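(* There is a constant $\delta>0$ such that the following holds. Let $k$ be a positive integer. For $n=2,3,\ldots$ let $R_n$ be a graph sampled uniformly at random from $(\mathrm{Ex}\,(k+1)C)_n$, and let $S_n$ be the set of vertices in $R_n$ with degree $>n/\ln n$. Let $\varepsilon>0$ be any constant. Then with probability $1-e^{-\Omega(n)}$ all of the following hold: (i) $|S_n|=k$ and $S_n$ is a blocker in $R_n$; (ii) each blocker in $R_n$ not containing $S_n$ (as a subset) has size $>\delta n$; and (iii) each vertex in $S_n$ has degree between $(\tfrac12-\varepsilon)n$ and $(\tfrac12+\varepsilon)n$.
   Context: Graphs are finite and simple. A set $B$ of vertices of a graph $G$ is a blocker if the graph $G-B$ obtained by deleting the vertices in $B$ has no cycles. $\mathrm{Ex}\,(k+1)C$ denotes the class of graphs which do not have $k+1$ pairwise vertex-disjoint cycles. For a class $\mathcal{A}$ of graphs, $\mathcal{A}_n$ denotes the set of graphs in $\mathcal{A}$ on the vertex set $\{1,\ldots,n\}$. An event holds with probability $1-e^{-\Omega(n)}$ if there is a constant $c>0$ (here possibly depending on $k$ and $\varepsilon$) such that for all sufficiently large $n$ it fails with probability at most $e^{-cn}$. *)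

theory Defs
  imports "HOL-Probability.Probability"
begin

record 'a ugraph =
  verts :: "'a set"
  edges :: "'a set set"

definition simple_graph :: "'a ugraph \<Rightarrow> bool" where
  "simple_graph G \<longleftrightarrow> finite (verts G) \<and> (\<forall>e\<in>edges G. e \<subseteq> verts G \<and> card e = 2)"

definition vdegree :: "'a ugraph \<Rightarrow> 'a \<Rightarrow> nat" where
  "vdegree G v = card {e \<in> edges G. v \<in> e}"

definition del_verts :: "'a ugraph \<Rightarrow> 'a set \<Rightarrow> 'a ugraph" where
  "del_verts G B = \<lparr>verts = verts G - B, edges = {e \<in> edges G. e \<inter> B = {}}\<rparr>"

text \<open>A cycle is given by the list of its vertices in cyclic order, without repeating the
  first vertex at the end.\<close>

definition is_cycle :: "'a ugraph \<Rightarrow> 'a list \<Rightarrow> bool" where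
  "is_cycle G c \<longleftrightarrow> length c \<ge> 3 \<and> distinct c \<and> set c \<subseteq> verts G \<and>
     (\<forall>i < length c. {c ! i, c ! (Suc i mod length c)} \<in> edges G)"

definition blocker :: "'a ugraph \<Rightarrow> 'a set \<Rightarrow> bool" where
  "blocker G B \<longleftrightarrow> B \<subseteq> verts G \<and> (\<nexists>c. is_cycle (del_verts G B) c)"

definition has_disjoint_cycles :: "'a ugraph \<Rightarrow> nat \<Rightarrow> bool" where
  "has_disjoint_cycles G m \<longleftrightarrow> (\<exists>c :: nat \<Rightarrow> 'a list.
     (\<forall>i<m. is_cycle G (c i)) \<and>
     (\<forall>i<m. \<forall>j<m. i \<noteq> j \<longrightarrow> set (c i) \<inter> set (c j) = {}))"

text \<open>The class \<open>Ex mC\<close>: graphs without \<open>m\<close> pairwise vertex-disjoint cycles.\<close>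

definition Ex_cycles :: "nat \<Rightarrow> 'a ugraph set" where
  "Ex_cycles m = {G. simple_graph G \<and> \<not> has_disjoint_cycles G m}"

definition labelled :: "nat ugraph set \<Rightarrow> nat \<Rightarrow> nat ugraph set" where
  "labelled \<A> n = {G \<in> \<A>. verts G = {1..n}}"

definition high_degree_verts :: "nat ugraph \<Rightarrow> nat \<Rightarrow> nat set" where
  "high_degree_verts G n = {v \<in> verts G. real (vdegree G v) > real n / ln (real n)}"

text \<open>The next two facts ensure that \<^const>\<open>pmf_of_set\<close> is the uniform distribution on
  \<open>labelled (Ex_cycles m) n\<close>.\<close>

lemma finite_labelled_Ex_cycles: "finite (labelled (Ex_cycles m) n)"
proof (rule finite_subset)
  show "labelled (Ex_cycles m) n \<subseteq>
      (\<lambda>E. \<lparr>verts = {1..n}, edges = E\<rparr>) ` Pow (Pow {1..n})"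
  proof
    fix G assume "G \<in> labelled (Ex_cycles m) n"
    then have "verts G = {1..n}" "edges G \<in> Pow (Pow {1..n})"
      by (auto simp: labelled_def Ex_cycles_def simple_graph_def)
    then show "G \<in> (\<lambda>E. \<lparr>verts = {1..n}, edges = E\<rparr>) ` Pow (Pow {1..n})"
      by (intro image_eqI[where x = "edges G"]) auto
  qed
qed simp

lemma labelled_Ex_cycles_nonempty:
  assumes "m \<ge> 1"
  shows "labelled (Ex_cycles m) n \<noteq> {}"
proof -
  have "\<not> is_cycle \<lparr>verts = {1..n}, edges = {}\<rparr> c" for c
    by (auto simp: is_cycle_def intro!: exI[of _ 0])
  then have "\<lparr>verts = {1..n}, edges = {}\<rparr> \<in> labelled (Ex_cycles m) n"
    using assms by (auto simp: labelled_def Ex_cycles_def simple_graph_def has_disjoint_cycles_def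
        intro!: exI[of _ 0])
  then show ?thesis by blast
qed

end

theory Submission
  imports Defs "HOL-Real_Asymp.Real_Asymp"
begin

text \<open>
  Every graph in \<open>Ex (k+1)C\<close> has a blocker of size \<open>O(k ln n)\<close>, because graphs of minimum degree
  three have short cycles. Enlarging it a little, one may split off a set \<open>S\<close> of at most \<open>k\<close> vertices
  such that every remaining vertex of the blocker closes no cycle with the forest \<open>F\<close> outside the
  blocker. Contracting the trees of \<open>F\<close> and using that graphs without \<open>k+1\<close> disjoint cycles have
  only linearly many edges, the graph without \<open>S\<close> has at most \<open>O(k)\<close> times (number of trees plus
  size of the blocker) edges outside \<open>F\<close>. As forests with \<open>\<kappa>\<close> components are rarer than all forests
  by a factor of about \<open>1/\<kappa>!\<close>, one may assume \<open>\<kappa> \<le> \<beta> n / ln n\<close>; then the graph without \<open>S\<close>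
  is a parent function plus \<open>O(\<beta> n / ln n)\<close> further edges, which costs only a factor
  \<open>exp (O(\<beta> n))\<close> with \<open>\<beta>\<close> as small as we like. Counting parent functions shows that, up to
  exponentially few exceptions, there is no other vertex of high degree, there is a linear matching,
  and every graph with a cycle but no short cycle is excluded since long paths are rare.
  Given the graph without \<open>S\<close>, the neighbourhoods of the vertices of \<open>S\<close> are arbitrary subsets, so
  all but an exponentially small proportion of them have about half the vertices and contain many
  matching edges. The triangles so obtained force \<open>S\<close> to be a blocker and make blockers that
  avoid a vertex of \<open>S\<close> large. All this is compared with the \<open>2^(k (n - k))\<close> times
  \<open>(n - k)^(n - k - 2)\<close> graphs in which \<open>{1..k}\<close> is a blocker, by Cayley's formula.
\<close>

section \<open>Cores instead of cycles\<close>

text \<open>All counts are measured in units of 2^(k n) (n+1)^n, which is above the size of the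
  class by at most a polynomial factor. So upper bounds may count arbitrary parent functions, at
  most (n+1)^n of them, and every exceptional family has to save an exponential factor. A set
  \<open>S\<close> with fewer than \<open>k\<close> vertices saves 2^(-n) at once. The delicate
  point is the price of the edges outside the forest: naming one freely costs about n^2, and the
  gain 1/\<kappa>! from \<kappa> trees cannot pay this for O(k \<kappa>) edges. But all of them
  touch the small set \<open>A\<close>, so there are only O(k n ln n) candidates, and the price is a
  power of ln n per tree. This excludes \<kappa> \<ge> \<beta> n / ln n at a rate depending on
  \<beta>; below that the edges are named freely for exp (O(k \<beta> n)) in total. Hence the order
  of choices: first the rate \<open>c1\<close> of the families that do not involve \<beta>, then
  \<beta> small against \<open>c1\<close>. The constant \<delta> is free of k and \<epsilon>: the
  matching (n/64 edges) comes from the forest, and the n/1024 of its edges seen by a vertex of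
  \<open>S\<close> come from one random subset.\<close>

definition graph2 :: "'a set set \<Rightarrow> bool" where
  "graph2 E \<longleftrightarrow> (\<forall>e\<in>E. card e = 2)"

definition nb :: "'a set set \<Rightarrow> 'a set \<Rightarrow> 'a \<Rightarrow> 'a set" where
  "nb E U x = {y \<in> U. {x, y} \<in> E}"

definition ec :: "'a set set \<Rightarrow> 'a set \<Rightarrow> nat" where
  "ec E U = card {e \<in> E. e \<subseteq> U}"

text \<open>A vertex set contains a cycle iff it contains a core, and this can be read off from edge
  counts.\<close>

definition core :: "'a set set \<Rightarrow> 'a set \<Rightarrow> bool" where
  "core E W \<longleftrightarrow> finite W \<and> W \<noteq> {} \<and> (\<forall>x\<in>W. card (nb E W x) \<ge> 2)"

definition coreless :: "'a set set \<Rightarrow> 'a set \<Rightarrow> bool" where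
  "coreless E U \<longleftrightarrow> (\<forall>W\<subseteq>U. \<not> core E W)"

definition disj_cores :: "'a set set \<Rightarrow> 'a set \<Rightarrow> nat \<Rightarrow> bool" where
  "disj_cores E U m \<longleftrightarrow> (\<exists>W :: nat \<Rightarrow> 'a set. (\<forall>i<m. core E (W i) \<and> W i \<subseteq> U) \<and>
     (\<forall>i<m. \<forall>j<m. i \<noteq> j \<longrightarrow> W i \<inter> W j = {}))"

lemma graph2_irrefl: "graph2 E \<Longrightarrow> {x} \<notin> E"
  by (auto simp: graph2_def)

lemma nb_subset: "nb E U x \<subseteq> U"
  by (auto simp: nb_def)

lemma finite_nb [simp]: "finite U \<Longrightarrow> finite (nb E U x)"
  by (auto simp: nb_def)

lemma nb_mono: "U \<subseteq> V \<Longrightarrow> nb E U x \<subseteq> nb E V x"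
  by (auto simp: nb_def)

lemma nb_insert: "nb E (insert z U) x = (if {x, z} \<in> E then insert z (nb E U x) else nb E U x)"
  by (auto simp: nb_def)

lemma nb_self: "graph2 E \<Longrightarrow> x \<notin> nb E U x"
  by (auto simp: nb_def graph2_def)

lemma nb_insert_self: "graph2 E \<Longrightarrow> nb E (insert x U) x = nb E U x"
  by (auto simp: nb_def graph2_def)

lemma finite_ec [simp]: "finite U \<Longrightarrow> finite {e \<in> E. e \<subseteq> U}"
  by (rule finite_subset[of _ "Pow U"]) auto

lemma ec_empty [simp]: "graph2 E \<Longrightarrow> ec E {} = 0"
  by (auto simp: ec_def graph2_def card_eq_0_iff)

lemma ec_insert:
  assumes "graph2 E" "finite U" "x \<notin> U"
  shows "ec E (insert x U) = ec E U + card (nb E U x)"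
proof -
  have eq: "{e \<in> E. e \<subseteq> insert x U} = {e \<in> E. e \<subseteq> U} \<union> (\<lambda>y. {x, y}) ` nb E U x"
  proof (intro set_eqI iffI)
    fix e assume e: "e \<in> {e \<in> E. e \<subseteq> insert x U}"
    then obtain a b where ab: "e = {a, b}" "a \<noteq> b" 
      using assms(1) by (auto simp: graph2_def card_2_iff)
    with e show "e \<in> {e \<in> E. e \<subseteq> U} \<union> (\<lambda>y. {x, y}) ` nb E U x"
      by (cases "a = x"; cases "b = x") (auto simp: nb_def insert_commute image_iff)
  qed (auto simp: nb_def)
  have "card ((\<lambda>y. {x, y}) ` nb E U x) = card (nb E U x)"
    by (rule card_image) (auto simp: inj_on_def doubleton_eq_iff)
  moreover have "{e \<in> E. e \<subseteq> U} \<inter> (\<lambda>y. {x, y}) ` nb E U x = {}"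
    using assms(3) by auto
  ultimately show ?thesis
    unfolding ec_def eq using assms(2) by (subst card_Un_disjoint) auto
qed

lemma ec_remove:
  assumes "graph2 E" "finite U" "x \<in> U"
  shows "ec E U = ec E (U - {x}) + card (nb E U x)"
proof -
  have "ec E (insert x (U - {x})) = ec E (U - {x}) + card (nb E (U - {x}) x)"
    using assms by (intro ec_insert) auto
  moreover have "nb E (U - {x}) x = nb E U x"
    using assms by (auto simp: nb_def graph2_def)
  moreover have "insert x (U - {x}) = U" using assms by auto
  ultimately show ?thesis by simp
qed

lemma handshake:
  assumes "graph2 E" "finite U"
  shows "(\<Sum>x\<in>U. card (nb E U x)) = 2 * ec E U"
  using assms(2)
proof (induction U)
  case empty
  then show ?case using assms(1) by simp
next
  case (insert x U)
  have "(\<Sum>y\<in>U. card (nb E (insert x U) y)) = (\<Sum>y\<in>U. card (nb E U y) + (if {x, y} \<in> E then 1 else 0))"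
  proof (intro sum.cong refl)
    fix y assume "y \<in> U"
    have "x \<notin> nb E U y" using insert nb_subset[of E U y] by auto
    then show "card (nb E (insert x U) y) = card (nb E U y) + (if {x, y} \<in> E then 1 else 0)"
      using insert by (auto simp: nb_insert insert_commute)
  qed
  also have "\<dots> = 2 * ec E U + card (nb E U x)"
    using insert by (simp add: sum.distrib sum.If_cases nb_def Int_def)
  finally show ?case
    using insert assms(1) by (simp add: ec_insert nb_insert_self)
qed

lemma core_ec:
  assumes "graph2 E" "core E W"
  shows "card W \<le> ec E W"
proof -
  have "2 * card W = (\<Sum>x\<in>W. 2)" by simp
  also have "\<dots> \<le> (\<Sum>x\<in>W. card (nb E W x))"
    using assms by (intro sum_mono) (auto simp: core_def)
  finally show ?thesis using assms by (simp add: handshake core_def)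
qed

text \<open>Remove a vertex with at most one neighbour: this costs at most one edge, so
  \<open>card U \<le> ec E U\<close> persists. A single vertex has no edge and violates the
  inequality, so the removal must stop earlier, at a core.\<close>

lemma ec_core:
  assumes "graph2 E" "finite U" "U \<noteq> {}" "card U \<le> ec E U"
  shows "\<exists>W\<subseteq>U. core E W"
  using assms(2-4)
proof (induction "card U" arbitrary: U rule: less_induct)
  case less
  show ?case
  proof (cases "core E U")
    case False
    then obtain x where x: "x \<in> U" "\<not> 2 \<le> card (nb E U x)"
      using less.prems unfolding core_def by blast
    have e: "card (U - {x}) \<le> ec E (U - {x})"
      using ec_remove[OF assms(1) less.prems(1) x(1)] x less.prems by simp
    have "U - {x} \<noteq> {}"
    proof
      assume "U - {x} = {}"
      then have "U = {x}" using x by auto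
      then have "ec E U = 0" using ec_insert[OF assms(1), of "{}" x] assms(1) by (simp add: nb_def)
      then show False using less.prems by simp
    qed
    moreover have "card (U - {x}) < card U" using x less.prems(1) by (intro card_Diff1_less)
    ultimately obtain W where "W \<subseteq> U - {x}" "core E W"
      using less.hyps[of "U - {x}"] e less.prems by auto
    then show ?thesis by auto
  qed auto
qed

lemma coreless_ec:
  assumes "graph2 E" "finite U" "U \<noteq> {}" "coreless E U"
  shows "ec E U < card U"
  using ec_core[OF assms(1-3)] assms(4) unfolding coreless_def by (metis not_less)

lemma coreless_ec_le:
  assumes "graph2 E" "finite U" "coreless E U"
  shows "ec E U \<le> card U"
  using coreless_ec[OF assms(1,2) _ assms(3)] assms(1) by (cases "U = {}") auto

lemma coreless_subset: "coreless E U \<Longrightarrow> V \<subseteq> U \<Longrightarrow> coreless E V"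
  by (auto simp: coreless_def)

lemma core_triangle:
  assumes "graph2 E" "{x, y} \<in> E" "{y, z} \<in> E" "{x, z} \<in> E"
  shows "core E {x, y, z}"
proof -
  have d: "x \<noteq> y" "y \<noteq> z" "x \<noteq> z" using assms by (auto simp: graph2_def)
  have *: "2 \<le> card (nb E W w)" if "finite W" "a \<in> nb E W w" "b \<in> nb E W w" "a \<noteq> b" for W w a b
    using that card_mono[of "nb E W w" "{a, b}"] by simp
  have "2 \<le> card (nb E {x, y, z} x)" "2 \<le> card (nb E {x, y, z} y)" "2 \<le> card (nb E {x, y, z} z)"
    using assms d by (intro *[of _ y _ z] *[of _ x _ z] *[of _ x _ y]; simp add: nb_def insert_commute)+
  then show ?thesis by (simp add: core_def)
qed

lemma disj_cores_0 [simp]: "disj_cores E U 0"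
  by (auto simp: disj_cores_def)

lemma disj_coresE:
  assumes "disj_cores E U m"
  obtains W where "\<forall>i<m. core E (W i)" "\<forall>i<m. W i \<subseteq> U"
    "\<forall>i<m. \<forall>j<m. i \<noteq> j \<longrightarrow> W i \<inter> W j = {}"
proof -
  obtain W where "(\<forall>i<m. core E (W i) \<and> W i \<subseteq> U) \<and> (\<forall>i<m. \<forall>j<m. i \<noteq> j \<longrightarrow> W i \<inter> W j = {})"
    using assms unfolding disj_cores_def ..
  then show thesis by (intro that[of W]) simp_all
qed

lemma disj_coresI:
  assumes "\<And>i. i < m \<Longrightarrow> core E (W i)" "\<And>i. i < m \<Longrightarrow> W i \<subseteq> U"
    "\<And>i j. i < m \<Longrightarrow> j < m \<Longrightarrow> i \<noteq> j \<Longrightarrow> W i \<inter> W j = {}"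
  shows "disj_cores E U m"
  unfolding disj_cores_def using assms by (intro exI[of _ W]) simp

lemma disj_cores_Suc:
  assumes "disj_cores E V m" "V \<subseteq> U" "core E C" "C \<subseteq> U" "C \<inter> V = {}"
  shows "disj_cores E U (Suc m)"
proof -
  obtain W where W: "\<forall>i<m. core E (W i)" "\<forall>i<m. W i \<subseteq> V"
    "\<forall>i<m. \<forall>j<m. i \<noteq> j \<longrightarrow> W i \<inter> W j = {}"
    using assms(1)
    by (rule disj_coresE)
  let ?W = "\<lambda>i. if i < m then W i else C"
  have "core E (?W i)" "?W i \<subseteq> U" for i
    using W(1,2) assms(2,3,4) by auto
  moreover have "?W i \<inter> ?W j = {}" if ij: "i < Suc m" "j < Suc m" "i \<noteq> j" for i j
  proof (cases "i < m \<and> j < m")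
    case True
    then show ?thesis using W(3) ij by simp
  next
    case False
    then consider "i = m" "j < m" | "j = m" "i < m" using ij by linarith
    then show ?thesis
    proof cases
      case 1
      then show ?thesis using W(2) assms(5) by fastforce
    next
      case 2
      then show ?thesis using W(2) assms(5) by fastforce
    qed
  qed
  ultimately show ?thesis by (rule disj_coresI)
qed

lemma disj_cores_1:
  assumes "core E C" "C \<subseteq> U"
  shows "disj_cores E U 1"
  using disj_cores_Suc[of E "{}" 0 U C] assms by simp

lemma not_disj_cores_1: "\<not> disj_cores E U 1 \<longleftrightarrow> coreless E U"
  using disj_cores_1 unfolding coreless_def by (auto simp: disj_cores_def)

lemma disj_cores_mono:
  assumes "disj_cores E V m" "V \<subseteq> U"
  shows "disj_cores E U m"
proof -
  obtain W where W: "\<forall>i<m. core E (W i)" "\<forall>i<m. W i \<subseteq> V"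
    "\<forall>i<m. \<forall>j<m. i \<noteq> j \<longrightarrow> W i \<inter> W j = {}"
    using assms(1)
    by (rule disj_coresE)
  then show ?thesis using assms(2) by (intro disj_coresI[of m E W]) (auto simp: subset_iff)
qed

lemma cycle_core:
  assumes "is_cycle G c"
  shows "core (edges G) (set c)" 
proof -
  let ?n = "length c"
  have n: "?n \<ge> 3" "distinct c" "\<And>i. i < ?n \<Longrightarrow> {c ! i, c ! (Suc i mod ?n)} \<in> edges G"
    using assms by (auto simp: is_cycle_def)
  have "2 \<le> card (nb (edges G) (set c) x)" if x: "x \<in> set c" for x
  proof -
    obtain i where i: "i < ?n" "x = c ! i" using x by (metis in_set_conv_nth)
    define j where "j = Suc i mod ?n"
    define l where "l = (if i = 0 then ?n - 1 else i - 1)"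
    have l: "l < ?n" "Suc l mod ?n = i" using i n(1) by (auto simp: l_def)
    have j: "j < ?n" using i unfolding j_def by (intro mod_less_divisor) auto
    have "j \<noteq> l"
      using i n(1) by (auto simp: j_def l_def mod_Suc)
    then have ne: "c ! j \<noteq> c ! l" using n(2) j l(1) by (simp add: nth_eq_iff_index_eq)
    have "{x, c ! j} \<in> edges G" using n(3)[OF i(1)] i j_def by simp
    moreover have "{x, c ! l} \<in> edges G" using n(3)[OF l(1)] l i by (simp add: insert_commute)
    ultimately have "{c ! j, c ! l} \<subseteq> nb (edges G) (set c) x"
      using j l by (auto simp: nb_def)
    then have "card {c ! j, c ! l} \<le> card (nb (edges G) (set c) x)"
      by (intro card_mono) auto
    then show ?thesis using ne by simp
  qed
  moreover have "set c \<noteq> {}" using n(1) by auto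
  ultimately show ?thesis by (auto simp: core_def)
qed

text \<open>Take a longest path in \<open>W\<close>. By maximality all neighbours of its first
  vertex lie on it; there are at least two, so one of them comes after the second vertex and closes
  an initial segment to a cycle.\<close>

lemma core_cycle:
  assumes "graph2 (edges G)" "core (edges G) W" "W \<subseteq> verts G"
  shows "\<exists>c. is_cycle G c \<and> set c \<subseteq> W"
proof -
  let ?E = "edges G"
  define P where "P c \<longleftrightarrow> c \<noteq> [] \<and> distinct c \<and> set c \<subseteq> W \<and> 
     (\<forall>i. Suc i < length c \<longrightarrow> {c ! i, c ! Suc i} \<in> ?E)" for c
  have W: "finite W" "W \<noteq> {}" "\<And>x. x \<in> W \<Longrightarrow> card (nb ?E W x) \<ge> 2"
    using assms(2) by (auto simp: core_def)
  obtain w where "w \<in> W" using W by auto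
  then have Pw: "P [w]" by (auto simp: P_def)
  have bound: "length c < Suc (card W)" if "P c" for c
  proof -
    have "length c = card (set c)" using that by (simp add: P_def distinct_card)
    also have "\<dots> \<le> card W" using that W by (intro card_mono) (auto simp: P_def)
    finally show ?thesis by simp
  qed
  obtain c where c: "P c" "\<And>d. P d \<Longrightarrow> length d \<le> length c"
    using ex_has_greatest_nat[of P "[w]" length "Suc (card W)"] Pw bound by (metis less_imp_le)
  have c0: "c \<noteq> []" "distinct c" "set c \<subseteq> W" "\<And>i. Suc i < length c \<Longrightarrow> {c ! i, c ! Suc i} \<in> ?E"
    using c(1) by (auto simp: P_def)
  have hd: "hd c \<in> W" using c0 by auto
  have nbc: "nb ?E W (hd c) \<subseteq> set c"
  proof
    fix y assume y: "y \<in> nb ?E W (hd c)"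
    show "y \<in> set c"
    proof (rule ccontr)
      assume "y \<notin> set c"
      then have "P (y # c)"
        using c0 y by (auto simp: P_def nb_def hd_conv_nth nth_Cons insert_commute split: nat.splits)
      then show False using c(2) by fastforce
    qed
  qed
  \<comment> \<open>For a one-vertex path \<open>c ! 1\<close> is an unspecified value; the set
    still has a single element, so the count covers this case too.\<close>
  have "\<not> nb ?E W (hd c) \<subseteq> {c ! 1}"
    using W(3)[OF hd] card_mono[of "{c ! 1}" "nb ?E W (hd c)"] by auto
  then obtain y where y: "y \<in> nb ?E W (hd c)" "y \<noteq> c ! 1" by auto
  then obtain j where j: "j < length c" "y = c ! j" using nbc by (metis in_set_conv_nth subsetD)
  have "y \<noteq> hd c" using y(1) nb_self[OF assms(1)] by auto
  then have "j \<noteq> 0" using j c0 by (metis hd_conv_nth)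
  moreover have "j \<noteq> 1" using j y by auto
  ultimately have j2: "j \<ge> 2" by auto
  let ?d = "take (Suc j) c"
  have "is_cycle G ?d"
    unfolding is_cycle_def
  proof (intro conjI allI impI)
    show "3 \<le> length ?d" using j2 j by auto
    show "distinct ?d" using c0 by auto
    show "set ?d \<subseteq> verts G" using c0 assms(3) set_take_subset[of "Suc j" c] by blast
    fix i assume i: "i < length ?d"
    then have i': "i < Suc j" using j by simp
    have len: "length ?d = Suc j" using j by auto
    show "{?d ! i, ?d ! (Suc i mod length ?d)} \<in> ?E"
    proof (cases "i = j")
      case True
      then show ?thesis using len y j c0 by (auto simp: nb_def hd_conv_nth insert_commute)
    next
      case False
      then have "Suc i mod length ?d = Suc i" using i' len by auto
      then show ?thesis using False i' c0(4)[of i] j by auto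
    qed
  qed
  then show ?thesis using c0(3) set_take_subset[of "Suc j" c] by blast
qed

lemma simple_graph2: "simple_graph G \<Longrightarrow> graph2 (edges G)"
  by (auto simp: simple_graph_def graph2_def)

lemma core_del_verts:
  assumes "W \<inter> B = {}"
  shows "core (edges (del_verts G B)) W \<longleftrightarrow> core (edges G) W"
proof -
  have "nb (edges (del_verts G B)) W x = nb (edges G) W x" if "x \<in> W" for x
    using assms that by (auto simp: nb_def del_verts_def)
  then show ?thesis by (simp add: core_def)
qed

lemma blocker_iff_coreless:
  assumes "simple_graph G"
  shows "blocker G B \<longleftrightarrow> B \<subseteq> verts G \<and> coreless (edges G) (verts G - B)"
proof -
  have "graph2 (edges (del_verts G B))" using simple_graph2[OF assms] by (auto simp: graph2_def del_verts_def)
  moreover have "verts (del_verts G B) = verts G - B" by (simp add: del_verts_def)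
  moreover have "is_cycle (del_verts G B) c \<Longrightarrow> set c \<subseteq> verts G - B" for c
    by (auto simp: is_cycle_def del_verts_def)
  moreover have "core (edges (del_verts G B)) W \<longleftrightarrow> core (edges G) W" if "W \<subseteq> verts G - B" for W
    using that by (intro core_del_verts) auto
  ultimately have "(\<exists>c. is_cycle (del_verts G B) c) \<longleftrightarrow> (\<exists>W\<subseteq>verts G - B. core (edges G) W)"
    using cycle_core[of "del_verts G B"] core_cycle[of "del_verts G B"] by metis
  then show ?thesis by (auto simp: blocker_def coreless_def)
qed

lemma has_disjoint_cycles_iff:
  assumes "simple_graph G"
  shows "has_disjoint_cycles G m \<longleftrightarrow> disj_cores (edges G) (verts G) m"
proof
  assume "has_disjoint_cycles G m"
  then obtain c where c: "(\<forall>i<m. is_cycle G (c i)) \<and> 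
     (\<forall>i<m. \<forall>j<m. i \<noteq> j \<longrightarrow> set (c i) \<inter> set (c j) = {})"
    unfolding has_disjoint_cycles_def ..
  show "disj_cores (edges G) (verts G) m"
  proof (rule disj_coresI)
    fix i assume i: "i < m"
    then show "core (edges G) (set (c i))" using c by (simp add: cycle_core)
    show "set (c i) \<subseteq> verts G" using c i by (auto simp: is_cycle_def)
  qed (use c in auto)
next
  assume "disj_cores (edges G) (verts G) m"
  then obtain W where W: "\<forall>i<m. core (edges G) (W i)" "\<forall>i<m. W i \<subseteq> verts G"
    "\<forall>i<m. \<forall>j<m. i \<noteq> j \<longrightarrow> W i \<inter> W j = {}"

    by (rule disj_coresE)
  have "\<forall>i. \<exists>c. i < m \<longrightarrow> is_cycle G c \<and> set c \<subseteq> W i"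
    using core_cycle[OF simple_graph2[OF assms]] W(1,2) by blast
  then obtain c where c: "\<forall>i. i < m \<longrightarrow> is_cycle G (c i) \<and> set (c i) \<subseteq> W i" 
    using choice[of "\<lambda>i c. i < m \<longrightarrow> is_cycle G c \<and> set c \<subseteq> W i"] by blast
  show "has_disjoint_cycles G m"
    unfolding has_disjoint_cycles_def
  proof (intro exI[of _ c] conjI allI impI)
    fix i j assume "i < m" "j < m" "i \<noteq> j"
    then show "set (c i) \<inter> set (c j) = {}" using c W(3) by blast
  qed (use c in auto)
qed

section \<open>Edge counts and blockers\<close>

lemma nb_Un: "nb E (U \<union> V) x = nb E U x \<union> nb E V x"
  by (auto simp: nb_def)

lemma ec_Un:
  assumes "graph2 E" "finite C" "finite D" "C \<inter> D = {}"
  shows "ec E (C \<union> D) = ec E C + ec E D + (\<Sum>v\<in>D. card (nb E C v))"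
  using assms(3,4)
proof (induction D)
  case empty
  then show ?case using assms(1) by simp
next
  case (insert v D)
  have "ec E (C \<union> insert v D) = ec E (insert v (C \<union> D))" by simp
  also have "\<dots> = ec E (C \<union> D) + card (nb E (C \<union> D) v)"
    using assms insert by (intro ec_insert) auto
  also have "card (nb E (C \<union> D) v) = card (nb E C v) + card (nb E D v)"
  proof -
    have "nb E C v \<inter> nb E D v = {}" using insert.prems by (auto simp: nb_def)
    then show ?thesis unfolding nb_Un using assms(2) insert by (intro card_Un_disjoint) auto
  qed
  finally show ?case using insert assms(1) by (simp add: ec_insert)
qed

lemma card_insert_le_Suc: "card (insert x S) \<le> Suc (card S)"
  by (cases "finite S") (simp_all add: card_insert_if)

lemma two_le_cardI:
  assumes "finite S" "a \<in> S" "b \<in> S" "a \<noteq> b"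
  shows "2 \<le> card S"
  using assms card_mono[of S "{a, b}"] by simp

lemma two_le_cardE:
  assumes "2 \<le> card S"
  obtains a b where "a \<in> S" "b \<in> S" "a \<noteq> b"
  using assms by (metis card_2_iff' obtain_subset_with_card_n subsetD)

section \<open>Minimal cores and the linear bound on the number of edges\<close>

lemma core_card:
  assumes "graph2 E" "core E W"
  shows "3 \<le> card W"
proof -
  obtain x where x: "x \<in> W" using assms by (auto simp: core_def)
  then have "2 \<le> card (nb E W x)" using assms by (auto simp: core_def)
  moreover have "nb E W x \<subseteq> W - {x}" using nb_self[OF assms(1)] by (auto simp: nb_def)
  moreover have "finite W" using assms(2) by (simp add: core_def)
  ultimately have "2 \<le> card (W - {x})" by (meson card_mono finite_Diff le_trans)
  then show ?thesis using x \<open>finite W\<close> by simp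
qed

text \<open>An inclusion-minimal core is a cycle. Deleting \<open>x\<close> leaves a coreless set,
  hence fewer than \<open>card C - 1\<close> edges, so every degree is at least
  \<open>2 + ec E C - card C\<close>. With \<open>ec E C = card C + d\<close> the degree sum gives
  \<open>card C * d \<le> 2 * d\<close>, and \<open>card C \<ge> 3\<close> forces
  \<open>d = 0\<close>.\<close>

lemma min_core:
  assumes "graph2 E" "core E C" "\<And>D. D \<subset> C \<Longrightarrow> \<not> core E D"
  shows "ec E C = card C" "x \<in> C \<Longrightarrow> card (nb E C x) = 2"
proof -
  have fin: "finite C" and "C \<noteq> {}" and deg: "\<And>x. x \<in> C \<Longrightarrow> 2 \<le> card (nb E C x)"
    using assms(2) by (auto simp: core_def)
  have c3: "3 \<le> card C" by (rule core_card[OF assms(1,2)])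
  have low: "ec E C + 2 \<le> card (nb E C x) + card C" if x: "x \<in> C" for x
  proof -
    have "card (C - {x}) \<noteq> 0" using c3 x fin by simp
    then have "C - {x} \<noteq> {}" by (metis card.empty)
    moreover have "coreless E (C - {x})"
      unfolding coreless_def using assms(3) x by blast
    ultimately have "ec E (C - {x}) < card (C - {x})"
      using assms(1) fin by (intro coreless_ec) auto
    then show ?thesis using ec_remove[OF assms(1) fin x] x fin c3 by simp
  qed
  have "card C * (ec E C + 2) \<le> (\<Sum>x\<in>C. card (nb E C x) + card C)"
    using sum_mono[of C "\<lambda>_. ec E C + 2", OF low] by simp
  also have "\<dots> = 2 * ec E C + card C * card C"
    using handshake[OF assms(1) fin] by (simp add: sum.distrib)
  finally have *: "card C * (ec E C + 2) \<le> 2 * ec E C + card C * card C" .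
  obtain d where d: "ec E C = card C + d"
    using core_ec[OF assms(1,2)] le_Suc_ex by blast
  have "card C * d \<le> 2 * d" using * unfolding d by (simp add: algebra_simps)
  moreover have "3 * d \<le> card C * d" using c3 by simp
  ultimately have "d = 0" by linarith
  then show e: "ec E C = card C" using d by simp
  show "card (nb E C x) = 2" if x: "x \<in> C"
  proof (rule ccontr)
    assume "card (nb E C x) \<noteq> 2"
    then have "2 < card (nb E C x)" using deg[OF x] by simp
    then have "(\<Sum>x\<in>C. 2) < (\<Sum>x\<in>C. card (nb E C x))"
      using fin deg x by (intro sum_strict_mono_ex1) auto
    then show False using handshake[OF assms(1) fin] e by simp
  qed
qed

text \<open>Deleting two neighbours of \<open>v\<close> from \<open>insert v C\<close> destroys at most six edges, so five
  neighbours would leave a shorter core.\<close>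

lemma min_card_core_nb:
  assumes "graph2 E" "core E C" "\<And>D. D \<subseteq> insert v C \<Longrightarrow> core E D \<Longrightarrow> card C \<le> card D" "v \<notin> C"
  shows "card (nb E C v) \<le> 4"
proof (rule ccontr)
  assume "\<not> card (nb E C v) \<le> 4"
  then have n5: "5 \<le> card (nb E C v)" by simp
  have fin: "finite C" using assms(2) by (simp add: core_def)
  have c5: "5 \<le> card C" using n5 card_mono[OF fin nb_subset[of E C v]] by simp
  have minC: "\<not> core E D" if "D \<subset> C" for D
    using assms(3)[of D] psubset_card_mono[OF fin that] that by force
  have mc: "ec E C = card C" "\<And>x. x \<in> C \<Longrightarrow> card (nb E C x) = 2"
    using min_core[OF assms(1,2)] minC by blast+
  have "2 \<le> card (nb E C v)" using n5 by simp
  then obtain a b where ab: "a \<in> nb E C v" "b \<in> nb E C v" "a \<noteq> b" by (rule two_le_cardE)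
  have abC: "a \<in> C" "b \<in> C" using ab by (auto simp: nb_def)
  have deg3: "card (nb E (insert v C) x) \<le> 3" if "x \<in> C" for x
  proof -
    have "card (nb E (insert v C) x) \<le> card (insert v (nb E C x))"
      using fin by (intro card_mono) (auto simp: nb_def)
    also have "\<dots> \<le> 3" using mc(2)[OF that] fin by (simp add: card_insert_if)
    finally show ?thesis .
  qed
  let ?D = "insert v C - {a} - {b}"
  have "ec E (insert v C) = ec E (insert v C - {a}) + card (nb E (insert v C) a)"
    using assms fin abC by (intro ec_remove) auto
  moreover have "ec E (insert v C - {a}) = ec E ?D + card (nb E (insert v C - {a}) b)"
    using assms fin abC ab by (intro ec_remove) auto
  moreover have "card (nb E (insert v C - {a}) b) \<le> card (nb E (insert v C) b)"
    using fin by (intro card_mono) (auto simp: nb_def)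
  moreover have "ec E (insert v C) = card C + card (nb E C v)"
    using ec_insert[OF assms(1) fin assms(4)] mc(1) by simp
  ultimately have e: "ec E ?D + 1 \<ge> card C"
    using deg3[OF abC(1)] deg3[OF abC(2)] n5 by linarith
  have cD: "card ?D = card C - 1" using fin assms(4) abC ab by simp
  moreover have "?D \<noteq> {}" using abC assms(4) by auto
  ultimately have "\<exists>W\<subseteq>?D. core E W"
    using e fin by (intro ec_core[OF assms(1)]) auto
  then obtain W where W: "W \<subseteq> ?D" "core E W" by blast
  then have "card W \<le> card ?D" using fin by (intro card_mono) auto
  moreover have "card C \<le> card W" using W by (intro assms(3)) auto
  ultimately show False using cD c5 by simp
qed

text \<open>Remove a core \<open>C\<close> of least size. It spans only \<open>card C\<close> edges
  and receives at most four from each vertex outside, and what is left has one disjoint core fewer.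
  So five more edges per vertex suffice for each unit of \<open>k\<close>.\<close>

lemma ec_linear:
  assumes "graph2 E" "finite U" "\<not> disj_cores E U (Suc k)"
  shows "ec E U \<le> (5 * k + 1) * card U"
  using assms(2,3)
proof (induction k arbitrary: U)
  case 0
  then have "coreless E U" using not_disj_cores_1[of E U] by simp
  then show ?case using coreless_ec_le[OF assms(1)] 0 by simp
next
  case (Suc k)
  show ?case
  proof (cases "coreless E U")
    case True
    then show ?thesis
      by (intro order_trans[OF coreless_ec_le[OF assms(1) Suc.prems(1)]]) simp_all
  next
    case False
    then obtain C0 where "core E C0 \<and> C0 \<subseteq> U" by (auto simp: coreless_def)
    then obtain C where C: "core E C \<and> C \<subseteq> U" 
        "\<And>D. core E D \<and> D \<subseteq> U \<Longrightarrow> card C \<le> card D"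
      using exists_least_lemma[of "\<lambda>n. \<exists>C. core E C \<and> C \<subseteq> U \<and> card C = n"]
        ex_has_least_nat[of "\<lambda>C. core E C \<and> C \<subseteq> U" C0 card] by blast
    have fin: "finite C" using C by (simp add: core_def)
    have "ec E C = card C"
    proof (rule min_core)
      fix D assume "D \<subset> C"
      then show "\<not> core E D" using C(2)[of D] C(1) psubset_card_mono[OF fin, of D] by force
    qed (use assms C in auto)
    have nb4: "card (nb E C v) \<le> 4" if "v \<in> U - C" for v
      using that C by (intro min_card_core_nb[OF assms(1)]) blast+
    have "\<not> disj_cores E (U - C) (Suc k)"
    proof
      assume "disj_cores E (U - C) (Suc k)"
      then have "disj_cores E U (Suc (Suc k))" by (rule disj_cores_Suc[of _ _ _ _ C]) (use C in auto)
      then show False using Suc.prems by simp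
    qed
    then have IH: "ec E (U - C) \<le> (5 * k + 1) * card (U - C)" using Suc by auto
    have "U = C \<union> (U - C)" using C by auto
    then have "ec E U = ec E C + ec E (U - C) + (\<Sum>v\<in>U - C. card (nb E C v))"
      using ec_Un[OF assms(1) fin, of "U - C"] Suc.prems by auto
    also have "\<dots> \<le> card C + (5 * k + 1) * card (U - C) + 4 * card (U - C)"
      using sum_mono[of "U - C" "\<lambda>v. card (nb E C v)" "\<lambda>_. 4", OF nb4] IH \<open>ec E C = card C\<close> by simp
    also have "\<dots> \<le> (5 * Suc k + 1) * (card C + card (U - C))"
      by (simp add: algebra_simps)
    also have "card C + card (U - C) = card U"
      using C Suc.prems fin card_mono[of U C] by (simp add: card_Diff_subset)
    finally show ?thesis .
  qed
qed

section \<open>Connected sets, and blocker vertices that close no cycle with the forest\<close>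

inductive conn :: "'a set set \<Rightarrow> 'a \<Rightarrow> 'a set \<Rightarrow> bool" for E x where
  conn_single: "conn E x {x}"
| conn_insert: "conn E x U \<Longrightarrow> y \<notin> U \<Longrightarrow> nb E U y \<noteq> {} \<Longrightarrow> conn E x (insert y U)"

lemma conn_finite: "conn E x U \<Longrightarrow> finite U"
  by (induction rule: conn.induct) auto

lemma conn_root: "conn E x U \<Longrightarrow> x \<in> U"
  by (induction rule: conn.induct) auto

lemma conn_ec:
  assumes "graph2 E" "conn E x U"
  shows "card U \<le> Suc (ec E U)"
  using assms(2)
proof (induction rule: conn.induct)
  case (conn_insert U y)
  have fin: "finite U" by (rule conn_finite[OF conn_insert.hyps(1)])
  then have "1 \<le> card (nb E U y)" using conn_insert by (simp add: Suc_le_eq card_gt_0_iff)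
  then show ?case using conn_insert fin ec_insert[OF assms(1) fin, of y] by simp
qed simp

lemma conn_Un:
  assumes "conn E x U" "conn E x V"
  shows "conn E x (U \<union> V)"
  using assms(2)
proof (induction rule: conn.induct)
  case conn_single
  then show ?case using assms(1) conn_root by (metis Un_insert_right insert_absorb sup_bot.right_neutral)
next
  case (conn_insert V y)
  show ?case
  proof (cases "y \<in> U")
    case True
    then show ?thesis using conn_insert.IH by (simp add: insert_absorb)
  next
    case False
    then have "conn E x (insert y (U \<union> V))"
      using conn_insert by (intro conn.conn_insert) (auto simp: nb_Un)
    then show ?thesis by simp
  qed
qed

lemma ex_component:
  assumes "finite P" "u \<in> P"
  obtains K where "conn E u K" "K \<subseteq> P" "\<And>y. y \<in> P - K \<Longrightarrow> nb E K y = {}"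
proof -
  have "conn E u {u} \<and> {u} \<subseteq> P" using assms by (auto intro: conn.intros)
  moreover have "\<forall>K. conn E u K \<and> K \<subseteq> P \<longrightarrow> card K < Suc (card P)"
    using assms(1) by (auto simp: less_Suc_eq_le intro: card_mono)
  ultimately obtain K where K: "conn E u K" "K \<subseteq> P" "\<And>L. conn E u L \<Longrightarrow> L \<subseteq> P \<Longrightarrow> card L \<le> card K"
    using ex_has_greatest_nat[of "\<lambda>K. conn E u K \<and> K \<subseteq> P" "{u}" card "Suc (card P)"] by (metis less_imp_le)
  have "nb E K y = {}" if y: "y \<in> P - K" for y
  proof (rule ccontr)
    assume "nb E K y \<noteq> {}"
    then have "conn E u (insert y K)" using K y by (intro conn.intros) auto
    then have "card (insert y K) \<le> card K" using K y by (intro K(3)) auto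
    then show False using y conn_finite[OF K(1)] by simp
  qed
  then show thesis using that K by blast
qed

text \<open>A core in the union splits at \<open>w\<close> into two parts without edges between
  them. Each part together with \<open>w\<close> has fewer edges than vertices, and adding up, so
  has the whole, against \<open>core_ec\<close>.\<close>

lemma coreless_glue:
  assumes "graph2 E" "finite P" "finite Q" "P \<inter> Q = {}" "\<And>u. u \<in> Q \<Longrightarrow> nb E P u = {}"
    and "w \<notin> P \<union> Q" "coreless E (insert w P)" "coreless E (insert w Q)"
  shows "coreless E (insert w (P \<union> Q))"
  unfolding coreless_def
proof (intro allI impI notI)
  fix W assume W: "W \<subseteq> insert w (P \<union> Q)" "core E W"
  define P' Q' where "P' = W \<inter> P" and "Q' = W \<inter> Q"
  have fin: "finite P'" "finite Q'" using assms by (auto simp: P'_def Q'_def)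
  have PQ: "ec E (P' \<union> Q') = ec E P' + ec E Q'"
  proof -
    have "nb E P' v = {}" if "v \<in> Q'" for v
      using assms(5)[of v] that nb_mono[of P' P E v] by (auto simp: P'_def Q'_def)
    moreover have "P' \<inter> Q' = {}" using assms(4) by (auto simp: P'_def Q'_def)
    ultimately show ?thesis using ec_Un[OF assms(1) fin] by simp
  qed
  have sub: "P' \<subseteq> insert w P" "Q' \<subseteq> insert w Q" by (auto simp: P'_def Q'_def)
  have cPQ: "card (P' \<union> Q') = card P' + card Q'"
    using fin assms(4) by (intro card_Un_disjoint) (auto simp: P'_def Q'_def)
  have "ec E W < card W"
  proof (cases "w \<in> W")
    case True
    then have WW: "W = insert w (P' \<union> Q')" using W(1) by (auto simp: P'_def Q'_def)
    have nw: "w \<notin> P'" "w \<notin> Q'" using assms(6) by (auto simp: P'_def Q'_def)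
    have "ec E (insert w P') < card (insert w P')"
      using assms(1,7) fin by (intro coreless_ec) (auto intro: coreless_subset simp: P'_def)
    moreover have "ec E (insert w Q') < card (insert w Q')"
      using assms(1,8) fin by (intro coreless_ec) (auto intro: coreless_subset simp: Q'_def)
    moreover have "card (nb E (P' \<union> Q') w) \<le> card (nb E P' w) + card (nb E Q' w)"
      unfolding nb_Un by (rule card_Un_le)
    moreover have "card W = Suc (card P' + card Q')" unfolding WW using nw fin cPQ by simp
    moreover have "ec E W = ec E (P' \<union> Q') + card (nb E (P' \<union> Q') w)"
      unfolding WW using nw fin by (intro ec_insert[OF assms(1)]) auto
    ultimately show ?thesis
      using PQ ec_insert[OF assms(1) fin(1) nw(1)] ec_insert[OF assms(1) fin(2) nw(2)] nw fin by simp
  next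
    case False
    then have WW: "W = P' \<union> Q'" using W(1) by (auto simp: P'_def Q'_def)
    have "P' \<noteq> {} \<Longrightarrow> ec E P' < card P'" "Q' \<noteq> {} \<Longrightarrow> ec E Q' < card Q'"
      using assms(1,7,8) fin sub by (blast intro: coreless_ec coreless_subset)+
    moreover have "P' \<noteq> {} \<or> Q' \<noteq> {}" using W(2) WW by (auto simp: core_def)
    moreover have "ec E P' \<le> card P'" "ec E Q' \<le> card Q'"
      using assms(1,7,8) fin sub by (blast intro: coreless_ec_le coreless_subset)+
    ultimately show ?thesis unfolding WW using PQ cPQ by linarith
  qed
  then show False using core_ec[OF assms(1) W(2)] by simp
qed

lemma coreless_conn_nb:
  assumes "graph2 E" "conn E u K" "x \<notin> K" "coreless E (insert x K)"
  shows "card (nb E K x) \<le> 1"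
proof -
  have fin: "finite K" using assms(2) by (rule conn_finite)
  have "ec E (insert x K) < card (insert x K)"
    using assms fin by (intro coreless_ec) auto
  then show ?thesis
    using ec_insert[OF assms(1) fin assms(3)] conn_ec[OF assms(1,2)] fin assms(3) by simp
qed

text \<open>\<open>U\<close> is a branch of the forest \<open>F\<close>: only its attachment vertex
  \<open>x\<close> has neighbours in \<open>F - U\<close>. A smallest branch that closes a core with
  some vertex of \<open>A\<close> works: if some \<open>w\<close> still closed a core with
  \<open>U - {x}\<close>, a single component \<open>P\<close> of \<open>U - {x}\<close> would do so,
  and \<open>P\<close> is a smaller branch because the forest has at most one edge from
  \<open>x\<close> to \<open>P\<close>.\<close>

lemma ex_branch:
  assumes "graph2 E" "finite F" "coreless E F" "A \<inter> F = {}" "v0 \<in> A" "\<not> coreless E (insert v0 F)"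
  obtains U x v where "U \<subseteq> F" "x \<in> U" "\<forall>u\<in>U - {x}. nb E (F - U) u = {}"
    "v \<in> A" "\<not> coreless E (insert v U)" "\<forall>w\<in>A. coreless E (insert w (U - {x}))"
proof -
  define B where "B = (\<lambda>(U, x). U \<subseteq> F \<and> x \<in> U \<and> (\<forall>u\<in>U - {x}. nb E (F - U) u = {}) \<and>
     (\<exists>v\<in>A. \<not> coreless E (insert v U)))"
  have "F \<noteq> {}"
  proof
    assume "F = {}"
    then obtain W where "W \<subseteq> {v0}" "core E W" using assms(6) by (auto simp: coreless_def)
    then show False using core_card[OF assms(1), of W] card_mono[of "{v0}" W] by simp
  qed
  then obtain x0 where "x0 \<in> F" by auto
  then have "B (F, x0)" using assms by (auto simp: B_def nb_def)
  then obtain U x where UB: "B (U, x)" and min: "\<And>U' x'. B (U', x') \<Longrightarrow> card U \<le> card U'"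
    using ex_has_least_nat[of B "(F, x0)" "\<lambda>p. card (fst p)"] by (metis fst_conv surj_pair)
  then have U: "U \<subseteq> F" "x \<in> U" "\<And>u. u \<in> U - {x} \<Longrightarrow> nb E (F - U) u = {}" "\<exists>v\<in>A. \<not> coreless E (insert v U)"
    by (auto simp: B_def)
  have finU: "finite U" using U(1) assms(2) finite_subset by blast
  have "coreless E (insert w (U - {x}))" if w: "w \<in> A" for w
  proof (rule ccontr)
    assume nc: "\<not> coreless E (insert w (U - {x}))"
    let ?P = "U - {x}"
    \<comment> \<open>The sets \<open>P\<close> considered here are unions of components of
      \<open>U - {x}\<close>; a smallest one turns out to be connected, by
      \<open>coreless_glue\<close>.\<close>
    define D where "D P \<longleftrightarrow> P \<subseteq> ?P \<and> (\<forall>y\<in>?P - P. nb E P y = {}) \<and> \<not> coreless E (insert w P)" for P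
    have "D ?P" using nc by (auto simp: D_def)
    then obtain P where DP: "D P" and Pmin: "\<And>P'. D P' \<Longrightarrow> card P \<le> card P'"
      using ex_has_least_nat[of D ?P card] by blast
    have P: "P \<subseteq> ?P" "\<And>y. y \<in> ?P - P \<Longrightarrow> nb E P y = {}" "\<not> coreless E (insert w P)"
      using DP by (auto simp: D_def)
    have finP: "finite P" using P(1) finU by (metis finite_Diff finite_subset)
    have wP: "w \<notin> P" using P(1) U(1) w assms(4) by auto
    have "P \<noteq> {}"
    proof
      assume "P = {}"
      then obtain W where "W \<subseteq> {w}" "core E W" using P(3) by (auto simp: coreless_def)
      then show False using core_card[OF assms(1), of W] card_mono[of "{w}" W] by simp
    qed
    then obtain u where u: "u \<in> P" by auto
    obtain K where K: "conn E u K" "K \<subseteq> P" "\<And>y. y \<in> P - K \<Longrightarrow> nb E K y = {}"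
      using ex_component[OF finP u] by metis
    have "K = P"
    proof (rule ccontr)
      assume "K \<noteq> P"
      then have KP: "card K < card P" "card (P - K) < card P"
        using K finP conn_root[OF K(1)] u by (auto intro!: psubset_card_mono)
      have "coreless E (insert w K)"
      proof (rule ccontr)
        assume "\<not> coreless E (insert w K)"
        moreover have "nb E K y = {}" if "y \<in> ?P - K" for y
          using K(3)[of y] P(2)[of y] that K(2) nb_mono[OF K(2), of E y] by (cases "y \<in> P") auto
        ultimately have "D K" using K P by (auto simp: D_def)
        then show False using Pmin KP by fastforce
      qed
      moreover have "coreless E (insert w (P - K))"
      proof (rule ccontr)
        assume "\<not> coreless E (insert w (P - K))"
        moreover have "nb E (P - K) y = {}" if y: "y \<in> ?P - (P - K)" for y
        proof (cases "y \<in> K")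
          case True
          have "z \<notin> nb E (P - K) y" for z
            using K(3)[of z] True by (auto simp: nb_def insert_commute)
          then show ?thesis by blast
        next
          case False
          then show ?thesis using P(2)[of y] y nb_mono[of "P - K" P E y] by auto
        qed
        ultimately have "D (P - K)" using P by (auto simp: D_def)
        then show False using Pmin KP by fastforce
      qed
      moreover have "K \<union> (P - K) = P" using K by auto
      ultimately show False
        using coreless_glue[OF assms(1), of K "P - K" w] K wP finP P(3) conn_finite[OF K(1)] by auto
    qed
    have xP: "x \<notin> P" using P(1) by auto
    have "coreless E (insert x P)"
      using assms(3) by (rule coreless_subset) (use U P in auto)
    then have "card (nb E P x) \<le> 1"
      using coreless_conn_nb[OF assms(1) K(1)] \<open>K = P\<close> xP by simp
    \<comment> \<open>\<open>y\<close> is the attachment vertex of the new branch \<open>P\<close>: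
      the only possible neighbour of \<open>x\<close> in it, or any vertex if there is none.\<close>
    then obtain y where y: "y \<in> P" "nb E P x \<subseteq> {y}"
    proof (cases "nb E P x = {}")
      case False
      then have "card (nb E P x) = 1" using \<open>card (nb E P x) \<le> 1\<close> finP by (simp add: card_gt_0_iff Suc_leI le_antisym)
      then obtain y where "nb E P x = {y}" by (rule card_1_singletonE)
      then show ?thesis using that[of y] by (auto simp: nb_def)
    qed (use u in auto)
    have "B (P, y)"
      unfolding B_def
    proof (clarify, intro conjI ballI)
      fix z assume z: "z \<in> P - {y}"
      have "q \<notin> nb E (F - P) z" for q
      proof
        assume "q \<in> nb E (F - P) z"
        then have q: "q \<in> F" "q \<notin> P" "{z, q} \<in> E" by (auto simp: nb_def)
        consider "q \<in> F - U" | "q = x" | "q \<in> ?P - P" using q by auto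
        then show False
        proof cases
          case 1
          then have "q \<in> nb E (F - U) z" using q by (auto simp: nb_def)
          then show False using U(3)[of z] z P(1) by auto
        next
          case 2
          then have "z \<in> nb E P x" using q z by (auto simp: nb_def insert_commute)
          then show False using y z by auto
        next
          case 3
          then have "z \<in> nb E P q" using q z by (auto simp: nb_def insert_commute)
          then show False using P(2) 3 by auto
        qed
      qed
      then show "nb E (F - P) z = {}" by blast
    qed (use P U y w in auto)
    then have "card U \<le> card P" using min by blast
    moreover have "card P < card U" using P(1) U(2) finU by (intro psubset_card_mono) auto
    ultimately show False by simp
  qed
  then show thesis using that U by blast
qed

text \<open>Each round uses up one disjoint core: the one in \<open>insert v U\<close> is disjoint
  from \<open>(A - {v}) \<union> (F - U)\<close>, which therefore admits one fewer. \<open>S\<close>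
  collects the vertices \<open>v\<close>, \<open>Q\<close> the attachment vertices \<open>x\<close>.
  Once \<open>x\<close> is deleted, \<open>U - {x}\<close> has no edges to \<open>F - U\<close>, so
  both parts, harmless for a remaining \<open>w\<close>, can be glued at \<open>w\<close>.\<close>

lemma redundant_blocker:
  assumes "graph2 E" "finite F" "finite A" "A \<inter> F = {}" "coreless E F" "\<not> disj_cores E (A \<union> F) (Suc k)"
  shows "\<exists>S Q. S \<subseteq> A \<and> Q \<subseteq> F \<and> card S \<le> k \<and> card Q \<le> k \<and> (\<forall>v\<in>A - S. coreless E (insert v (F - Q)))"
  using assms(2-6)
proof (induction k arbitrary: F A)
  case 0
  then have "coreless E (A \<union> F)" using not_disj_cores_1[of E "A \<union> F"] by simp
  then have "\<forall>v\<in>A. coreless E (insert v F)" by (auto intro: coreless_subset)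
  then show ?case by (intro exI[of _ "{}"]) auto
next
  case (Suc k)
  show ?case
  proof (cases "\<forall>v\<in>A. coreless E (insert v F)")
    case True
    then show ?thesis by (intro exI[of _ "{}"]) auto
  next
    case False
    then obtain v0 where v0: "v0 \<in> A" "\<not> coreless E (insert v0 F)" by auto
    obtain U x v where U: "U \<subseteq> F" "x \<in> U" "\<forall>u\<in>U - {x}. nb E (F - U) u = {}"
      "v \<in> A" "\<not> coreless E (insert v U)" "\<forall>w\<in>A. coreless E (insert w (U - {x}))"
      by (rule ex_branch[OF assms(1) Suc.prems(1,4,3) v0])
    obtain C where C: "core E C" "C \<subseteq> insert v U" using U(5) by (auto simp: coreless_def)
    have "\<not> disj_cores E ((A - {v}) \<union> (F - U)) (Suc k)"
    proof
      assume "disj_cores E ((A - {v}) \<union> (F - U)) (Suc k)"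
      then have "disj_cores E (A \<union> F) (Suc (Suc k))"
        by (rule disj_cores_Suc[of _ _ _ _ C]) (use C U Suc.prems in auto)
      then show False using Suc.prems by simp
    qed
    moreover have "coreless E (F - U)" using Suc.prems(4) by (rule coreless_subset) auto
    moreover have "(A - {v}) \<inter> (F - U) = {}" "finite (F - U)" "finite (A - {v})" using Suc.prems by auto
    ultimately obtain S Q where SQ: "S \<subseteq> A - {v}" "Q \<subseteq> F - U" "card S \<le> k" "card Q \<le> k"
       "\<forall>v\<in>A - {v} - S. coreless E (insert v (F - U - Q))"
      using Suc.IH[of "F - U" "A - {v}"] by blast
    have "coreless E (insert w (F - insert x Q))" if w: "w \<in> A - insert v S" for w
    proof -
      have "coreless E (insert w ((F - U - Q) \<union> (U - {x})))"
      proof (rule coreless_glue[OF assms(1)])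
        fix u assume u: "u \<in> U - {x}"
        then show "nb E (F - U - Q) u = {}" using U(3) u nb_mono[of "F - U - Q" "F - U" E u] by auto
      next
        show "w \<notin> F - U - Q \<union> (U - {x})" using w Suc.prems U by auto
      qed (use SQ U w Suc.prems finite_subset[OF U(1)] in auto)
      moreover have "insert w (F - insert x Q) \<subseteq> insert w ((F - U - Q) \<union> (U - {x}))" by auto
      ultimately show ?thesis by (rule coreless_subset)
    qed
    moreover have "card (insert v S) \<le> Suc k" "card (insert x Q) \<le> Suc k"
      using SQ(3,4) card_insert_le_Suc by (meson Suc_le_mono le_trans)+
    moreover have "insert v S \<subseteq> A" "insert x Q \<subseteq> F" using U SQ by auto
    ultimately show ?thesis by (intro exI[of _ "insert v S"] exI[of _ "insert x Q"]) auto
  qed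
qed

section \<open>Short cores and blockers of logarithmic size\<close>

lemma sum_card_nb_swap:
  assumes "finite A" "finite B"
  shows "(\<Sum>x\<in>A. card (nb E B x)) = (\<Sum>y\<in>B. card (nb E A y))"
proof -
  have c: "card (nb E U x) = (\<Sum>y\<in>U. if {x, y} \<in> E then 1 else 0)" if "finite U" for U and x :: 'a
    using that by (simp add: nb_def sum.If_cases Int_def)
  have "(\<Sum>x\<in>A. card (nb E B x)) = (\<Sum>x\<in>A. \<Sum>y\<in>B. if {x, y} \<in> E then 1 else 0)"
    using c[OF assms(2)] by simp
  also have "\<dots> = (\<Sum>y\<in>B. \<Sum>x\<in>A. if {y, x} \<in> E then 1 else 0)"
    by (subst sum.swap) (simp add: insert_commute)
  also have "\<dots> = (\<Sum>y\<in>B. card (nb E A y))"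
    using c[OF assms(1)] by simp
  finally show ?thesis .
qed

text \<open>As long as there is no short core, the levels of a breadth-first search double in size.\<close>

lemma short_core:
  assumes "graph2 E" "finite U" "U \<noteq> {}" "\<And>x. x \<in> U \<Longrightarrow> 3 \<le> card (nb E U x)" "card U < 2 ^ h"
  shows "\<exists>C\<subseteq>U. core E C \<and> card C \<le> 2 * h + 2"
proof (rule ccontr)
  assume "\<not> ?thesis"
  then have no: "\<And>C. C \<subseteq> U \<Longrightarrow> core E C \<Longrightarrow> 2 * h + 2 < card C" by (meson not_le)
  obtain x0 where x0: "x0 \<in> U" using assms(3) by auto
  define B where "B = rec_nat {x0} (\<lambda>_ B. B \<union> {y \<in> U. nb E B y \<noteq> {}})"
  have B0: "B 0 = {x0}" and BS: "\<And>i. B (Suc i) = B i \<union> {y \<in> U. nb E (B i) y \<noteq> {}}"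
    by (simp_all add: B_def)
  have BU: "B i \<subseteq> U" for i by (induction i) (auto simp: B0 BS x0)
  have finB: "finite (B i)" for i using BU assms(2) finite_subset by blast
  \<comment> \<open>\<open>P\<close> stands for a path from \<open>x0\<close> to \<open>u\<close>.
    Apart from \<open>u\<close> it stays in the ball one level below, so a vertex new in
    \<open>B i\<close> is on no path to another vertex of \<open>B i\<close>. For
    \<open>i = 0\<close> the truncated \<open>i - 1\<close> gives \<open>B 0\<close> again.\<close>
  have path: "\<forall>u\<in>B i. \<exists>P. P \<subseteq> insert u (B (i - 1)) \<and> conn E x0 P \<and> u \<in> P \<and> card P \<le> i + 1" for i
  proof (induction i)
    case 0
    then show ?case by (auto simp: B0 intro!: exI[of _ "{x0}"] conn.intros)
  next
    case (Suc i)
    show ?case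
    proof
      fix u assume u: "u \<in> B (Suc i)"
      have BB: "B (i - 1) \<subseteq> B i" by (cases i) (auto simp: BS)
      show "\<exists>P. P \<subseteq> insert u (B (Suc i - 1)) \<and> conn E x0 P \<and> u \<in> P \<and> card P \<le> Suc i + 1"
      proof (cases "u \<in> B i")
        case True
        then obtain P where "P \<subseteq> insert u (B (i - 1))" "conn E x0 P" "u \<in> P" "card P \<le> i + 1"
          using Suc by blast
        then show ?thesis using BB by (intro exI[of _ P]) auto
      next
        case False
        then obtain w where w: "w \<in> B i" "{u, w} \<in> E" using u by (auto simp: BS nb_def)
        then obtain P where P: "P \<subseteq> insert w (B (i - 1))" "conn E x0 P" "w \<in> P" "card P \<le> i + 1"
          using Suc by blast
        have "u \<notin> P" using P(1) BB False w(1) by auto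
        moreover have "nb E P u \<noteq> {}" using w P by (auto simp: nb_def)
        ultimately have "conn E x0 (insert u P)" using P by (intro conn.intros)
        moreover have "card (insert u P) \<le> Suc i + 1" using P card_insert_le_Suc[of u P] by simp
        ultimately show ?thesis using P(1) BB w by (intro exI[of _ "insert u P"]) auto
      qed
    qed
  qed
  \<comment> \<open>Two neighbours in the ball would give two connected sets through
    \<open>x0\<close> with at most \<open>i + 1\<close> and \<open>i + 2\<close> vertices. Together
    with \<open>u\<close> they have at least as many edges as vertices, hence contain a core of at
    most \<open>2 * i + 4 \<le> 2 * h + 2\<close> vertices.\<close>
  have one: "card (nb E (B (Suc i)) u) \<le> 1" if u: "u \<in> B (Suc i) - B i" and i: "i < h" for i u
  proof (rule ccontr)
    assume "\<not> ?thesis"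
    then have "2 \<le> card (nb E (B (Suc i)) u)" by simp
    then obtain a b where ab: "a \<in> nb E (B (Suc i)) u" "b \<in> nb E (B (Suc i)) u" "a \<noteq> b"
      by (rule two_le_cardE)
    obtain w1 where w1: "w1 \<in> B i" "{u, w1} \<in> E" using u by (auto simp: BS nb_def)
    obtain w2 where w2: "w2 \<in> nb E (B (Suc i)) u" "w2 \<noteq> w1" using ab by metis
    obtain P1 where P1: "P1 \<subseteq> insert w1 (B (i - 1))" "conn E x0 P1" "w1 \<in> P1" "card P1 \<le> i + 1"
      using path w1 by blast
    have w2B: "w2 \<in> B (Suc i)" using w2(1) by (simp add: nb_def)
    obtain P2 where P2: "P2 \<subseteq> insert w2 (B (Suc i - 1))" "conn E x0 P2" "w2 \<in> P2" "card P2 \<le> Suc i + 1"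
      using path[of "Suc i"] w2B by blast
    have BB: "B (i - 1) \<subseteq> B i" by (cases i) (auto simp: BS)
    have "u \<noteq> w2" using w2(1) nb_self[OF assms(1)] by auto
    then have uP: "u \<notin> P1 \<union> P2" using P1(1) P2(1) BB w1 u by auto
    have c: "conn E x0 (P1 \<union> P2)" using P1 P2 by (intro conn_Un)
    have fin: "finite (P1 \<union> P2)" using c by (rule conn_finite)
    have "w1 \<in> nb E (P1 \<union> P2) u" "w2 \<in> nb E (P1 \<union> P2) u"
      using w1 w2(1) P1(3) P2(3) by (simp_all add: nb_def)
    then have "2 \<le> card (nb E (P1 \<union> P2) u)"
      using fin w2(2) by (metis two_le_cardI finite_nb)
    then have "card (insert u (P1 \<union> P2)) \<le> ec E (insert u (P1 \<union> P2))"
      using ec_insert[OF assms(1) fin uP] conn_ec[OF assms(1) c] uP fin by simp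
    then have "\<exists>W\<subseteq>insert u (P1 \<union> P2). core E W"
      using fin by (intro ec_core[OF assms(1)]) auto
    then obtain W where W: "W \<subseteq> insert u (P1 \<union> P2)" "core E W" by blast
    have "insert u (P1 \<union> P2) \<subseteq> B (Suc i)"
      using u P1(1) P2(1) w1 w2(1) nb_subset[of E "B (Suc i)" u] BB BS[of i] by auto
    then have "W \<subseteq> U" using W(1) BU[of "Suc i"] by blast
    then have "2 * h + 2 < card W" using no W by blast
    also have "card W \<le> card (insert u (P1 \<union> P2))" using W fin by (intro card_mono) auto
    also have "\<dots> \<le> Suc (card P1 + card P2)"
      using card_insert_le_Suc[of u "P1 \<union> P2"] card_Un_le[of P1 P2] by linarith
    finally show False using P1 P2 i by linarith
  qed
  define L where "L i = (case i of 0 \<Rightarrow> B 0 | Suc j \<Rightarrow> B (Suc j) - B j)" for i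
  have LB: "L i \<subseteq> B i" for i by (auto simp: L_def split: nat.splits)
  have finL: "finite (L i)" for i using LB finB finite_subset by blast
  have dbl: "2 * card (L i) \<le> card (L (Suc i))" if i: "i < h" for i
  proof -
    have low: "2 \<le> card (nb E (L (Suc i)) u)" if u: "u \<in> L i" for u
    proof -
      have uB: "u \<in> B i" using u LB by auto
      have "nb E U u \<subseteq> nb E (L (Suc i)) u \<union> nb E (B i) u"
        using uB by (auto simp: nb_def L_def BS insert_commute)
      then have "card (nb E U u) \<le> card (nb E (L (Suc i)) u) + card (nb E (B i) u)"
        using finL finB by (meson card_Un_le card_mono finite_UnI finite_nb le_trans)
      moreover have "card (nb E (B i) u) \<le> 1"
      proof (cases i)
        case 0
        then have "nb E (B i) u = {}" using u graph2_irrefl[OF assms(1)] by (auto simp: L_def B0 nb_def)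
        then show ?thesis by simp
      next
        case (Suc j)
        then show ?thesis using one[of u j] u i by (simp add: L_def)
      qed
      moreover have "3 \<le> card (nb E U u)" using assms(4) uB BU by blast
      ultimately show ?thesis by linarith
    qed
    have high: "card (nb E (L i) y) \<le> 1" if y: "y \<in> L (Suc i)" for y
    proof -
      have "card (nb E (L i) y) \<le> card (nb E (B (Suc i)) y)"
        using LB[of i] by (intro card_mono finite_nb nb_mono finB) (auto simp: BS)
      also have "\<dots> \<le> 1" using y i by (intro one) (auto simp: L_def)
      finally show ?thesis .
    qed
    have "2 * card (L i) \<le> (\<Sum>u\<in>L i. card (nb E (L (Suc i)) u))"
      using sum_mono[of "L i" "\<lambda>_. 2" "\<lambda>u. card (nb E (L (Suc i)) u)"] low by (simp add: mult.commute)
    also have "\<dots> = (\<Sum>y\<in>L (Suc i). card (nb E (L i) y))"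
      by (rule sum_card_nb_swap[OF finL finL])
    also have "\<dots> \<le> card (L (Suc i))"
      using sum_mono[of "L (Suc i)" "\<lambda>y. card (nb E (L i) y)" "\<lambda>_. 1"] high by simp
    finally show ?thesis .
  qed
  have "i \<le> h \<Longrightarrow> 2 ^ i \<le> card (L i)" for i
  proof (induction i)
    case 0
    then show ?case by (simp add: L_def B0)
  next
    case (Suc i)
    then show ?case using dbl[of i] by simp
  qed
  then have "2 ^ h \<le> card (L h)" by simp
  also have "\<dots> \<le> card U" using LB BU assms(2) by (meson card_mono order_trans)
  finally show False using assms(5) by simp
qed

text \<open>Vertices of degree at most two are eliminated by deletion or by replacing them by an edge
  between their neighbours; what remains has minimum degree three.\<close>

lemma local_blocker:
  assumes "graph2 E" "finite U" "\<not> coreless E U" "card U < 2 ^ h"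
  shows "\<exists>C X. core E C \<and> C \<subseteq> U \<and> X \<subseteq> U \<and> card X \<le> 2 * h + 2 \<and>
    (\<forall>D\<subseteq>U. core E D \<and> D \<inter> C \<noteq> {} \<longrightarrow> D \<inter> X \<noteq> {})"
  using assms
proof (induction "card U" arbitrary: U E rule: less_induct)
  case less
  note g = less.prems(1) and fin = less.prems(2)
  have smaller: "card (U - {v}) < card U" "card (U - {v}) < 2 ^ h" if "v \<in> U" for v
    using that fin less.prems(4) card_Diff1_less[of U v] by auto
  show ?case
  proof (cases "\<forall>v\<in>U. 3 \<le> card (nb E U v)")
    case True
    have "U \<noteq> {}" using less.prems(3) by (auto simp: coreless_def core_def)
    then obtain C where "C \<subseteq> U" "core E C" "card C \<le> 2 * h + 2"
      using short_core[OF g fin _ _ less.prems(4)] True by blast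
    then show ?thesis by (intro exI[of _ C]) auto
  next
    case False
    then obtain v where v: "v \<in> U" "card (nb E U v) < 3" by (auto simp: not_le)
    have sub: "D \<subseteq> U - {v}" if "D \<subseteq> U" "v \<notin> D" for D using that by auto
    show ?thesis
    proof (cases "card (nb E U v) = 2")
      case False
      have vD: "v \<notin> D" if D: "core E D" "D \<subseteq> U" for D
      proof
        assume "v \<in> D"
        then have "2 \<le> card (nb E D v)" using D by (auto simp: core_def)
        also have "\<dots> \<le> card (nb E U v)" using D(2) fin by (intro card_mono nb_mono finite_nb)
        finally show False using v False by simp
      qed
      then have "\<not> coreless E (U - {v})" using less.prems(3) sub unfolding coreless_def by blast
      then have "\<exists>C X. core E C \<and> C \<subseteq> U - {v} \<and> X \<subseteq> U - {v} \<and> card X \<le> 2 * h + 2 \<and>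
          (\<forall>D\<subseteq>U - {v}. core E D \<and> D \<inter> C \<noteq> {} \<longrightarrow> D \<inter> X \<noteq> {})"
        using smaller[OF v(1)] fin by (intro less.hyps g) auto
      then obtain C X where CX: "core E C \<and> C \<subseteq> U - {v} \<and> X \<subseteq> U - {v} \<and> card X \<le> 2 * h + 2 \<and>
          (\<forall>D\<subseteq>U - {v}. core E D \<and> D \<inter> C \<noteq> {} \<longrightarrow> D \<inter> X \<noteq> {})"
        by (elim exE)
      have "D \<inter> X \<noteq> {}" if D: "D \<subseteq> U" "core E D" "D \<inter> C \<noteq> {}" for D
        using CX D sub[OF D(1) vD[OF D(2,1)]] by simp
      moreover have "C \<subseteq> U" "X \<subseteq> U" using CX by auto
      ultimately show ?thesis using CX by (intro exI[of _ C] exI[of _ X]) simp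
    next
      case True
      then obtain a b where ab: "nb E U v = {a, b}" "a \<noteq> b" by (auto simp: card_2_iff)
      then have abE: "{v, a} \<in> E" "{v, b} \<in> E" "a \<in> U" "b \<in> U" by (auto simp: nb_def)
      have av: "a \<noteq> v" "b \<noteq> v" using abE graph2_irrefl[OF g] by auto
      have vD: "a \<in> D \<and> b \<in> D" if D: "core E D" "D \<subseteq> U" "v \<in> D" for D
      proof -
        have d2: "2 \<le> card (nb E D v)" using D by (auto simp: core_def)
        have "nb E D v \<subseteq> {a, b}" using nb_mono[OF D(2), of E v] ab by simp
        then have "nb E D v = {a, b}" using d2 ab(2) by (intro card_seteq) auto
        then show ?thesis by (auto simp: nb_def)
      qed
      show ?thesis
      \<comment> \<open>If \<open>a\<close> and \<open>b\<close> are adjacent, replacing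
        \<open>v\<close> by an edge would create a parallel one. But then there is a triangle, and
        every core through \<open>v\<close> contains both \<open>a\<close> and
        \<open>b\<close>.\<close>
      proof (cases "{a, b} \<in> E")
        case True
        then have "core E {v, a, b}" using abE by (intro core_triangle[OF g]) auto
        moreover have "D \<inter> {a, b} \<noteq> {}" if "D \<subseteq> U" "core E D" "D \<inter> {v, a, b} \<noteq> {}" for D
          using vD[of D] that by auto
        ultimately show ?thesis using v abE
          by (intro exI[of _ "{v, a, b}"] exI[of _ "{a, b}"]) (auto simp: card_insert_if)
      next
        case nE: False
        define E' where "E' = insert {a, b} E"
        have g': "graph2 E'" using g ab(2) by (auto simp: graph2_def E'_def)
        have t1: "core E' (D - {v})" if D: "core E D" "D \<subseteq> U" for D
        proof -
          have finD: "finite D" using D by (simp add: core_def)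
          have "D - {v} \<noteq> {}"
            using core_card[OF g D(1)] card_mono[of "{v}" D] by fastforce
          moreover have "2 \<le> card (nb E' (D - {v}) x)" if x: "x \<in> D - {v}" for x
          proof -
            \<comment> \<open>The lost neighbour \<open>v\<close> of \<open>a\<close> or
              \<open>b\<close> is replaced by the other end of the new edge. This is injective on
              neighbourhoods because \<open>{a, b}\<close> was not an edge before.\<close>
            define f where "f y = (if y = v then (if x = a then b else a) else y)" for y
            have xD: "x \<in> D" "x \<noteq> v" using x by auto
            have nbv: "x = a \<or> x = b" if "v \<in> nb E D x"
            proof -
              have "x \<in> nb E U v" using that xD D(2) by (auto simp: nb_def insert_commute)
              then show ?thesis using ab by auto
            qed
            have "inj_on f (nb E D x)"
              using nbv nE by (auto simp: inj_on_def f_def nb_def insert_commute split: if_splits)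
            moreover have "f ` nb E D x \<subseteq> nb E' (D - {v}) x"
            proof
              fix z assume "z \<in> f ` nb E D x"
              then obtain y where y: "y \<in> nb E D x" "z = f y" by auto
              show "z \<in> nb E' (D - {v}) x"
              proof (cases "y = v")
                case True
                then have "v \<in> D" using y by (auto simp: nb_def)
                then show ?thesis using True nbv y vD[OF D] av ab(2)
                  by (auto simp: f_def nb_def E'_def insert_commute)
              next
                case False
                then show ?thesis using y by (auto simp: f_def nb_def E'_def)
              qed
            qed
            ultimately have "card (nb E D x) \<le> card (nb E' (D - {v}) x)"
              using finD by (metis card_image card_mono finite_Diff finite_nb)
            moreover have "2 \<le> card (nb E D x)" using D xD by (auto simp: core_def)
            ultimately show ?thesis by simp
          qed
          ultimately show ?thesis using finD by (auto simp: core_def)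
        qed
        have "\<not> coreless E' (U - {v})"
          using less.prems(3) t1 unfolding coreless_def by (meson Diff_mono order_refl)
        then have "\<exists>C X. core E' C \<and> C \<subseteq> U - {v} \<and> X \<subseteq> U - {v} \<and> card X \<le> 2 * h + 2 \<and>
            (\<forall>D\<subseteq>U - {v}. core E' D \<and> D \<inter> C \<noteq> {} \<longrightarrow> D \<inter> X \<noteq> {})"
          using smaller[OF v(1)] fin by (intro less.hyps g') auto
        then obtain C' X where CX: "core E' C'" "C' \<subseteq> U - {v}" "X \<subseteq> U - {v}" "card X \<le> 2 * h + 2"
          "\<forall>D\<subseteq>U - {v}. core E' D \<and> D \<inter> C' \<noteq> {} \<longrightarrow> D \<inter> X \<noteq> {}"
          by (elim exE conjE)
        \<comment> \<open>This undoes the replacement: if the new edge lies inside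
          \<open>C'\<close>, it is subdivided by \<open>v\<close> again.\<close>
        define C where "C = (if a \<in> C' \<and> b \<in> C' then insert v C' else C')"
        have finC: "finite C'" and C'2: "\<And>x. x \<in> C' \<Longrightarrow> 2 \<le> card (nb E' C' x)"
          using CX(1) by (auto simp: core_def)
        have vC': "v \<notin> C'" using CX(2) by auto
        have "2 \<le> card (nb E C x)" if x: "x \<in> C" for x
        proof (cases "a \<in> C' \<and> b \<in> C'")
          case True
          then have C: "C = insert v C'" by (simp add: C_def)
          consider "x = v" | "x = a" | "x = b" | "x \<in> C'" "x \<noteq> a" "x \<noteq> b" using x C by auto
          then show ?thesis
          proof cases
            case 1
            have "a \<in> nb E C v" "b \<in> nb E C v" using True C abE by (simp_all add: nb_def)
            then show ?thesis using 1 C finC ab(2) by (metis two_le_cardI finite_nb finite_insert)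
          next
            case 2
            have "nb E' C' a \<subseteq> insert b (nb E C' a)"
              using nE by (auto simp: nb_def E'_def doubleton_eq_iff)
            then have "card (nb E' C' a) \<le> Suc (card (nb E C' a))"
              using finC by (meson card_insert_le_Suc card_mono finite_insert finite_nb le_trans)
            moreover have "nb E C a = insert v (nb E C' a)"
              using C abE by (auto simp: nb_def insert_commute)
            moreover have "v \<notin> nb E C' a" using vC' by (auto simp: nb_def)
            ultimately show ?thesis using C'2[of a] True 2 finC by simp
          next
            case 3
            have "nb E' C' b \<subseteq> insert a (nb E C' b)"
              using nE by (auto simp: nb_def E'_def doubleton_eq_iff)
            then have "card (nb E' C' b) \<le> Suc (card (nb E C' b))"
              using finC by (meson card_insert_le_Suc card_mono finite_insert finite_nb le_trans)
            moreover have "nb E C b = insert v (nb E C' b)"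
              using C abE by (auto simp: nb_def insert_commute)
            moreover have "v \<notin> nb E C' b" using vC' by (auto simp: nb_def)
            ultimately show ?thesis using C'2[of b] True 3 finC by simp
          next
            case 4
            then have "nb E' C' x \<subseteq> nb E C x" using C by (auto simp: nb_def E'_def doubleton_eq_iff)
            then have "card (nb E' C' x) \<le> card (nb E C x)" using finC C by (intro card_mono) auto
            then show ?thesis using C'2[of x] 4 by simp
          qed
        next
          case False
          then have C: "C = C'" unfolding C_def by (rule if_not_P)
          have "nb E' C' x = nb E C' x"
            using False x C by (auto simp: nb_def E'_def doubleton_eq_iff)
          then show ?thesis using C'2[of x] x C by simp
        qed
        moreover have "finite C" "C \<noteq> {}" using CX(1) by (auto simp: C_def core_def)
        ultimately have "core E C" by (simp add: core_def)
        moreover have "C \<subseteq> U" using CX(2) v by (auto simp: C_def)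
        moreover have "D \<inter> X \<noteq> {}" if D: "D \<subseteq> U" "core E D" "D \<inter> C \<noteq> {}" for D
        proof -
          have DC: "(D - {v}) \<inter> C' \<noteq> {}"
          proof (cases "v \<in> D \<and> v \<in> C")
            case True
            then have "a \<in> C'" using vC' by (auto simp: C_def split: if_splits)
            then show ?thesis using vD[OF D(2,1)] True av by auto
          next
            case False
            then show ?thesis using D(3) vC' by (auto simp: C_def split: if_splits)
          qed
          have "D - {v} \<subseteq> U - {v}" using D(1) by auto
          then have "(D - {v}) \<inter> X \<noteq> {}"
            using CX(5) t1[OF D(2,1)] DC by simp
          then show ?thesis by auto
        qed
        moreover have "X \<subseteq> U" using CX(3) by auto
        ultimately show ?thesis using CX(4) by (intro exI[of _ C] exI[of _ X]) simp
      qed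
    qed
  qed
qed

text \<open>Once \<open>X\<close> is deleted no core meets \<open>C\<close>, so \<open>Suc k\<close>
  disjoint cores left over would be completed to \<open>Suc (Suc k)\<close> by \<open>C\<close>
  itself. Hence the at most \<open>2 * h + 2\<close> vertices of \<open>X\<close> lower the number
  of disjoint cores by one: an Erdos-Posa bound with a logarithmic loss.\<close>

lemma small_blocker:
  assumes "graph2 E" "finite U" "card U < 2 ^ h" "\<not> disj_cores E U (Suc k)"
  shows "\<exists>X\<subseteq>U. card X \<le> k * (2 * h + 2) \<and> coreless E (U - X)"
  using assms(2-4)
proof (induction k arbitrary: U)
  case 0
  then have "coreless E U" using not_disj_cores_1[of E U] by simp
  then show ?case by (intro exI[of _ "{}"]) auto
next
  case (Suc k)
  show ?case
  proof (cases "coreless E U")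
    case True
    then show ?thesis by (intro exI[of _ "{}"]) auto
  next
    case False
    then obtain C X where CX: "core E C" "C \<subseteq> U" "X \<subseteq> U" "card X \<le> 2 * h + 2"
      "\<forall>D\<subseteq>U. core E D \<and> D \<inter> C \<noteq> {} \<longrightarrow> D \<inter> X \<noteq> {}"
      using local_blocker[OF assms(1) Suc.prems(1) _ Suc.prems(2)] by blast
    have "\<not> disj_cores E (U - X) (Suc k)"
    proof
      assume "disj_cores E (U - X) (Suc k)"
      then obtain W where W: "\<forall>i<Suc k. core E (W i)" "\<forall>i<Suc k. W i \<subseteq> U - X"
        "\<forall>i<Suc k. \<forall>j<Suc k. i \<noteq> j \<longrightarrow> W i \<inter> W j = {}" by (rule disj_coresE)
      have "disj_cores E (U - C) (Suc k)"
      proof (rule disj_coresI)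
        fix i assume i: "i < Suc k"
        then show "core E (W i)" using W by auto
        have "W i \<inter> C = {}" using CX(5) W(1,2) i by blast
        then show "W i \<subseteq> U - C" using W(2) i by blast
      qed (use W in auto)
      then have "disj_cores E U (Suc (Suc k))"
        by (rule disj_cores_Suc[of _ _ _ _ C]) (use CX in auto)
      then show False using Suc.prems by simp
    qed
    moreover have "card (U - X) < 2 ^ h"
      using Suc.prems card_mono[of U "U - X"] by fastforce
    ultimately obtain Y where Y: "Y \<subseteq> U - X" "card Y \<le> k * (2 * h + 2)" "coreless E (U - X - Y)"
      using Suc.IH[of "U - X"] Suc.prems by auto
    have "card (X \<union> Y) \<le> Suc k * (2 * h + 2)" using card_Un_le[of X Y] CX Y by simp
    moreover have "U - X - Y = U - (X \<union> Y)" by auto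
    ultimately show ?thesis using Y CX by (intro exI[of _ "X \<union> Y"]) auto
  qed
qed

text \<open>Contract the edges of the forest \<open>F\<close> one at a time. Each contraction loses
  exactly one vertex and one edge, both inside \<open>F\<close>, since a common neighbour of the two
  ends would form a triangle with them. At the end each tree is one vertex, and
  \<open>ec_linear\<close> applies to \<open>card A\<close> plus the number of trees many
  vertices.\<close>

lemma contract_edge_bound:
  assumes "graph2 E" "finite F" "finite A" "A \<inter> F = {}" "coreless E F"
    "\<And>a. a \<in> A \<Longrightarrow> coreless E (insert a F)" "\<not> disj_cores E (A \<union> F) (Suc k)"
  shows "ec E (A \<union> F) \<le> ec E F + (5 * k + 1) * (card A + (card F - ec E F))"
  using assms
proof (induction "card F" arbitrary: F E rule: less_induct)
  case less
  note g = less.prems(1) and finF = less.prems(2) and finA = less.prems(3) and AF = less.prems(4)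
  show ?case
  proof (cases "\<exists>u v. u \<in> F \<and> v \<in> F \<and> {u, v} \<in> E")
    case False
    have "{e \<in> E. e \<subseteq> F} = {}"
    proof (rule ccontr)
      assume "{e \<in> E. e \<subseteq> F} \<noteq> {}"
      then obtain e where e: "e \<in> E" "e \<subseteq> F" by auto
      then obtain u v where "e = {u, v}" using g by (auto simp: graph2_def card_2_iff)
      then show False using e False by auto
    qed
    then have "ec E F = 0" unfolding ec_def by (simp only: card.empty)
    then show ?thesis
      using ec_linear[OF g _ less.prems(7)] finF finA AF by (simp add: card_Un_disjoint)
  next
    case True
    then obtain u v where uv: "u \<in> F" "v \<in> F" "{u, v} \<in> E" by auto
    have "u \<noteq> v" using uv graph2_irrefl[OF g] by auto
    \<comment> \<open>\<open>v\<close> is merged into \<open>u\<close>: its edges are moved to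
      \<open>u\<close>, and the edge between the two disappears.\<close>
    define E' where "E' = {e \<in> E. v \<notin> e} \<union> (\<lambda>y. {u, y}) ` {y. {v, y} \<in> E \<and> y \<noteq> u}"
    have g': "graph2 E'" using g by (auto simp: graph2_def E'_def)
    have c1: "ec E' T = ec E T" if "u \<notin> T" "v \<notin> T" for T
    proof -
      have "{e \<in> E'. e \<subseteq> T} = {e \<in> E. e \<subseteq> T}" using that by (auto simp: E'_def)
      then show ?thesis by (simp add: ec_def)
    qed
    \<comment> \<open>The \<open>1\<close> is the contracted edge; the last summand counts the pairs
      of edges that become parallel.\<close>
    have c2: "ec E (insert v T) = ec E' T + 1 + card (nb E (T - {u}) u \<inter> nb E (T - {u}) v)"
      if T: "finite T" "u \<in> T" "v \<notin> T" for T
    proof -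
      let ?T = "T - {u}"
      have "nb E' ?T u = nb E ?T u \<union> nb E ?T v"
        using T \<open>u \<noteq> v\<close> by (auto simp: nb_def E'_def doubleton_eq_iff)
      then have "ec E' T = ec E ?T + card (nb E ?T u \<union> nb E ?T v)"
        using ec_insert[OF g', of ?T u] T c1[of ?T] by (simp add: insert_absorb)
      moreover have "ec E (insert v T) = ec E T + card (nb E T v)"
        using T by (intro ec_insert[OF g]) auto
      moreover have "ec E T = ec E ?T + card (nb E ?T u)"
        using ec_insert[OF g, of ?T u] T by (simp add: insert_absorb)
      moreover have "nb E T v = insert u (nb E ?T v)"
        using T uv by (auto simp: nb_def insert_commute)
      then have "card (nb E T v) = Suc (card (nb E ?T v))"
        using T by (simp add: nb_def)
      moreover have "card (nb E ?T u) + card (nb E ?T v) =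
          card (nb E ?T u \<union> nb E ?T v) + card (nb E ?T u \<inter> nb E ?T v)"
        using T by (intro card_Un_Int) auto
      ultimately show ?thesis by simp
    qed
    \<comment> \<open>The preimage of \<open>D\<close> under the contraction. It gains one vertex
      and at least one edge if \<open>u \<in> D\<close>, so there are still at least as many edges
      as vertices, and \<open>ec_core\<close> supplies a core.\<close>
    define lift where "lift D = (if u \<in> D then insert v D else D)" for D
    have lift_core: "\<exists>W\<subseteq>lift D. core E W" if D: "core E' D" "v \<notin> D" for D
    proof (rule ec_core[OF g])
      have fin: "finite D" "D \<noteq> {}" using D by (auto simp: core_def)
      then show "finite (lift D)" "lift D \<noteq> {}" by (auto simp: lift_def)
      have "card D \<le> ec E' D" by (rule core_ec[OF g' D(1)])
      then show "card (lift D) \<le> ec E (lift D)"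
        using c1[of D] c2[of D] fin D(2) by (auto simp: lift_def)
    qed
    have coreless': "coreless E' (T - {v})" if "coreless E T" "v \<in> T" for T
      unfolding coreless_def
    proof (intro allI impI notI)
      fix D assume D: "D \<subseteq> T - {v}" "core E' D"
      then obtain W where "W \<subseteq> lift D" "core E W" using lift_core[of D] by auto
      moreover have "lift D \<subseteq> T" using D that by (auto simp: lift_def)
      ultimately show False using that by (auto simp: coreless_def)
    qed
    have nodisj: "\<not> disj_cores E' (A \<union> (F - {v})) (Suc k)"
    proof
      assume "disj_cores E' (A \<union> (F - {v})) (Suc k)"
      then obtain W where W: "\<forall>i<Suc k. core E' (W i)" "\<forall>i<Suc k. W i \<subseteq> A \<union> (F - {v})"
        "\<forall>i<Suc k. \<forall>j<Suc k. i \<noteq> j \<longrightarrow> W i \<inter> W j = {}" by (rule disj_coresE)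
      have vW: "v \<notin> W i" if "i < Suc k" for i using W(2) AF uv that by blast
      have "\<exists>Z\<subseteq>lift (W i). core E Z" if "i < Suc k" for i
        using that W(1) vW by (intro lift_core) auto
      then have "\<forall>i. \<exists>Z. i < Suc k \<longrightarrow> Z \<subseteq> lift (W i) \<and> core E Z" by blast
      then obtain Z where Z: "\<forall>i. i < Suc k \<longrightarrow> Z i \<subseteq> lift (W i) \<and> core E (Z i)"
        using choice[of "\<lambda>i Z. i < Suc k \<longrightarrow> Z \<subseteq> lift (W i) \<and> core E Z"] by blast
      have "disj_cores E (A \<union> F) (Suc k)"
      proof (rule disj_coresI)
        fix i j assume ij: "i < Suc k" "j < Suc k" "i \<noteq> j"
        have "lift (W i) \<inter> lift (W j) = {}"
          using W(3) ij vW[OF ij(1)] vW[OF ij(2)] by (auto simp: lift_def)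
        then show "Z i \<inter> Z j = {}" using Z ij by blast
      next
        fix i assume i: "i < Suc k"
        have "lift (W i) \<subseteq> A \<union> F" using W(2) i uv by (auto simp: lift_def)
        then show "Z i \<subseteq> A \<union> F" using Z i by blast
      qed (use Z in auto)
      then show False using less.prems(7) by simp
    qed
    have nocommon: "nb E (T - {u}) u \<inter> nb E (T - {u}) v = {}" if T: "T \<subseteq> A \<union> F" for T
    proof (rule ccontr)
      assume "nb E (T - {u}) u \<inter> nb E (T - {u}) v \<noteq> {}"
      then obtain y where y: "y \<in> A \<union> F" "{u, y} \<in> E" "{v, y} \<in> E" using T by (auto simp: nb_def)
      have "core E {u, v, y}" using y uv by (intro core_triangle[OF g])
      moreover have "coreless E (insert y F)"
        using y less.prems(5,6) by (cases "y \<in> F") (auto simp: insert_absorb)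
      ultimately show False using uv unfolding coreless_def by (metis empty_subsetI insert_subset insertI1 insertI2)
    qed
    have eAF: "ec E (A \<union> F) = ec E' (A \<union> (F - {v})) + 1"
    proof -
      have "A \<union> F = insert v (A \<union> (F - {v}))" using uv by auto
      moreover have "finite (A \<union> (F - {v}))" "u \<in> A \<union> (F - {v})" "v \<notin> A \<union> (F - {v})"
        using finA finF uv AF \<open>u \<noteq> v\<close> by auto
      moreover have "A \<union> (F - {v}) \<subseteq> A \<union> F" by auto
      ultimately show ?thesis using c2[of "A \<union> (F - {v})"] nocommon[of "A \<union> (F - {v})"] by simp
    qed
    have eF: "ec E F = ec E' (F - {v}) + 1"
    proof -
      have "F = insert v (F - {v})" using uv by auto
      then show ?thesis using c2[of "F - {v}"] nocommon[of "F - {v}"] finF uv \<open>u \<noteq> v\<close>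
        by auto
    qed
    have cF: "card F = card (F - {v}) + 1" using uv finF by (simp add: card_Diff_singleton card_gt_0_iff Suc_leI) (metis Suc_pred card_gt_0_iff empty_iff)
    have "ec E' (A \<union> (F - {v})) \<le> ec E' (F - {v}) + (5 * k + 1) * (card A + (card (F - {v}) - ec E' (F - {v})))"
    proof (rule less.hyps)
      show "card (F - {v}) < card F" using cF by simp
      show "coreless E' (F - {v})" using less.prems(5) uv by (intro coreless')
      fix a assume a: "a \<in> A"
      have "insert a (F - {v}) = insert a F - {v}" using a AF uv by auto
      then show "coreless E' (insert a (F - {v}))" using coreless'[of "insert a F"] less.prems(6)[OF a] uv by auto
    qed (use g' finF finA AF nodisj in auto)
    then show ?thesis using eAF eF cF by simp
  qed
qed

text \<open>\<open>A\<close> consists of the redundant blocker vertices \<open>X - S\<close> and of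
  the attachment vertices \<open>Q\<close>. A vertex of \<open>Q\<close> closes no core with the
  remaining forest because \<open>X\<close> was a blocker, the others by the choice of
  \<open>Q\<close>; so \<open>contract_edge_bound\<close> applies. The sizes add up to
  \<open>k * (2 * h + 2) + k\<close>.\<close>

theorem few_disjoint_cores_structure:
  assumes "graph2 E" "finite V" "card V < 2 ^ h" "\<not> disj_cores E V (Suc k)"
  obtains S A where "S \<subseteq> V" "A \<subseteq> V - S" "card S \<le> k" "card A \<le> k * (2 * h + 3)"
    "coreless E (V - S - A)"
    "ec E (V - S) \<le> ec E (V - S - A) + (5 * k + 1) * (card A + (card (V - S - A) - ec E (V - S - A)))"
proof -
  obtain X where X: "X \<subseteq> V" "card X \<le> k * (2 * h + 2)" "coreless E (V - X)"
    using small_blocker[OF assms] by blast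
  have "X \<union> (V - X) = V" using X by auto
  then obtain S Q where SQ: "S \<subseteq> X" "Q \<subseteq> V - X" "card S \<le> k" "card Q \<le> k"
    "\<forall>v\<in>X - S. coreless E (insert v (V - X - Q))"
    using redundant_blocker[OF assms(1), of "V - X" X k] X assms finite_subset[OF X(1) assms(2)] by auto
  define A where "A = (X - S) \<union> Q"
  have F: "V - S - A = V - X - Q" using SQ by (auto simp: A_def)
  have fin: "finite A" using assms(2) X SQ by (auto simp: A_def intro: finite_subset)
  have "card (X - S) \<le> card X" using X assms(2) by (intro card_mono) (auto intro: finite_subset)
  then have cA: "card A \<le> k * (2 * h + 3)"
    using card_Un_le[of "X - S" Q] SQ X by (simp add: A_def algebra_simps)
  have cF: "coreless E (V - S - A)" unfolding F using X(3) by (rule coreless_subset) auto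
  have VS: "V - S = A \<union> (V - S - A)" using SQ X by (auto simp: A_def)
  have "ec E (A \<union> (V - S - A)) \<le> ec E (V - S - A) + (5 * k + 1) * (card A + (card (V - S - A) - ec E (V - S - A)))"
  proof (rule contract_edge_bound[OF assms(1)])
    fix a assume a: "a \<in> A"
    show "coreless E (insert a (V - S - A))"
    proof (cases "a \<in> Q")
      case True
      then show ?thesis unfolding F using SQ(2) X(3) by (auto intro: coreless_subset)
    next
      case False
      then show ?thesis unfolding F using SQ(5) a by (auto simp: A_def)
    qed
  next
    show "\<not> disj_cores E (A \<union> (V - S - A)) (Suc k)"
      using assms(4) disj_cores_mono[of E "V - S" "Suc k" V] VS by auto
  qed (use fin assms(2) cF in auto)
  then show thesis using that[of S A] SQ X cA cF VS by (auto simp: A_def)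
qed

section \<open>Parent functions and their number\<close>

text \<open>A function \<open>p\<close> from \<open>V\<close> to \<open>insert r V\<close> is read as a parent function; the value \<open>r\<close>,
  which lies outside \<open>V\<close>, marks the roots.\<close>

definition pedges :: "'a \<Rightarrow> 'a set \<Rightarrow> ('a \<Rightarrow> 'a) \<Rightarrow> 'a set set" where
  "pedges r V p = (\<lambda>x. {x, p x}) ` {x \<in> V. p x \<noteq> r}"

text \<open>Forbidding \<open>p (p x) = x\<close> makes \<open>x \<mapsto> {x, p x}\<close>
  injective on the non-roots, so that the number of edges is \<open>card V\<close> minus the number
  of roots. The functions serve upper bounds, where this count is what matters.\<close>

definition parent_fun :: "'a set set \<Rightarrow> 'a \<Rightarrow> 'a set \<Rightarrow> ('a \<Rightarrow> 'a) \<Rightarrow> bool" where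
  "parent_fun E r V p \<longleftrightarrow> (\<forall>x\<in>V. p x \<in> insert r V \<and> (p x \<noteq> r \<longrightarrow> {x, p x} \<in> E \<and> p (p x) \<noteq> x))"

lemma parent_fun_insert:
  assumes "parent_fun E r P p" "y \<notin> P" "y \<noteq> r" "r \<notin> P" "w \<in> P" "{y, w} \<in> E"
  shows "parent_fun E r (insert y P) (p(y := w))"
  using assms unfolding parent_fun_def by (auto split: if_splits)

text \<open>Vertices adjacent to the part already reached are attached to it one by one. No roots
  are added, and the process ends with a set \<open>K\<close> that has no edges to the rest of
  \<open>V\<close>.\<close>

lemma parent_fun_extend:
  assumes "finite V" "P \<subseteq> V" "r \<notin> V" "parent_fun E r P p"
  shows "\<exists>K q. P \<subseteq> K \<and> K \<subseteq> V \<and> parent_fun E r K q \<and> (\<forall>x\<in>P. q x = p x) \<and>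
    {x \<in> K. q x = r} = {x \<in> P. p x = r} \<and> (\<forall>y\<in>V - K. nb E K y = {})"
  using assms(2,4)
proof (induction "card (V - P)" arbitrary: P p rule: less_induct)
  case less
  show ?case
  proof (cases "\<forall>y\<in>V - P. nb E P y = {}")
    case True
    then show ?thesis using less.prems by (intro exI[of _ P] exI[of _ p]) auto
  next
    case False
    then obtain y w where y: "y \<in> V - P" "w \<in> P" "{y, w} \<in> E" by (auto simp: nb_def)
    have r: "r \<notin> P" "y \<noteq> r" using less.prems assms(3) y by auto
    have "V - insert y P \<subset> V - P" using y by auto
    then have "card (V - insert y P) < card (V - P)" using assms(1) by (intro psubset_card_mono) auto
    moreover have "parent_fun E r (insert y P) (p(y := w))"
      using less.prems y r by (intro parent_fun_insert) auto
    ultimately obtain K q where K: "insert y P \<subseteq> K" "K \<subseteq> V" "parent_fun E r K q"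
      "\<forall>x\<in>insert y P. q x = (p(y := w)) x"
      "{x \<in> K. q x = r} = {x \<in> insert y P. (p(y := w)) x = r}" "\<forall>y\<in>V - K. nb E K y = {}"
      using less.hyps[of "insert y P" "p(y := w)"] less.prems y by auto
    have "\<forall>x\<in>P. q x = p x" using K(4) y(1) by auto
    moreover have "{x \<in> insert y P. (p(y := w)) x = r} = {x \<in> P. p x = r}"
      using y r by auto
    ultimately show ?thesis using K by (intro exI[of _ K] exI[of _ q]) auto
  qed
qed

lemma parent_fun_path:
  assumes "c \<noteq> []" "distinct c" "r \<notin> set c" "\<And>i. Suc i < length c \<Longrightarrow> {c ! i, c ! Suc i} \<in> E"
  shows "\<exists>p. parent_fun E r (set c) p \<and> (\<forall>i. Suc i < length c \<longrightarrow> p (c ! i) = c ! Suc i) \<and>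
    {x \<in> set c. p x = r} = {last c}"
  using assms
proof (induction c)
  case (Cons x c)
  show ?case
  proof (cases "c = []")
    case True
    then show ?thesis by (intro exI[of _ "\<lambda>_. r"]) (auto simp: parent_fun_def)
  next
    case False
    have edge: "{x, c ! 0} \<in> E" using Cons.prems(4)[of 0] False by auto
    have "{c ! i, c ! Suc i} \<in> E" if "Suc i < length c" for i
      using Cons.prems(4)[of "Suc i"] that by auto
    then obtain p where p: "parent_fun E r (set c) p" "\<forall>i. Suc i < length c \<longrightarrow> p (c ! i) = c ! Suc i"
       "{y \<in> set c. p y = r} = {last c}"
      using Cons.IH[OF False] Cons.prems(2,3) by auto
    let ?p = "p(x := c ! 0)"
    have "parent_fun E r (insert x (set c)) ?p"
      using p Cons.prems False edge by (intro parent_fun_insert) auto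
    moreover have "?p ((x # c) ! i) = (x # c) ! Suc i" if i: "Suc i < length (x # c)" for i
    proof (cases i)
      case (Suc j)
      then have "c ! j \<noteq> x" using i Cons.prems(2) by auto
      then show ?thesis using Suc i p(2) by auto
    qed simp
    moreover have "c ! 0 \<noteq> r" using False Cons.prems(3) by auto
    then have "{y \<in> set (x # c). ?p y = r} = {y \<in> set c. p y = r}"
      using Cons.prems(2) by auto
    moreover have "last (x # c) = last c" using False by simp
    ultimately show ?thesis using p(3) by (intro exI[of _ ?p]) (simp del: fun_upd_apply)
  qed
qed simp

text \<open>Each component \<open>K\<close> of the graph on \<open>V\<close> receives one root,
  while the forest \<open>F\<close> has at most \<open>card K - 1\<close> edges in it. So
  \<open>p\<close> records at least as many edges as \<open>F\<close> has. The component of the path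
  \<open>c\<close> is grown from the path itself, directed towards its last vertex.\<close>

lemma ex_parent_fun:
  assumes "graph2 E" "finite V" "r \<notin> V" "F \<subseteq> V" "coreless E F" "distinct c" "set c \<subseteq> V"
    "\<And>i. Suc i < length c \<Longrightarrow> {c ! i, c ! Suc i} \<in> E"
  shows "\<exists>p. parent_fun E r V p \<and> (\<forall>i. Suc i < length c \<longrightarrow> p (c ! i) = c ! Suc i) \<and>
    card {x \<in> V. p x = r} + ec E F \<le> card V"
  using assms(2-)
proof (induction "card V" arbitrary: V F c rule: less_induct)
  case less
  show ?case
  proof (cases "V = {}")
    case True
    then show ?thesis using less.prems assms(1) by (auto simp: parent_fun_def)
  next
    case False
    then obtain u where u: "u \<in> V" by auto
    \<comment> \<open>If there is no path to follow, the component is grown from an arbitrary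
      vertex.\<close>
    define d where "d = (if c = [] then [u] else c)"
    have d: "d \<noteq> []" "distinct d" "set d \<subseteq> V" "\<And>i. Suc i < length d \<Longrightarrow> {d ! i, d ! Suc i} \<in> E"
      using less.prems u by (auto simp: d_def)
    have "r \<notin> set d" using less.prems(2) d(3) by auto
    then obtain p where p: "parent_fun E r (set d) p" "\<forall>i. Suc i < length d \<longrightarrow> p (d ! i) = d ! Suc i"
       "{y \<in> set d. p y = r} = {last d}"
      using parent_fun_path[OF d(1,2) _ d(4)] by blast
    obtain K q where K: "set d \<subseteq> K" "K \<subseteq> V" "parent_fun E r K q" "\<forall>x\<in>set d. q x = p x"
       "{x \<in> K. q x = r} = {last d}" "\<forall>y\<in>V - K. nb E K y = {}"
      using parent_fun_extend[OF less.prems(1) d(3) less.prems(2) p(1)] p(3) by auto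
    have finK: "finite K" using K(2) less.prems(1) by (rule finite_subset)
    have finF: "finite F" using less.prems(3,1) by (rule finite_subset)
    have Kne: "K \<noteq> {}" using K(1) d(1) by auto
    have cVK: "card V = card K + card (V - K)"
      using K(2) less.prems(1) finK card_mono[OF less.prems(1) K(2)] by (simp add: card_Diff_subset)
    then have "card (V - K) < card V" using Kne finK by (simp add: card_gt_0_iff)
    then have "\<exists>p. parent_fun E r (V - K) p \<and> (\<forall>i. Suc i < length ([] :: 'a list) \<longrightarrow> p ([] ! i) = [] ! Suc i) \<and>
        card {x \<in> V - K. p x = r} + ec E (F - K) \<le> card (V - K)"
      by (rule less.hyps) (use less.prems in \<open>auto intro: coreless_subset\<close>)
    then obtain p' where p': "parent_fun E r (V - K) p'"
      "card {x \<in> V - K. p' x = r} + ec E (F - K) \<le> card (V - K)" by auto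
    define f where "f x = (if x \<in> K then q x else p' x)" for x
    have rV: "r \<notin> V" by (rule less.prems(2))
    have "parent_fun E r V f"
      unfolding parent_fun_def
    proof
      fix x assume x: "x \<in> V"
      show "f x \<in> insert r V \<and> (f x \<noteq> r \<longrightarrow> {x, f x} \<in> E \<and> f (f x) \<noteq> x)"
      proof (cases "x \<in> K")
        case True
        then have "q x \<in> insert r K" "q x \<noteq> r \<Longrightarrow> {x, q x} \<in> E \<and> q (q x) \<noteq> x"
          using K(3) by (auto simp: parent_fun_def)
        then show ?thesis using True K(2) by (auto simp: f_def)
      next
        case False
        then have "p' x \<in> insert r (V - K)" "p' x \<noteq> r \<Longrightarrow> {x, p' x} \<in> E \<and> p' (p' x) \<noteq> x"
          using p'(1) x by (auto simp: parent_fun_def)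
        then show ?thesis using False by (auto simp: f_def)
      qed
    qed
    moreover have "f (c ! i) = c ! Suc i" if "Suc i < length c" for i
    proof -
      have cd: "d = c" using that by (auto simp: d_def)
      have ci: "c ! i \<in> set d" using that cd by auto
      then have "c ! i \<in> K" using K(1) by auto
      then show ?thesis using ci K(4) p(2) that cd by (simp add: f_def)
    qed
    moreover have "card {x \<in> V. f x = r} + ec E F \<le> card V"
    proof -
      have "{x \<in> V. f x = r} = {last d} \<union> {x \<in> V - K. p' x = r}"
        unfolding K(5)[symmetric] using K(2) by (auto simp: f_def)
      then have "card {x \<in> V. f x = r} \<le> 1 + card {x \<in> V - K. p' x = r}"
        using card_Un_le[of "{last d}"] by (metis card.empty card_insert_le_Suc One_nat_def insert_is_Un plus_1_eq_Suc)
      moreover have "ec E F = ec E (F \<inter> K) + ec E (F - K)"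
      proof -
        have "nb E (F \<inter> K) v = {}" if "v \<in> F - K" for v
          using K(6) that less.prems(3) nb_mono[of "F \<inter> K" K E v] by auto
        moreover have "F = (F \<inter> K) \<union> (F - K)" by auto
        ultimately show ?thesis
          using ec_Un[OF assms(1), of "F \<inter> K" "F - K"] finF by auto
      qed
      moreover have "ec E (F \<inter> K) < card K"
      proof (cases "F \<inter> K = {}")
        case True
        then show ?thesis using assms(1) Kne finK by (simp add: card_gt_0_iff)
      next
        case False
        have "ec E (F \<inter> K) < card (F \<inter> K)"
          using less.prems(4) finF False by (intro coreless_ec[OF assms(1)]) (auto intro: coreless_subset)
        also have "\<dots> \<le> card K" using finK by (intro card_mono) auto
        finally show ?thesis .
      qed
      ultimately show ?thesis using p'(2) cVK by linarith
    qed
    ultimately show ?thesis by (intro exI[of _ f]) auto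
  qed
qed

lemma pedges_restrict [simp]: "pedges r V (restrict p V) = pedges r V p"
  by (auto simp: pedges_def)

lemma card_pedges:
  assumes "finite V" "parent_fun E r V p"
  shows "card (pedges r V p) + card {x \<in> V. p x = r} = card V"
proof -
  have "inj_on (\<lambda>x. {x, p x}) {x \<in> V. p x \<noteq> r}"
    using assms(2) by (auto simp: inj_on_def parent_fun_def doubleton_eq_iff)
  then have "card (pedges r V p) = card {x \<in> V. p x \<noteq> r}"
    unfolding pedges_def by (rule card_image)
  moreover have "V = {x \<in> V. p x \<noteq> r} \<union> {x \<in> V. p x = r}" by auto
  then have "card V = card {x \<in> V. p x \<noteq> r} + card {x \<in> V. p x = r}"
    using assms(1) by (metis (no_types, lifting) card_Un_disjoint disjoint_iff finite_Un mem_Collect_eq)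
  ultimately show ?thesis by simp
qed

lemma pedges_subset: "parent_fun E r V p \<Longrightarrow> pedges r V p \<subseteq> {e \<in> E. e \<subseteq> V}"
  by (auto simp: pedges_def parent_fun_def)

text \<open>Taking the forest to be the whole graph, the inequality of \<open>ex_parent_fun\<close>
  leaves no edge unrecorded: both edge counts must be equal, and the roots then count the
  trees.\<close>

lemma forest_parent_fun:
  assumes "graph2 E" "finite V" "r \<notin> V" "coreless E V"
  shows "\<exists>p. parent_fun E r V p \<and> pedges r V p = {e \<in> E. e \<subseteq> V} \<and>
    card {x \<in> V. p x = r} = card V - ec E V"
proof -
  obtain p where p: "parent_fun E r V p" "card {x \<in> V. p x = r} + ec E V \<le> card V"
    using ex_parent_fun[OF assms(1-3) order_refl assms(4), of "[]"] by auto
  have "card (pedges r V p) \<le> ec E V"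
    unfolding ec_def using pedges_subset[OF p(1)] assms(2) by (intro card_mono) auto
  then have *: "card (pedges r V p) = ec E V" "card {x \<in> V. p x = r} = card V - ec E V"
    using card_pedges[OF assms(2) p(1)] p(2) by linarith+
  then have "pedges r V p = {e \<in> E. e \<subseteq> V}"
    using pedges_subset[OF p(1)] assms(2) by (intro card_subset_eq) (auto simp: ec_def)
  then show ?thesis using p * by blast
qed

section \<open>Counting small subsets and special parent functions\<close>

lemma bounded_subsets:
  assumes "finite A"
  shows "finite {X. X \<subseteq> A \<and> card X \<le> m}" "card {X. X \<subseteq> A \<and> card X \<le> m} \<le> (card A + 1) ^ m"
proof -
  show fin: "finite {X. X \<subseteq> A \<and> card X \<le> m}" for m
    by (rule finite_subset[of _ "Pow A"]) (use assms in auto)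
  show "card {X. X \<subseteq> A \<and> card X \<le> m} \<le> (card A + 1) ^ m"
  proof (induction m)
    case 0
    have "{X. X \<subseteq> A \<and> card X \<le> 0} = {{}}"
      using finite_subset[OF _ assms] by (auto dest: card_eq_0_iff[THEN iffD1])
    then show ?case by simp
  next
    case (Suc m)
    let ?S = "\<lambda>m. {X. X \<subseteq> A \<and> card X \<le> m}"
    \<comment> \<open>\<open>None\<close> adds no element; this is the source of the
      \<open>+ 1\<close> in the base of the power.\<close>
    let ?f = "\<lambda>(a, X). case a of None \<Rightarrow> X | Some b \<Rightarrow> insert b X"
    have "?S (Suc m) \<subseteq> ?f ` (insert None (Some ` A) \<times> ?S m)"
    proof
      fix X assume X: "X \<in> ?S (Suc m)"
      show "X \<in> ?f ` (insert None (Some ` A) \<times> ?S m)"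
      proof (cases "X = {}")
        case True
        then show ?thesis by (intro image_eqI[of _ _ "(None, {})"]) auto
      next
        case False
        then obtain b where b: "b \<in> X" by auto
        have "finite X" using X assms finite_subset by auto
        then show ?thesis using X b
          by (intro image_eqI[of _ _ "(Some b, X - {b})"]) auto
      qed
    qed
    then have "card (?S (Suc m)) \<le> card (?f ` (insert None (Some ` A) \<times> ?S m))"
      using fin assms by (intro card_mono) auto
    also have "\<dots> \<le> card (insert None (Some ` A) \<times> ?S m)"
      using fin assms by (intro card_image_le) auto
    also have "\<dots> = (card A + 1) * card (?S m)"
      using assms by (simp add: card_cartesian_product card_image)
    also have "\<dots> \<le> (card A + 1) * (card A + 1) ^ m" by (rule mult_le_mono2[OF Suc])
    also have "\<dots> = (card A + 1) ^ Suc m" by simp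
    finally show ?case .
  qed
qed

lemma sum_Pow_insert:
  fixes f :: "'a set \<Rightarrow> real"
  assumes "finite A" "a \<notin> A"
  shows "(\<Sum>X\<in>Pow (insert a A). f X) = (\<Sum>X\<in>Pow A. f X + f (insert a X))"
proof -
  have inj: "inj_on (insert a) (Pow A)" using assms(2) by (auto simp: inj_on_def)
  have "(\<Sum>X\<in>Pow (insert a A). f X) = (\<Sum>X\<in>Pow A. f X) + (\<Sum>X\<in>insert a ` Pow A. f X)"
    unfolding Pow_insert using assms by (intro sum.union_disjoint) auto
  also have "(\<Sum>X\<in>insert a ` Pow A. f X) = (\<Sum>X\<in>Pow A. f (insert a X))"
    using sum.reindex[OF inj, of f] by simp
  finally show ?thesis by (simp add: sum.distrib)
qed

lemma sum_Pow_power: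
  fixes y :: real
  assumes "finite A"
  shows "(\<Sum>X\<in>Pow A. y ^ card X) = (1 + y) ^ card A"
  using assms
proof (induction A)
  case (insert a A)
  have "card (insert a X) = Suc (card X)" if "X \<in> Pow A" for X
    using that insert.hyps finite_subset[of X A] by (auto simp: card_insert_if)
  then have "(\<Sum>X\<in>Pow (insert a A). y ^ card X) = (\<Sum>X\<in>Pow A. (1 + y) * y ^ card X)"
    unfolding sum_Pow_insert[OF insert.hyps] by (intro sum.cong) (auto simp: algebra_simps)
  then show ?case using insert by (simp add: sum_distrib_left[symmetric])
qed simp

text \<open>Give each \<open>X\<close> the weight \<open>y ^ card X\<close> with
  \<open>y = m / L \<le> 1\<close>. A set of size at most \<open>m\<close> weighs at least
  \<open>y ^ m\<close>, and all subsets of \<open>A\<close> together weigh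
  \<open>(1 + y) ^ card A \<le> exp m\<close>.\<close>

lemma bounded_subsets_exp:
  assumes "finite A" "real (card A) \<le> L" "0 < m" "real m \<le> L"
  shows "real (card {X. X \<subseteq> A \<and> card X \<le> m}) \<le> (exp 1 * L / real m) ^ m"
proof -
  let ?S = "{X. X \<subseteq> A \<and> card X \<le> m}"
  define y where "y = real m / L"
  have L: "L > 0" using assms by linarith
  have y: "0 < y" "y \<le> 1" using assms L by (auto simp: y_def)
  have "real (card ?S) * y ^ m = (\<Sum>X\<in>?S. y ^ m)" by simp
  also have "\<dots> \<le> (\<Sum>X\<in>?S. y ^ card X)"
    using y by (intro sum_mono power_decreasing) auto
  also have "\<dots> \<le> (\<Sum>X\<in>Pow A. y ^ card X)"
    using y assms(1) by (intro sum_mono2) auto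
  also have "\<dots> = (1 + y) ^ card A" by (rule sum_Pow_power[OF assms(1)])
  also have "\<dots> \<le> exp y ^ card A" using y by (intro power_mono) auto
  also have "\<dots> = exp (card A * y)" by (simp add: exp_of_nat_mult)
  also have "\<dots> \<le> exp (L * y)" using assms(2) y by (intro iffD2[OF exp_le_cancel_iff] mult_right_mono) auto
  also have "L * y = real m * 1" using L by (simp add: y_def)
  also have "exp (real m * 1) = exp 1 ^ m" by (rule exp_of_nat_mult)
  finally have "real (card ?S) \<le> exp 1 ^ m / y ^ m" using y by (simp add: field_simps)
  also have "\<dots> = (exp 1 * L / real m) ^ m"
    unfolding power_divide[symmetric] using L assms(3) by (simp add: y_def)
  finally show ?thesis .
qed

lemma card_PiE_fixed:
  assumes "finite V" "D \<subseteq> V" "finite T"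
  shows "card {p \<in> V \<rightarrow>\<^sub>E T. \<forall>x\<in>D. p x = g x} \<le> card T ^ (card V - card D)"
proof -
  have "{p \<in> V \<rightarrow>\<^sub>E T. \<forall>x\<in>D. p x = g x} \<subseteq> PiE V (\<lambda>x. if x \<in> D then {g x} else T)"
    by (auto simp: PiE_def Pi_def)
  then have "card {p \<in> V \<rightarrow>\<^sub>E T. \<forall>x\<in>D. p x = g x} \<le> card (PiE V (\<lambda>x. if x \<in> D then {g x} else T))"
    using assms by (intro card_mono finite_PiE) auto
  also have "\<dots> = (\<Prod>x\<in>V. if x \<in> D then 1 else card T)"
    using assms(1) by (simp add: card_PiE if_distrib cong: if_cong)
  also have "\<dots> = card T ^ card (V - D)"
    using assms(1) by (simp add: prod.If_cases Diff_eq)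
  also have "card (V - D) = card V - card D"
    using assms by (intro card_Diff_subset) (auto intro: finite_subset)
  finally show ?thesis .
qed

text \<open>Guess \<open>d\<close> preimages of \<open>y\<close>: with N = \<open>card V\<close>,
  each guess leaves at most |T|^(N-d) functions, and (N choose d) d! \<le> N^d \<le> |T|^d. For
  \<open>y = r\<close> this is the factor 1/\<kappa>! for many roots, for a vertex \<open>y\<close>
  the rarity of high degrees.\<close>

lemma card_many_preimages:
  assumes "finite V" "finite T" "card V \<le> card T"
  shows "card {p \<in> V \<rightarrow>\<^sub>E T. d \<le> card {x \<in> V. p x = y}} * fact d \<le> card T ^ card V"
proof (cases "d \<le> card V")
  case True
  let ?Q = "\<lambda>D. {p \<in> V \<rightarrow>\<^sub>E T. \<forall>x\<in>D. p x = y}"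
  let ?DD = "{D. D \<subseteq> V \<and> card D = d}"
  have finDD: "finite ?DD" using assms(1) by (auto intro: finite_subset[of _ "Pow V"])
  have "finite (V \<rightarrow>\<^sub>E T)" using assms by (intro finite_PiE) auto
  then have finQ: "finite (?Q D)" for D by simp
  have "{p \<in> V \<rightarrow>\<^sub>E T. d \<le> card {x \<in> V. p x = y}} \<subseteq> (\<Union>D\<in>?DD. ?Q D)"
  proof
    fix p assume p: "p \<in> {p \<in> V \<rightarrow>\<^sub>E T. d \<le> card {x \<in> V. p x = y}}"
    then obtain D where "D \<subseteq> {x \<in> V. p x = y}" "card D = d"
      using obtain_subset_with_card_n by (metis (mono_tags, lifting) mem_Collect_eq)
    then show "p \<in> (\<Union>D\<in>?DD. ?Q D)" using p by auto
  qed
  then have "card {p \<in> V \<rightarrow>\<^sub>E T. d \<le> card {x \<in> V. p x = y}} \<le> card (\<Union>D\<in>?DD. ?Q D)"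
    using finDD finQ by (intro card_mono) auto
  also have "\<dots> \<le> (\<Sum>D\<in>?DD. card (?Q D))" by (rule card_UN_le[OF finDD])
  also have "\<dots> \<le> (\<Sum>D\<in>?DD. card T ^ (card V - d))"
    using card_PiE_fixed[OF assms(1) _ assms(2), of _ "\<lambda>_. y"] by (intro sum_mono) auto
  also have "\<dots> = (card V choose d) * card T ^ (card V - d)"
    using n_subsets[OF assms(1)] by simp
  finally have "card {p \<in> V \<rightarrow>\<^sub>E T. d \<le> card {x \<in> V. p x = y}} * fact d
      \<le> (card V choose d) * fact d * card T ^ (card V - d)" by (simp add: algebra_simps)
  also have "\<dots> \<le> card V ^ d * card T ^ (card V - d)"
    using binomial_fact_pow[of "card V" d] by (intro mult_right_mono) auto
  also have "\<dots> \<le> card T ^ d * card T ^ (card V - d)"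
    using assms(3) by (intro mult_right_mono power_mono) auto
  also have "\<dots> = card T ^ card V" using True by (simp add: power_add[symmetric])
  finally show ?thesis .
next
  case False
  have "card {x \<in> V. p x = y} \<le> card V" for p using assms(1) by (intro card_mono) auto
  then have "{p \<in> V \<rightarrow>\<^sub>E T. d \<le> card {x \<in> V. p x = y}} = {}" using False by (blast dest: order_trans)
  then show ?thesis by (simp only: card.empty mult_0 le0)
qed

text \<open>There are at most \<open>2 ^ card V\<close> sets \<open>W\<close>; a vertex outside
  \<open>W\<close> has at most \<open>w + 1\<close> possible values, one inside has
  \<open>card V + 1\<close>.\<close>

lemma card_small_image:
  assumes "finite V" "r \<notin> V" "w \<le> card V"
  shows "card {p \<in> V \<rightarrow>\<^sub>E insert r V. \<exists>W\<subseteq>V. card W \<le> w \<and> (\<forall>x\<in>V - W. p x \<in> insert r W)}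
    \<le> 2 ^ card V * ((w + 1) ^ (card V - w) * (card V + 1) ^ w)"
proof -
  let ?Q = "\<lambda>W. PiE V (\<lambda>x. if x \<in> W then insert r V else insert r W)"
  let ?WW = "{W. W \<subseteq> V \<and> card W \<le> w}"
  have finWW: "finite ?WW" using assms(1) by (auto intro: finite_subset[of _ "Pow V"])
  have finW: "finite W" if "W \<subseteq> V" for W using that assms(1) by (rule finite_subset)
  have finQ: "finite (?Q W)" if "W \<in> ?WW" for W using that assms finW by (intro finite_PiE) auto
  have cQ: "card (?Q W) \<le> (w + 1) ^ (card V - w) * (card V + 1) ^ w" if W: "W \<in> ?WW" for W
  proof -
    have "card (?Q W) = (\<Prod>x\<in>V. card (if x \<in> W then insert r V else insert r W))"
      using assms(1) by (simp add: card_PiE)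
    also have "\<dots> = (\<Prod>x\<in>V. if x \<in> W then card V + 1 else card W + 1)"
    proof -
      have "r \<notin> W" "finite W" using W assms(2) finW by auto
      then show ?thesis using assms(1,2) by (intro prod.cong) auto
    qed
    also have "\<dots> = (card V + 1) ^ card W * (card W + 1) ^ (card V - card W)"
      using assms(1) W finW[of W]
      by (simp add: prod.If_cases Diff_eq[symmetric] Int_absorb1 card_Diff_subset)
    also have "\<dots> \<le> (card V + 1) ^ card W * (w + 1) ^ (card V - card W)"
      using W by (intro mult_left_mono power_mono) auto
    also have "card V - card W = (w - card W) + (card V - w)" using W assms(3) by auto
    also have "(card V + 1) ^ card W * (w + 1) ^ ((w - card W) + (card V - w)) =
        (card V + 1) ^ card W * (w + 1) ^ (w - card W) * (w + 1) ^ (card V - w)"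
      by (simp add: power_add)
    also have "\<dots> \<le> (card V + 1) ^ card W * (card V + 1) ^ (w - card W) * (w + 1) ^ (card V - w)"
      using assms(3) by (intro mult_right_mono mult_left_mono power_mono) auto
    also have "\<dots> = (w + 1) ^ (card V - w) * (card V + 1) ^ w"
      using W by (simp add: power_add[symmetric])
    finally show ?thesis .
  qed
  have "{p \<in> V \<rightarrow>\<^sub>E insert r V. \<exists>W\<subseteq>V. card W \<le> w \<and> (\<forall>x\<in>V - W. p x \<in> insert r W)} \<subseteq> (\<Union>W\<in>?WW. ?Q W)"
    by (auto simp: PiE_def Pi_def)
  then have "card {p \<in> V \<rightarrow>\<^sub>E insert r V. \<exists>W\<subseteq>V. card W \<le> w \<and> (\<forall>x\<in>V - W. p x \<in> insert r W)}
      \<le> card (\<Union>W\<in>?WW. ?Q W)"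
    using finWW finQ by (intro card_mono) auto
  also have "\<dots> \<le> (\<Sum>W\<in>?WW. card (?Q W))" by (rule card_UN_le[OF finWW])
  also have "\<dots> \<le> card ?WW * ((w + 1) ^ (card V - w) * (card V + 1) ^ w)"
    using sum_bounded_above[of ?WW "\<lambda>W. card (?Q W)", OF cQ] by simp
  also have "\<dots> \<le> 2 ^ card V * ((w + 1) ^ (card V - w) * (card V + 1) ^ w)"
    using card_mono[of "Pow V" ?WW] assms(1) by (intro mult_right_mono) (auto simp: card_Pow)
  finally show ?thesis .
qed

text \<open>The birthday estimate: each factor N - i is at most N exp (- i / N).\<close>

lemma falling_product_le:
  assumes "g \<le> N" "0 < N"
  shows "real (\<Prod>{N - g + 1..N}) \<le> real N ^ g * exp (- (real g * (real g - 1) / (2 * real N)))"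
  using assms(1)
proof (induction g)
  case (Suc g)
  have "{N - Suc g + 1..N} = insert (N - g) {N - g + 1..N}" using Suc.prems by auto
  then have "real (\<Prod>{N - Suc g + 1..N}) = real (N - g) * real (\<Prod>{N - g + 1..N})"
    by simp
  also have "\<dots> \<le> real (N - g) * (real N ^ g * exp (- (real g * (real g - 1) / (2 * real N))))"
    using Suc by (intro mult_left_mono) auto
  also have "\<dots> \<le> (real N * exp (- (real g / real N))) * (real N ^ g * exp (- (real g * (real g - 1) / (2 * real N))))"
  proof (rule mult_right_mono)
    have "1 - real g / real N \<le> exp (- (real g / real N))"
      using exp_ge_add_one_self[of "- (real g / real N)"] by simp
    then have "real N * (1 - real g / real N) \<le> real N * exp (- (real g / real N))"
      by (intro mult_left_mono) auto
    then show "real (N - g) \<le> real N * exp (- (real g / real N))"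
      using Suc.prems assms(2) by (simp add: algebra_simps of_nat_diff)
  qed auto
  also have "\<dots> = real N ^ Suc g * exp (- (real g / real N) + - (real g * (real g - 1) / (2 * real N)))"
    unfolding exp_add by (simp add: mult_ac)
  also have "- (real g / real N) + - (real g * (real g - 1) / (2 * real N)) =
      - (real (Suc g) * (real (Suc g) - 1) / (2 * real N))"
    using assms(2) by (simp add: field_simps)
  finally show ?case .
qed simp

text \<open>The vertex sequences of length \<open>g\<close> are counted by a falling factorial, and
  each fixes \<open>g - 1\<close> values of \<open>p\<close>. The exponential saving is that of the
  falling factorial against a power; the one value that is not fixed explains the exponent
  \<open>card V + 1\<close>.\<close>

lemma card_long_path:
  assumes "finite V" "r \<notin> V" "0 < g"
  shows "real (card {p \<in> V \<rightarrow>\<^sub>E insert r V. \<exists>c. distinct c \<and> set c \<subseteq> V \<and> length c = g \<and>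
      (\<forall>i. Suc i < g \<longrightarrow> p (c ! i) = c ! Suc i)})
    \<le> real (card V + 1) ^ (card V + 1) * exp (- (real g * (real g - 1) / (2 * real (card V))))"
proof -
  let ?N = "card V"
  let ?C = "{c. length c = g \<and> distinct c \<and> set c \<subseteq> V}"
  let ?Q = "\<lambda>c. {p \<in> V \<rightarrow>\<^sub>E insert r V. \<forall>i. Suc i < g \<longrightarrow> p (c ! i) = c ! Suc i}"
  let ?P = "{p \<in> V \<rightarrow>\<^sub>E insert r V. \<exists>c. distinct c \<and> set c \<subseteq> V \<and> length c = g \<and>
      (\<forall>i. Suc i < g \<longrightarrow> p (c ! i) = c ! Suc i)}"
  show ?thesis
  proof (cases "g \<le> ?N")
    case True
    have finC: "finite ?C"
      by (rule finite_subset[of _ "{c. set c \<subseteq> V \<and> length c = g}"]) (use assms(1) in \<open>auto intro: finite_lists_length_eq\<close>)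
    have finPi: "finite (V \<rightarrow>\<^sub>E insert r V)" using assms(1) by (intro finite_PiE) auto
    then have finQ: "finite (?Q c)" for c by simp
    have cQ: "card (?Q c) \<le> (?N + 1) ^ (?N - (g - 1))" if c: "c \<in> ?C" for c
    proof -
      let ?D = "(!) c ` {..<g - 1}"
      have inj: "inj_on ((!) c) {..<g}" using c by (auto simp: inj_on_def nth_eq_iff_index_eq)
      define nx where "nx x = c ! Suc (the_inv_into {..<g} ((!) c) x)" for x
      have nx: "nx (c ! i) = c ! Suc i" if "i < g" for i
        using that the_inv_into_f_f[OF inj, of i] by (simp add: nx_def)
      have "card ?D = g - 1"
        using inj by (subst card_image) (auto intro: inj_on_subset)
      moreover have "?D \<subseteq> V" using c by auto
      moreover have "?Q c \<subseteq> {p \<in> V \<rightarrow>\<^sub>E insert r V. \<forall>x\<in>?D. p x = nx x}"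
        using nx by auto
      then have "card (?Q c) \<le> card {p \<in> V \<rightarrow>\<^sub>E insert r V. \<forall>x\<in>?D. p x = nx x}"
        by (rule card_mono[rotated]) (simp add: finPi)
      moreover have "card {p \<in> V \<rightarrow>\<^sub>E insert r V. \<forall>x\<in>?D. p x = nx x} \<le> card (insert r V) ^ (card V - card ?D)"
        using \<open>?D \<subseteq> V\<close> assms(1) by (intro card_PiE_fixed) auto
      ultimately show ?thesis using assms by simp
    qed
    have "?P \<subseteq> (\<Union>c\<in>?C. ?Q c)" by auto
    then have "card ?P \<le> card (\<Union>c\<in>?C. ?Q c)" using finC finQ by (intro card_mono) auto
    also have "\<dots> \<le> (\<Sum>c\<in>?C. card (?Q c))" by (rule card_UN_le[OF finC])
    also have "\<dots> \<le> card ?C * (?N + 1) ^ (?N - (g - 1))"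
      using sum_bounded_above[of ?C "\<lambda>c. card (?Q c)", OF cQ] by simp
    also have "card ?C = \<Prod>{?N - g + 1..?N}"
      using card_lists_distinct_length_eq[OF assms(1) True] by simp
    finally have "real (card ?P) \<le> real (\<Prod>{?N - g + 1..?N} * (?N + 1) ^ (?N - (g - 1)))"
      by (rule of_nat_mono)
    then have "real (card ?P) \<le> real (\<Prod>{?N - g + 1..?N}) * real (?N + 1) ^ (?N - (g - 1))"
      by (simp only: of_nat_mult of_nat_power)
    also have "\<dots> \<le> (real ?N ^ g * exp (- (real g * (real g - 1) / (2 * real ?N)))) * real (?N + 1) ^ (?N - (g - 1))"
      using True assms(3) by (intro mult_right_mono falling_product_le) auto
    also have "\<dots> \<le> (real (?N + 1) ^ g * exp (- (real g * (real g - 1) / (2 * real ?N)))) * real (?N + 1) ^ (?N - (g - 1))"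
      by (intro mult_right_mono power_mono) auto
    also have "\<dots> = real (?N + 1) ^ (g + (?N - (g - 1))) * exp (- (real g * (real g - 1) / (2 * real ?N)))"
      by (simp add: power_add)
    also have "g + (?N - (g - 1)) = ?N + 1" using True assms(3) by simp
    finally show ?thesis .
  next
    case False
    have "length c \<le> ?N" if "distinct c" "set c \<subseteq> V" for c
      using that card_mono[OF assms(1)] distinct_card by metis
    then have "\<not> (\<exists>c. distinct c \<and> set c \<subseteq> V \<and> length c = g)" using False by blast
    then have "?P = {}" by blast
    then have "card ?P = 0" by (simp only: card.empty)
    then show ?thesis by (simp only: of_nat_0) simp
  qed
qed

section \<open>A lower bound for the number of forests\<close>

text \<open>For finite \<open>V\<close> this says that \<open>p\<close> has no directed cycle.
  Quantifying over all subsets allows it to be applied directly to a core, or to the set where two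
  functions differ.\<close>

definition acyclic_fun :: "'a set \<Rightarrow> ('a \<Rightarrow> 'a) \<Rightarrow> bool" where
  "acyclic_fun V p \<longleftrightarrow> (\<forall>W\<subseteq>V. W \<noteq> {} \<longrightarrow> (\<exists>x\<in>W. p x \<notin> W))"

definition rooted_forests :: "'a \<Rightarrow> 'a set \<Rightarrow> nat \<Rightarrow> ('a \<Rightarrow> 'a) set" where
  "rooted_forests r V j = {p \<in> V \<rightarrow>\<^sub>E insert r V. acyclic_fun V p \<and> card {x \<in> V. p x = r} = j}"

definition pairs :: "'a set \<Rightarrow> 'a set set" where
  "pairs V = {e. e \<subseteq> V \<and> card e = 2}"

definition forests :: "'a set \<Rightarrow> 'a set set set" where
  "forests V = {E. E \<subseteq> pairs V \<and> coreless E V}"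

lemma finite_pairs [simp]: "finite V \<Longrightarrow> finite (pairs V)"
  by (rule finite_subset[of _ "Pow V"]) (auto simp: pairs_def)

lemma finite_forests [simp]: "finite V \<Longrightarrow> finite (forests V)"
  by (rule finite_subset[of _ "Pow (pairs V)"]) (auto simp: forests_def)

lemma graph2_pairs: "E \<subseteq> pairs V \<Longrightarrow> graph2 E"
  by (auto simp: graph2_def pairs_def)

lemma finite_rooted_forests [simp]: "finite V \<Longrightarrow> finite (rooted_forests r V j)"
  by (rule finite_subset[of _ "V \<rightarrow>\<^sub>E insert r V"]) (auto simp: rooted_forests_def intro: finite_PiE)

text \<open>Only the root of the tree of \<open>y\<close> cannot be attached to \<open>y\<close>.\<close>

lemma acyclic_fun_attach:
  assumes "finite V" "r \<notin> V" "p \<in> V \<rightarrow>\<^sub>E insert r V" "acyclic_fun V p" "y \<in> V"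
  shows "\<exists>\<rho>0\<in>V. p \<rho>0 = r \<and> (\<forall>\<rho>\<in>V. p \<rho> = r \<and> \<rho> \<noteq> \<rho>0 \<longrightarrow> acyclic_fun V (p(\<rho> := y)))"
proof -
  define closed where "closed W \<longleftrightarrow> (\<forall>x\<in>W. p x \<noteq> r \<longrightarrow> p x \<in> W)" for W
  \<comment> \<open>\<open>O'\<close> consists of \<open>y\<close> and its ancestors; the one vertex
    whose parent leaves \<open>O'\<close> is the root of the tree of \<open>y\<close>.\<close>
  define O' where "O' = \<Inter>{W. W \<subseteq> V \<and> y \<in> W \<and> closed W}"
  have "closed V" using assms(3) by (auto simp: closed_def)
  then have OV: "O' \<subseteq> V" using assms(5) by (auto simp: O'_def)
  have yO: "y \<in> O'" by (auto simp: O'_def)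
  have clO: "closed O'" by (auto simp: O'_def closed_def)
  obtain \<rho>0 where \<rho>0: "\<rho>0 \<in> O'" "p \<rho>0 \<notin> O'"
    using assms(4) OV yO unfolding acyclic_fun_def by blast
  then have root: "p \<rho>0 = r" using clO by (auto simp: closed_def)
  have "acyclic_fun V (p(\<rho> := y))" if \<rho>: "\<rho> \<in> V" "p \<rho> = r" "\<rho> \<noteq> \<rho>0" for \<rho>
    unfolding acyclic_fun_def
  proof (intro allI impI, rule ccontr)
    fix W assume W: "W \<subseteq> V" "W \<noteq> {}" "\<not> (\<exists>x\<in>W. (p(\<rho> := y)) x \<notin> W)"
    then have in_W: "\<And>x. x \<in> W \<Longrightarrow> x \<noteq> \<rho> \<Longrightarrow> p x \<in> W" "\<rho> \<in> W \<Longrightarrow> y \<in> W" by (metis fun_upd_apply)+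
    show False
    proof (cases "\<rho> \<in> W")
      case True
      then have "closed W" "y \<in> W" using in_W \<rho>(2) by (auto simp: closed_def)
      then have "\<rho>0 \<in> W" using \<rho>0(1) W(1) by (auto simp: O'_def)
      then have "r \<in> W" using in_W(1)[of \<rho>0] root \<rho>(3) by auto
      then show False using W(1) assms(2) by auto
    next
      case False
      then show False using in_W(1) W(1,2) assms(4) unfolding acyclic_fun_def by metis
    qed
  qed
  then show ?thesis using \<rho>0(1) OV root by blast
qed

text \<open>Pitman's double count. In a forest with \<open>j + 1\<close> roots attach a root of
  another tree to a vertex \<open>y\<close>, in at least \<open>j\<close> ways for each
  \<open>y\<close>. The result has \<open>j\<close> roots, and with the attached vertex marked, one
  of the \<open>card V - j\<close> non-roots, it determines the forest and \<open>y\<close>.\<close>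

lemma rooted_forests_step:
  assumes "finite V" "r \<notin> V"
  shows "j * card V * card (rooted_forests r V (Suc j)) \<le> card (rooted_forests r V j) * (card V - j)"
proof -
  let ?\<Phi> = "rooted_forests r V"
  define Good where "Good p y = {\<rho> \<in> V. p \<rho> = r \<and> acyclic_fun V (p(\<rho> := y))}" for p y
  define T where "T = Sigma (?\<Phi> (Suc j)) (\<lambda>p. Sigma V (Good p))"
  define U where "U = Sigma (?\<Phi> j) (\<lambda>q. {\<rho> \<in> V. q \<rho> \<noteq> r})"
  have good: "j \<le> card (Good p y)" if p: "p \<in> ?\<Phi> (Suc j)" and y: "y \<in> V" for p y
  proof -
    have p': "p \<in> V \<rightarrow>\<^sub>E insert r V" "acyclic_fun V p" "card {x \<in> V. p x = r} = Suc j"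
      using p by (auto simp: rooted_forests_def)
    obtain \<rho>0 where \<rho>0: "\<rho>0 \<in> V" "p \<rho>0 = r" "\<forall>\<rho>\<in>V. p \<rho> = r \<and> \<rho> \<noteq> \<rho>0 \<longrightarrow> acyclic_fun V (p(\<rho> := y))"
      using acyclic_fun_attach[OF assms p'(1,2) y] by blast
    have "card ({x \<in> V. p x = r} - {\<rho>0}) = j" using p'(3) \<rho>0 assms(1) by simp
    moreover have "{x \<in> V. p x = r} - {\<rho>0} \<subseteq> Good p y" using \<rho>0 by (auto simp: Good_def)
    moreover have "finite (Good p y)" using assms(1) by (simp add: Good_def)
    ultimately show ?thesis using card_mono by metis
  qed
  have finG: "finite (Good p y)" for p y using assms(1) by (simp add: Good_def)
  have "j * card V * card (?\<Phi> (Suc j)) = (\<Sum>p\<in>?\<Phi> (Suc j). \<Sum>y\<in>V. j)" by simp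
  also have "\<dots> \<le> (\<Sum>p\<in>?\<Phi> (Suc j). \<Sum>y\<in>V. card (Good p y))"
    using good by (intro sum_mono) auto
  also have "\<dots> = card T"
    unfolding T_def using assms(1) finG by (subst card_SigmaI) (auto simp: card_SigmaI)
  also have "card T \<le> card U"
  proof (rule card_inj_on_le)
    let ?f = "\<lambda>(p, y, \<rho>). (p(\<rho> := y), \<rho>)"
    show "finite U" unfolding U_def using assms(1) by (intro finite_SigmaI) auto
    show "inj_on ?f T"
    proof (rule inj_onI)
      fix t t' assume tt: "t \<in> T" "t' \<in> T" "?f t = ?f t'"
      obtain p y \<rho> p' y' \<rho>' where t: "t = (p, y, \<rho>)" "t' = (p', y', \<rho>')" by (metis prod_cases3)
      have *: "\<rho> = \<rho>'" "p(\<rho> := y) = p'(\<rho> := y')" "p \<rho> = r" "p' \<rho> = r"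
        using tt t by (auto simp: T_def Good_def)
      have "y = y'" using fun_cong[OF *(2), of \<rho>] by simp
      moreover have "p x = p' x" for x
        using fun_cong[OF *(2), of x] *(3,4) by (cases "x = \<rho>") auto
      ultimately show "t = t'" using t *(1) by auto
    qed
    show "?f ` T \<subseteq> U"
    proof
      fix z assume "z \<in> ?f ` T"
      then obtain p y \<rho> where z: "z = (p(\<rho> := y), \<rho>)" "p \<in> ?\<Phi> (Suc j)" "y \<in> V" "\<rho> \<in> Good p y"
        by (auto simp: T_def)
      have \<rho>: "\<rho> \<in> V" "p \<rho> = r" "acyclic_fun V (p(\<rho> := y))" "y \<noteq> r"
        using z assms(2) by (auto simp: Good_def)
      have "{x \<in> V. (p(\<rho> := y)) x = r} = {x \<in> V. p x = r} - {\<rho>}" using \<rho> by auto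
      then have "card {x \<in> V. (p(\<rho> := y)) x = r} = j"
        using z(2) \<rho> assms(1) by (simp add: rooted_forests_def)
      moreover have "p(\<rho> := y) \<in> V \<rightarrow>\<^sub>E insert r V"
        using z(2,3) \<rho>(1) by (auto simp: rooted_forests_def PiE_iff extensional_def)
      ultimately show "z \<in> U" using z(1) \<rho> by (auto simp: U_def rooted_forests_def)
    qed
  qed
  also have "card U = (\<Sum>q\<in>?\<Phi> j. card V - j)"
  proof -
    have "card {\<rho> \<in> V. q \<rho> \<noteq> r} = card V - j" if "q \<in> ?\<Phi> j" for q
    proof -
      have "{\<rho> \<in> V. q \<rho> \<noteq> r} = V - {x \<in> V. q x = r}" by auto
      then show ?thesis using that assms(1) by (simp add: card_Diff_subset rooted_forests_def)
    qed
    then show ?thesis unfolding U_def using assms(1) by (simp add: card_SigmaI)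
  qed
  finally show ?thesis by simp
qed

text \<open>The step inequalities are multiplied, starting from the forest in which every vertex is
  a root; the factorials clear the denominators. For \<open>m = card V - 1\<close> this is the
  Cayley count N^(N-1) of rooted trees on N vertices, as a lower bound.\<close>

lemma rooted_forests_lower:
  assumes "finite V" "r \<notin> V" "m < card V"
  shows "fact (card V - 1) * card V ^ m \<le>
    fact m * card (rooted_forests r V (card V - m)) * fact (card V - 1 - m)"
  using assms(3)
proof (induction m)
  case 0
  let ?p = "\<lambda>x\<in>V. r"
  have "acyclic_fun V ?p" unfolding acyclic_fun_def using assms(2) by (metis ex_in_conv restrict_apply' subsetD)
  moreover have "{x \<in> V. ?p x = r} = V" by auto
  ultimately have "?p \<in> rooted_forests r V (card V)" by (auto simp: rooted_forests_def)
  then have "1 \<le> card (rooted_forests r V (card V))"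
    using assms(1) by (simp add: Suc_le_eq card_gt_0_iff) blast
  then show ?case by simp
next
  case (Suc m)
  let ?N = "card V"
  let ?j = "?N - Suc m"
  have j: "?N - m = Suc ?j" "?N - 1 - m = Suc (?N - 1 - Suc m)" "?N - ?j = Suc m" "?j = Suc (?N - 1 - Suc m)"
    using Suc.prems by auto
  have e: "fact (Suc (?N - 1 - Suc m)) = ?j * (fact (?N - 1 - Suc m) :: nat)"
    by (simp only: fact_Suc of_nat_id j(4))
  have "fact (?N - 1) * ?N ^ Suc m = ?N * (fact (?N - 1) * ?N ^ m)" by simp
  also have "\<dots> \<le> ?N * (fact m * card (rooted_forests r V (Suc ?j)) * fact (Suc (?N - 1 - Suc m)))"
    using Suc j by (intro mult_left_mono) auto
  also have "\<dots> = fact m * fact (?N - 1 - Suc m) * (?j * ?N * card (rooted_forests r V (Suc ?j)))"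
    unfolding e by (simp only: mult_ac)
  also have "\<dots> \<le> fact m * fact (?N - 1 - Suc m) * (card (rooted_forests r V ?j) * Suc m)"
    using rooted_forests_step[OF assms(1,2), of ?j] j(3) by (intro mult_left_mono) auto
  also have "\<dots> = fact (Suc m) * card (rooted_forests r V ?j) * fact (?N - 1 - Suc m)"
    by (simp only: fact_Suc of_nat_id mult_ac)
  finally show ?case .
qed

text \<open>In every nonempty \<open>W\<close> some vertex has its parent outside \<open>W\<close>,
  so at most \<open>card W - 1\<close> edges lie inside \<open>W\<close>, too few for a
  core.\<close>

lemma acyclic_fun_pedges:
  assumes "finite V" "r \<notin> V" "p \<in> V \<rightarrow>\<^sub>E insert r V" "acyclic_fun V p"
  shows "pedges r V p \<in> forests V"
proof -
  have "p x \<noteq> x" if "x \<in> V" for x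
    using assms(4) that unfolding acyclic_fun_def by (metis empty_not_insert empty_subsetI insert_subset singletonD singletonI)
  then have sub: "pedges r V p \<subseteq> pairs V"
    using assms(3) by (force simp: pedges_def pairs_def card_insert_if)
  have "coreless (pedges r V p) V"
    unfolding coreless_def
  proof (intro allI impI notI)
    fix W assume W: "W \<subseteq> V" "core (pedges r V p) W"
    then have finW: "finite W" "W \<noteq> {}" by (auto simp: core_def)
    then obtain x where x: "x \<in> W" "p x \<notin> W" using assms(4) W unfolding acyclic_fun_def by blast
    have "card W \<le> ec (pedges r V p) W"
      by (rule core_ec[OF graph2_pairs[OF sub] W(2)])
    also have "\<dots> \<le> card ((\<lambda>x. {x, p x}) ` (W - {x}))"
      unfolding ec_def using finW x by (intro card_mono) (auto simp: pedges_def)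
    also have "\<dots> \<le> card (W - {x})" using finW by (intro card_image_le) auto
    also have "\<dots> < card W" using finW x by (intro card_Diff1_less) auto
    finally show False by simp
  qed
  then show ?thesis using sub by (simp add: forests_def)
qed

text \<open>Where \<open>p\<close> and \<open>q\<close> differ, choose \<open>x\<close> such that
  they agree at \<open>p x\<close>. The edge from \<open>x\<close> to \<open>p x\<close> must then
  come from \<open>q (p x) = x\<close>, so \<open>p (p x) = x\<close>, a directed 2-cycle.\<close>

lemma pedges_inj:
  assumes "r \<notin> V" "p \<in> V \<rightarrow>\<^sub>E insert r V" "q \<in> V \<rightarrow>\<^sub>E insert r V" "acyclic_fun V p"
    and "{x \<in> V. p x = r} = {x \<in> V. q x = r}" "pedges r V p = pedges r V q"
  shows "p = q"
proof -
  define W where "W = {x \<in> V. p x \<noteq> q x}"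
  have "W = {}"
  proof (rule ccontr)
    assume "W \<noteq> {}"
    then obtain x where x: "x \<in> W" "p x \<notin> W" using assms(4) unfolding acyclic_fun_def W_def by (metis (no_types, lifting) mem_Collect_eq subsetI)
    then have xV: "x \<in> V" "p x \<noteq> q x" by (auto simp: W_def)
    then have "p x \<noteq> r" using assms(5) by (metis (mono_tags, lifting) mem_Collect_eq)
    then have px: "p x \<in> V" using assms(2) xV by auto
    have "{x, p x} \<in> pedges r V q"
      using assms(6) xV \<open>p x \<noteq> r\<close> by (auto simp: pedges_def)
    then obtain z where z: "z \<in> V" "{x, p x} = {z, q z}" by (auto simp: pedges_def)
    then have "q (p x) = x" using xV(2) by (auto simp: doubleton_eq_iff)
    then have pp: "p (p x) = x" using x(2) px by (auto simp: W_def)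
    obtain w where "w \<in> {x, p x}" "p w \<notin> {x, p x}"
      using assms(4) xV px unfolding acyclic_fun_def by (metis empty_not_insert empty_subsetI insert_subset)
    then show False using pp by auto
  qed
  then have "\<And>x. x \<in> V \<Longrightarrow> p x = q x" by (auto simp: W_def)
  then show ?thesis using assms(2,3) by (intro PiE_ext)
qed

text \<open>Only trees are used: a rooted tree is determined by its root and its edges, which gives
  the factor \<open>card V\<close> on the right.\<close>

lemma forests_lower:
  assumes "finite V" "r \<notin> V" "V \<noteq> {}"
  shows "card V ^ (card V - 1) \<le> card V * card (forests V)"
proof -
  let ?N = "card V"
  have N: "0 < ?N" using assms by (simp add: card_gt_0_iff)
  then have j: "?N - (?N - 1) = 1" "?N - 1 - (?N - 1) = 0" by auto
  have "fact (?N - 1) * ?N ^ (?N - 1) \<le> fact (?N - 1) * card (rooted_forests r V 1)"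
    using rooted_forests_lower[OF assms(1,2), of "?N - 1"] N unfolding j by simp
  then have "?N ^ (?N - 1) \<le> card (rooted_forests r V 1)" by simp
  also have "\<dots> \<le> card ((\<lambda>x. {x}) ` V \<times> forests V)"
  proof (rule card_inj_on_le)
    let ?f = "\<lambda>p. ({x \<in> V. p x = r}, pedges r V p)"
    show "inj_on ?f (rooted_forests r V 1)"
      using pedges_inj[OF assms(2)] by (auto simp: inj_on_def rooted_forests_def)
    show "?f ` rooted_forests r V 1 \<subseteq> (\<lambda>x. {x}) ` V \<times> forests V"
    proof
      fix z assume "z \<in> ?f ` rooted_forests r V 1"
      then obtain p where p: "z = ?f p" "p \<in> V \<rightarrow>\<^sub>E insert r V" "acyclic_fun V p" "card {x \<in> V. p x = r} = 1"
        by (auto simp: rooted_forests_def)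
      obtain x where x: "{x \<in> V. p x = r} = {x}" using p(4) by (rule card_1_singletonE)
      then have "{x \<in> V. p x = r} \<in> (\<lambda>x. {x}) ` V" by auto
      then show "z \<in> (\<lambda>x. {x}) ` V \<times> forests V" using acyclic_fun_pedges[OF assms(1,2) p(2,3)] p(1) by auto
    qed
  qed (use assms in auto)
  also have "\<dots> = ?N * card (forests V)"
    by (simp add: card_cartesian_product card_image)
  finally show ?thesis .
qed

section \<open>A lower bound for the size of the class\<close>

lemma disj_cores_le_card:
  assumes "disj_cores E V m" "finite S" "coreless E (V - S)"
  shows "m \<le> card S"
proof -
  obtain W where W: "\<forall>i<m. core E (W i)" "\<forall>i<m. W i \<subseteq> V"
    "\<forall>i<m. \<forall>j<m. i \<noteq> j \<longrightarrow> W i \<inter> W j = {}" using assms(1) by (rule disj_coresE)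
  have "W i \<inter> S \<noteq> {}" if i: "i < m" for i
  proof
    assume "W i \<inter> S = {}"
    then have "W i \<subseteq> V - S" using W(2) i by auto
    then show False using W(1) assms(3) i unfolding coreless_def by blast
  qed
  then have "\<forall>i. \<exists>s. i < m \<longrightarrow> s \<in> W i \<inter> S" by blast
  then have "\<exists>s. \<forall>i. i < m \<longrightarrow> s i \<in> W i \<inter> S" by (rule choice)
  then obtain s where s: "\<forall>i. i < m \<longrightarrow> s i \<in> W i \<inter> S" ..
  have "inj_on s {..<m}"
  proof (rule inj_onI)
    fix i j assume ij: "i \<in> {..<m}" "j \<in> {..<m}" "s i = s j"
    then have "s i \<in> W i \<inter> W j" using s by auto
    then show "i = j" using W(3) ij by auto
  qed
  moreover have "s ` {..<m} \<subseteq> S" using s by auto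
  ultimately have "card {..<m} \<le> card S" using assms(2) by (rule card_inj_on_le)
  then show ?thesis by simp
qed

lemma Ex_cycles_edges:
  "labelled (Ex_cycles m) n =
    (\<lambda>E. \<lparr>verts = {1..n}, edges = E\<rparr>) ` {E. E \<subseteq> pairs {1..n} \<and> \<not> disj_cores E {1..n} m}"
proof (intro set_eqI iffI)
  fix G assume "G \<in> labelled (Ex_cycles m) n"
  then have G: "verts G = {1..n}" "simple_graph G" "\<not> has_disjoint_cycles G m"
    by (auto simp: labelled_def Ex_cycles_def)
  then have "edges G \<subseteq> pairs {1..n}" by (auto simp: simple_graph_def pairs_def)
  moreover have "\<not> disj_cores (edges G) {1..n} m"
    using G has_disjoint_cycles_iff by metis
  ultimately show "G \<in> (\<lambda>E. \<lparr>verts = {1..n}, edges = E\<rparr>) ` {E. E \<subseteq> pairs {1..n} \<and> \<not> disj_cores E {1..n} m}"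
    using G(1) by (intro image_eqI[of _ _ "edges G"]) auto
next
  fix G assume "G \<in> (\<lambda>E. \<lparr>verts = {1..n}, edges = E\<rparr>) ` {E. E \<subseteq> pairs {1..n} \<and> \<not> disj_cores E {1..n} m}"
  then obtain E where E: "G = \<lparr>verts = {1..n}, edges = E\<rparr>" "E \<subseteq> pairs {1..n}" "\<not> disj_cores E {1..n} m"
    by auto
  then have "simple_graph G" by (auto simp: simple_graph_def pairs_def)
  then show "G \<in> labelled (Ex_cycles m) n"
    using E has_disjoint_cycles_iff[of G m] by (auto simp: labelled_def Ex_cycles_def)
qed

text \<open>Put an arbitrary forest on \<open>{k+1..n}\<close> and arbitrary edges between it and
  \<open>{1..k}\<close>. The \<open>k\<close> vertices form a blocker, so any \<open>k + 1\<close>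
  cores intersect; the two edge sets can be read off the union.\<close>

lemma card_Ex_cycles_lower:
  assumes "k < n"
  shows "2 ^ (k * (n - k)) * (n - k) ^ (n - k - 1) \<le> (n - k) * card (labelled (Ex_cycles (k + 1)) n)"
proof -
  let ?S = "{1..k}" and ?V = "{k+1..n}"
  define CP where "CP = (\<lambda>(s, y). {s, y}) ` (?S \<times> ?V)"
  have inj: "inj_on (\<lambda>(s, y). {s, y}) (?S \<times> ?V)" by (auto simp: inj_on_def doubleton_eq_iff)
  have finCP: "finite CP" by (simp add: CP_def)
  have cCP: "card CP = k * (n - k)" unfolding CP_def by (subst card_image[OF inj]) simp
  have CPV: "\<not> e \<subseteq> ?V" if "e \<in> CP" for e using that by (auto simp: CP_def)
  let ?T = "{E. E \<subseteq> pairs {1..n} \<and> \<not> disj_cores E {1..n} (k + 1)}"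
  have finT: "finite ?T" by (rule finite_subset[of _ "Pow (pairs {1..n})"]) auto
  have "card (Pow CP \<times> forests ?V) \<le> card ?T"
  proof (rule card_inj_on_le)
    let ?f = "\<lambda>(X, E). X \<union> E"
    show "inj_on ?f (Pow CP \<times> forests ?V)"
    proof (rule inj_onI, clarify)
      fix X E X' E' assume a: "X \<subseteq> CP" "X' \<subseteq> CP" "E \<in> forests ?V" "E' \<in> forests ?V" "X \<union> E = X' \<union> E'"
      have "e \<subseteq> ?V" if "e \<in> E \<union> E'" for e using that a(3,4) by (auto simp: forests_def pairs_def)
      then show "X = X' \<and> E = E'" using CPV a by blast
    qed
    show "?f ` (Pow CP \<times> forests ?V) \<subseteq> ?T"
    proof clarify
      fix X E assume X: "X \<subseteq> CP" and E: "E \<in> forests ?V"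
      have "CP \<subseteq> pairs {1..n}" using assms by (auto simp: CP_def pairs_def)
      moreover have "pairs ?V \<subseteq> pairs {1..n}" by (auto simp: pairs_def)
      ultimately have sub: "X \<union> E \<subseteq> pairs {1..n}" using X E by (auto simp: forests_def)
      have "coreless (X \<union> E) ({1..n} - ?S)"
        unfolding coreless_def
      proof (intro allI impI notI)
        fix W assume W: "W \<subseteq> {1..n} - ?S" "core (X \<union> E) W"
        then have WV: "W \<subseteq> ?V" by auto
        have "nb (X \<union> E) W x = nb E W x" if "x \<in> W" for x
          using CPV X WV that by (auto simp: nb_def) 
        then have "core E W" using W(2) by (simp add: core_def)
        then show False using E WV by (auto simp: forests_def coreless_def)
      qed
      then have "\<not> disj_cores (X \<union> E) {1..n} (k + 1)"
        using disj_cores_le_card[of "X \<union> E" "{1..n}" "k + 1" ?S] by auto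
      then show "X \<union> E \<subseteq> pairs {1..n} \<and> \<not> disj_cores (X \<union> E) {1..n} (k + 1)" using sub by blast
    qed
  qed (rule finT)
  also have "card ?T = card (labelled (Ex_cycles (k + 1)) n)"
    unfolding Ex_cycles_edges by (subst card_image) (auto simp: inj_on_def)
  finally have *: "2 ^ (k * (n - k)) * card (forests ?V) \<le> card (labelled (Ex_cycles (k + 1)) n)"
    using finCP by (simp add: card_cartesian_product card_Pow cCP)
  have "(n - k) ^ (n - k - 1) \<le> (n - k) * card (forests ?V)"
    using forests_lower[of ?V 0] assms by simp
  then have "2 ^ (k * (n - k)) * (n - k) ^ (n - k - 1) \<le> 2 ^ (k * (n - k)) * ((n - k) * card (forests ?V))"
    by (rule mult_left_mono) simp
  also have "\<dots> = (n - k) * (2 ^ (k * (n - k)) * card (forests ?V))" by simp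
  also have "\<dots> \<le> (n - k) * card (labelled (Ex_cycles (k + 1)) n)"
    using * by (rule mult_left_mono) simp
  finally show ?thesis .
qed

section \<open>Encoding graphs by parent functions\<close>

definition edges_in :: "'a set set \<Rightarrow> 'a set \<Rightarrow> 'a set set" where
  "edges_in E U = {e \<in> E. e \<subseteq> U}"

definition encoded :: "'a \<Rightarrow> 'a set \<Rightarrow> ('a \<Rightarrow> 'a) set \<Rightarrow> nat \<Rightarrow> 'a set set set" where
  "encoded r U P M = {pedges r U p \<union> X | p X. p \<in> P \<and> X \<subseteq> pairs U \<and> card X \<le> M}"

lemma nb_edges_in: "W \<subseteq> U \<Longrightarrow> x \<in> U \<Longrightarrow> nb (edges_in E U) W x = nb E W x"
  by (auto simp: nb_def edges_in_def)

lemma card_pairs_le: "finite U \<Longrightarrow> card (pairs U) + 1 \<le> (card U + 1) ^ 2"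
proof -
  assume fin: "finite U"
  have "pairs U \<subseteq> (\<lambda>(x, y). {x, y}) ` (U \<times> U)"
    by (auto simp: pairs_def card_2_iff)
  then have "card (pairs U) \<le> card ((\<lambda>(x, y). {x, y}) ` (U \<times> U))"
    using fin by (intro card_mono) auto
  also have "\<dots> \<le> card (U \<times> U)" using fin by (intro card_image_le) auto
  finally show ?thesis using fin by (simp add: card_cartesian_product power2_eq_square)
qed

lemma card_encoded:
  assumes "finite U" "finite P"
  shows "finite (encoded r U P M)" "card (encoded r U P M) \<le> card P * (card U + 1) ^ (2 * M)"
proof -
  let ?X = "{X. X \<subseteq> pairs U \<and> card X \<le> M}"
  have fX: "finite ?X" and cX: "card ?X \<le> (card (pairs U) + 1) ^ M"
    using bounded_subsets[of "pairs U" M] assms(1) by auto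
  have eq: "encoded r U P M = (\<lambda>(p, X). pedges r U p \<union> X) ` (P \<times> ?X)"
    by (auto simp: encoded_def)
  show "finite (encoded r U P M)" unfolding eq using fX assms(2) by (intro finite_imageI finite_cartesian_product)
  have "card (encoded r U P M) \<le> card (P \<times> ?X)"
    unfolding eq using fX assms(2) by (intro card_image_le finite_cartesian_product)
  also have "\<dots> \<le> card P * (card (pairs U) + 1) ^ M"
    unfolding card_cartesian_product using cX by (rule mult_le_mono2)
  also have "\<dots> \<le> card P * ((card U + 1) ^ 2) ^ M"
    by (intro mult_le_mono2 power_mono card_pairs_le assms) auto
  finally show "card (encoded r U P M) \<le> card P * (card U + 1) ^ (2 * M)" by (simp add: power_mult)
qed

text \<open>The parent function records at least \<open>ec E F\<close> edges, so at most
  \<open>M\<close> are left for \<open>X\<close>. The path \<open>c\<close> is handed through so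
  that a long path in the graph is visible in \<open>p\<close> itself.\<close>

lemma encoded_mem:
  assumes "E \<subseteq> pairs V" "finite U" "r \<notin> U" "F \<subseteq> U" "coreless E F" "ec E U \<le> ec E F + M"
    "distinct c" "set c \<subseteq> U" "\<And>i. Suc i < length c \<Longrightarrow> {c ! i, c ! Suc i} \<in> E"
  shows "\<exists>p X. p \<in> U \<rightarrow>\<^sub>E insert r U \<and> X \<subseteq> pairs U \<and> card X \<le> M \<and> edges_in E U = pedges r U p \<union> X \<and>
    (\<forall>i. Suc i < length c \<longrightarrow> p (c ! i) = c ! Suc i)"
proof -
  have g: "graph2 E" using assms(1) by (rule graph2_pairs)
  obtain p where p: "parent_fun E r U p" "\<forall>i. Suc i < length c \<longrightarrow> p (c ! i) = c ! Suc i"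
    "card {x \<in> U. p x = r} + ec E F \<le> card U"
    using ex_parent_fun[OF g assms(2-5,7-9)] by blast
  let ?p = "restrict p U"
  have sub: "pedges r U p \<subseteq> edges_in E U" using pedges_subset[OF p(1)] by (simp add: edges_in_def)
  have fin: "finite (edges_in E U)" using assms(2) by (simp add: edges_in_def)
  have "card (edges_in E U - pedges r U p) = ec E U - card (pedges r U p)"
    using sub fin by (subst card_Diff_subset) (auto simp: ec_def edges_in_def intro: finite_subset)
  also have "\<dots> \<le> M" using card_pedges[OF assms(2) p(1)] p(3) assms(6) by linarith
  finally have "card (edges_in E U - pedges r U p) \<le> M" .
  moreover have "edges_in E U - pedges r U p \<subseteq> pairs U" using assms(1) by (auto simp: edges_in_def pairs_def)
  moreover have "edges_in E U = pedges r U ?p \<union> (edges_in E U - pedges r U p)" using sub by auto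
  moreover have "?p \<in> U \<rightarrow>\<^sub>E insert r U" using p(1) by (auto simp: parent_fun_def)
  moreover have "?p (c ! i) = c ! Suc i" if "Suc i < length c" for i
  proof -
    have "c ! i \<in> set c" using that by (intro nth_mem) auto
    then have "c ! i \<in> U" using assms(8) by blast
    then show ?thesis using p(2) that by simp
  qed
  ultimately show ?thesis by blast
qed

section \<open>Restoring the deleted vertices\<close>

lemma card_touching:
  assumes "finite V" "S \<subseteq> V"
  shows "card {e \<in> pairs V. e \<inter> S \<noteq> {}} \<le> card S * card V"
proof -
  have fS: "finite S" using assms finite_subset by auto
  have "{e \<in> pairs V. e \<inter> S \<noteq> {}} \<subseteq> (\<lambda>(x, y). {x, y}) ` (S \<times> V)"
  proof
    fix e assume e: "e \<in> {e \<in> pairs V. e \<inter> S \<noteq> {}}"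
    then obtain s where s: "s \<in> e" "s \<in> S" by auto
    obtain a b where ab: "e = {a, b}" using e by (auto simp: pairs_def card_2_iff)
    define y where "y = (if s = a then b else a)"
    have "e = {s, y}" "y \<in> V" using ab s e by (auto simp: y_def pairs_def)
    then show "e \<in> (\<lambda>(x, y). {x, y}) ` (S \<times> V)" using s by auto
  qed
  then have "card {e \<in> pairs V. e \<inter> S \<noteq> {}} \<le> card ((\<lambda>(x, y). {x, y}) ` (S \<times> V))"
    using assms fS by (intro card_mono) auto
  also have "\<dots> \<le> card (S \<times> V)" using assms fS by (intro card_image_le) auto
  finally show ?thesis by (simp add: card_cartesian_product)
qed

lemma card_UN_bounded:
  assumes "finite I" "\<And>i. i \<in> I \<Longrightarrow> card (f i) \<le> Q"
  shows "card (\<Union>i\<in>I. f i) \<le> card I * Q"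
proof -
  have "card (\<Union>i\<in>I. f i) \<le> (\<Sum>i\<in>I. card (f i))" by (rule card_UN_le[OF assms(1)])
  also have "\<dots> \<le> card I * Q" using sum_bounded_above[of I "\<lambda>i. card (f i)" Q] assms(2) by simp
  finally show ?thesis .
qed

text \<open>A graph is given by \<open>S\<close>, the graph on \<open>V - S\<close>, and an
  arbitrary set of edges touching \<open>S\<close>, of which there are at most
  \<open>s * card V\<close> candidates.\<close>

lemma lift_count:
  assumes "finite V"
    and sub: "\<And>E. E \<in> \<E> \<Longrightarrow> E \<subseteq> pairs V \<and> (\<exists>S\<subseteq>V. card S \<le> s \<and> edges_in E (V - S) \<in> \<Q> S)"
    and Q: "\<And>S. S \<subseteq> V \<Longrightarrow> card S \<le> s \<Longrightarrow> finite (\<Q> S) \<and> card (\<Q> S) \<le> Q"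
  shows "card \<E> \<le> (card V + 1) ^ s * (Q * 2 ^ (s * card V))"
proof -
  let ?SS = "{S. S \<subseteq> V \<and> card S \<le> s}"
  let ?T = "\<lambda>S. {e \<in> pairs V. e \<inter> S \<noteq> {}}"
  let ?f = "\<lambda>S. (\<lambda>(H, R). H \<union> R) ` (\<Q> S \<times> Pow (?T S))"
  have fT: "finite (?T S)" for S using assms(1) by simp
  have fSS: "finite ?SS" and cSS: "card ?SS \<le> (card V + 1) ^ s"
    using bounded_subsets[OF assms(1), of s] by auto
  have cf: "card (?f S) \<le> Q * 2 ^ (s * card V)" if S: "S \<in> ?SS" for S
  proof -
    have "card (?f S) \<le> card (\<Q> S \<times> Pow (?T S))"
      using Q[of S] S fT by (intro card_image_le) auto
    also have "\<dots> = card (\<Q> S) * 2 ^ card (?T S)" using fT by (simp add: card_cartesian_product card_Pow)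
    also have "\<dots> \<le> Q * 2 ^ (s * card V)"
    proof (intro mult_le_mono power_increasing)
      have "card (?T S) \<le> card S * card V" using S by (intro card_touching assms(1)) auto
      also have "\<dots> \<le> s * card V" using S by (intro mult_le_mono1) auto
      finally show "card (?T S) \<le> s * card V" .
    qed (use Q S in auto)
    finally show ?thesis .
  qed
  have ff: "finite (?f S)" if "S \<in> ?SS" for S using Q[of S] that fT by auto
  have "\<E> \<subseteq> (\<Union>S\<in>?SS. ?f S)"
  proof
    fix E assume E: "E \<in> \<E>"
    have "\<exists>S\<subseteq>V. card S \<le> s \<and> edges_in E (V - S) \<in> \<Q> S" using sub[OF E] ..
    then obtain S where "S \<subseteq> V \<and> card S \<le> s \<and> edges_in E (V - S) \<in> \<Q> S" ..
    then have S: "E \<subseteq> pairs V" "S \<subseteq> V" "card S \<le> s" "edges_in E (V - S) \<in> \<Q> S"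
      using sub[OF E] by auto
    have "E = edges_in E (V - S) \<union> (E \<inter> ?T S)" using S(1) by (auto simp: edges_in_def pairs_def)
    then have "E \<in> ?f S" using S(4) by (intro image_eqI[of _ _ "(edges_in E (V - S), E \<inter> ?T S)"]) auto
    then show "E \<in> (\<Union>S\<in>?SS. ?f S)" using S by blast
  qed
  then have "card \<E> \<le> card (\<Union>S\<in>?SS. ?f S)" using fSS ff by (intro card_mono) auto
  also have "\<dots> \<le> card ?SS * (Q * 2 ^ (s * card V))" by (rule card_UN_bounded[OF fSS cf])
  also have "\<dots> \<le> (card V + 1) ^ s * (Q * 2 ^ (s * card V))" using cSS by (rule mult_le_mono1)
  finally show ?thesis .
qed

text \<open>As in \<open>lift_count\<close>, but one vertex \<open>s\<close> of \<open>S\<close> has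
  a restricted neighbourhood outside \<open>S\<close>, so \<open>b\<close> choices replace
  \<open>2 ^ card V\<close>. The restriction may depend on the graph outside \<open>S\<close>. Edges
  from \<open>s\<close> to the rest of \<open>S\<close> count among those touching
  \<open>S - {s}\<close>.\<close>

lemma lift_count_nb:
  assumes "finite V" "0 < k"
    and sub: "\<And>E. E \<in> \<E> \<Longrightarrow> E \<subseteq> pairs V \<and> (\<exists>S\<subseteq>V. card S = k \<and> edges_in E (V - S) \<in> \<Q> S \<and>
      (\<exists>s\<in>S. nb E (V - S) s \<in> \<B> S (edges_in E (V - S))))"
    and Q: "\<And>S. S \<subseteq> V \<Longrightarrow> card S = k \<Longrightarrow> finite (\<Q> S) \<and> card (\<Q> S) \<le> Q"
    and B: "\<And>S H. S \<subseteq> V \<Longrightarrow> card S = k \<Longrightarrow> H \<in> \<Q> S \<Longrightarrow> finite (\<B> S H) \<and> card (\<B> S H) \<le> b"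
  shows "card \<E> \<le> (card V + 1) ^ k * (k * (Q * (b * 2 ^ ((k - 1) * card V))))"
proof -
  let ?SS = "{S. S \<subseteq> V \<and> card S = k}"
  let ?T = "\<lambda>S. {e \<in> pairs V. e \<inter> S \<noteq> {}}"
  let ?g = "\<lambda>S s H. (\<lambda>(B, R). H \<union> (\<lambda>y. {s, y}) ` B \<union> R) ` (\<B> S H \<times> Pow (?T (S - {s})))"
  let ?f = "\<lambda>S. \<Union>s\<in>S. \<Union>H\<in>\<Q> S. ?g S s H"
  have fT: "finite (?T S)" for S using assms(1) by simp
  have "?SS \<subseteq> {S. S \<subseteq> V \<and> card S \<le> k}" by auto
  then have fSS: "finite ?SS" and cSS: "card ?SS \<le> (card V + 1) ^ k"
    using bounded_subsets[OF assms(1), of k] finite_subset[of ?SS] card_mono[of "{S. S \<subseteq> V \<and> card S \<le> k}" ?SS] by auto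
  have cg: "card (?g S s H) \<le> b * 2 ^ ((k - 1) * card V)" if S: "S \<in> ?SS" "s \<in> S" "H \<in> \<Q> S" for S s H
  proof -
    have "card (?g S s H) \<le> card (\<B> S H \<times> Pow (?T (S - {s})))"
      using B[of S H] S fT by (intro card_image_le) auto
    also have "\<dots> = card (\<B> S H) * 2 ^ card (?T (S - {s}))" using fT by (simp add: card_cartesian_product card_Pow)
    also have "\<dots> \<le> b * 2 ^ ((k - 1) * card V)"
    proof (intro mult_le_mono power_increasing)
      have "card (?T (S - {s})) \<le> card (S - {s}) * card V" using S by (intro card_touching assms(1)) auto
      also have "\<dots> = (k - 1) * card V" using S by simp
      finally show "card (?T (S - {s})) \<le> (k - 1) * card V" .
    qed (use B S in auto)
    finally show ?thesis .
  qed
  have fS: "finite S" if "S \<in> ?SS" for S using that assms(1) finite_subset by auto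
  have cf: "card (?f S) \<le> k * (Q * (b * 2 ^ ((k - 1) * card V)))" if S: "S \<in> ?SS" for S
  proof -
    have fQ: "finite (\<Q> S)" "card (\<Q> S) \<le> Q" using Q S by auto
    have "card (\<Union>H\<in>\<Q> S. ?g S s H) \<le> Q * (b * 2 ^ ((k - 1) * card V))" if "s \<in> S" for s
      using card_UN_bounded[OF fQ(1), of "?g S s", OF cg[OF S that]] fQ(2)
      by (meson le_trans mult_le_mono1)
    then have "card (?f S) \<le> card S * (Q * (b * 2 ^ ((k - 1) * card V)))"
      by (intro card_UN_bounded fS[OF S])
    then show ?thesis using S by simp
  qed
  have ff: "finite (?f S)" if S: "S \<in> ?SS" for S
    using Q[of S] B[of S] S fT fS[OF S] by (intro finite_UN_I finite_imageI finite_cartesian_product) auto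
  have "\<E> \<subseteq> (\<Union>S\<in>?SS. ?f S)"
  proof
    fix E assume E: "E \<in> \<E>"
    have "\<exists>S\<subseteq>V. card S = k \<and> edges_in E (V - S) \<in> \<Q> S \<and> (\<exists>s\<in>S. nb E (V - S) s \<in> \<B> S (edges_in E (V - S)))"
      using sub[OF E] ..
    then obtain S where S': "S \<subseteq> V \<and> card S = k \<and> edges_in E (V - S) \<in> \<Q> S \<and>
      (\<exists>s\<in>S. nb E (V - S) s \<in> \<B> S (edges_in E (V - S)))" ..
    then obtain s where "s \<in> S \<and> nb E (V - S) s \<in> \<B> S (edges_in E (V - S))" by auto
    then have S: "E \<subseteq> pairs V" "S \<subseteq> V" "card S = k" "edges_in E (V - S) \<in> \<Q> S" "s \<in> S"
      "nb E (V - S) s \<in> \<B> S (edges_in E (V - S))" using sub[OF E] S' by auto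
    have "E = edges_in E (V - S) \<union> (\<lambda>y. {s, y}) ` nb E (V - S) s \<union> (E \<inter> ?T (S - {s}))" (is "E = ?R")
    proof
      show "?R \<subseteq> E" by (auto simp: edges_in_def nb_def)
      show "E \<subseteq> ?R"
      proof
        fix e assume e: "e \<in> E"
        then have eV: "e \<subseteq> V" "e \<in> pairs V" using S(1) by (auto simp: pairs_def)
        show "e \<in> ?R"
        proof (cases "e \<inter> S = {} \<or> e \<inter> (S - {s}) \<noteq> {}")
          case True
          then show ?thesis using e eV by (auto simp: edges_in_def)
        next
          case False
          then have es: "s \<in> e" "e \<inter> S = {s}" by auto
          obtain a b where ab: "e = {a, b}" "a \<noteq> b" using eV by (auto simp: pairs_def card_2_iff)
          define y where "y = (if s = a then b else a)"
          have y: "e = {s, y}" "y \<noteq> s" using ab es by (auto simp: y_def)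
          then have "y \<in> V - S" using es eV by auto
          then have "y \<in> nb E (V - S) s" using e y by (simp add: nb_def)
          then show ?thesis using y by auto
        qed
      qed
    qed
    then have "E \<in> ?g S s (edges_in E (V - S))" using S(6)
      by (intro image_eqI[of _ _ "(nb E (V - S) s, E \<inter> ?T (S - {s}))"]) auto
    then show "E \<in> (\<Union>S\<in>?SS. ?f S)" using S by blast
  qed
  then have "card \<E> \<le> card (\<Union>S\<in>?SS. ?f S)" using fSS ff by (intro card_mono) auto
  also have "\<dots> \<le> card ?SS * (k * (Q * (b * 2 ^ ((k - 1) * card V))))" by (rule card_UN_bounded[OF fSS cf])
  also have "\<dots> \<le> (card V + 1) ^ k * (k * (Q * (b * 2 ^ ((k - 1) * card V))))" using cSS by (rule mult_le_mono1)
  finally show ?thesis .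
qed

text \<open>The forest \<open>U - A\<close> has \<open>card (U - A) - ec E (U - A)\<close> components.\<close>

definition many_comps :: "'a set \<Rightarrow> nat \<Rightarrow> nat \<Rightarrow> nat \<Rightarrow> 'a set set set" where
  "many_comps U a0 C \<kappa> = {E. E \<subseteq> pairs U \<and> (\<exists>A\<subseteq>U. card A \<le> a0 \<and> coreless E (U - A) \<and>
     card (U - A) - ec E (U - A) = \<kappa> \<and> ec E U \<le> ec E (U - A) + C * \<kappa>)}"

text \<open>Since \<open>U - A\<close> is coreless, the edges outside the parent function all touch
  \<open>A\<close>. This leaves at most \<open>a0 * card U \<le> L\<close> candidates, so the choice
  of \<open>C * \<kappa>\<close> of them costs little against the \<open>fact \<kappa>\<close>
  gained from the \<kappa> roots.\<close>

lemma card_many_comps: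
  assumes "finite U" "r \<notin> U" "real (a0 * card U) \<le> L" "0 < C * \<kappa>" "real (C * \<kappa>) \<le> L"
  shows "real (card (many_comps U a0 C \<kappa>)) * fact \<kappa> \<le>
    real (card U + 1) ^ a0 * (real (card U + 1) ^ card U * (exp 1 * L / real (C * \<kappa>)) ^ (C * \<kappa>))"
proof -
  let ?AA = "{A. A \<subseteq> U \<and> card A \<le> a0}"
  let ?P = "\<lambda>A. {p \<in> (U - A) \<rightarrow>\<^sub>E insert r (U - A). \<kappa> \<le> card {x \<in> U - A. p x = r}}"
  let ?T = "\<lambda>A. {e \<in> pairs U. e \<inter> A \<noteq> {}}"
  let ?X = "\<lambda>A. {X. X \<subseteq> ?T A \<and> card X \<le> C * \<kappa>}"
  let ?f = "\<lambda>A. (\<lambda>(p, X). pedges r (U - A) p \<union> X) ` (?P A \<times> ?X A)"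
  have fAA: "finite ?AA" and cAA: "card ?AA \<le> (card U + 1) ^ a0"
    using bounded_subsets[OF assms(1), of a0] by auto
  have fT: "finite (?T A)" for A using assms(1) by simp
  have fX: "finite (?X A)" for A by (rule bounded_subsets(1)[OF fT])
  have fP: "finite (?P A)" for A
  proof -
    have "finite ((U - A) \<rightarrow>\<^sub>E insert r (U - A))" using assms(1) by (intro finite_PiE) auto
    then show ?thesis by simp
  qed
  let ?b = "real (card U + 1) ^ card U / fact \<kappa> * (exp 1 * L / real (C * \<kappa>)) ^ (C * \<kappa>)"
  have cf: "real (card (?f A)) \<le> ?b" if A: "A \<in> ?AA" for A
  proof -
    have "card (?f A) \<le> card (?P A \<times> ?X A)" using fP fX by (intro card_image_le finite_cartesian_product)
    then have h0: "real (card (?f A)) \<le> real (card (?P A)) * real (card (?X A))"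
      by (simp only: card_cartesian_product of_nat_mult[symmetric] of_nat_le_iff)
    have hX: "real (card (?X A)) \<le> (exp 1 * L / real (C * \<kappa>)) ^ (C * \<kappa>)"
    proof (rule bounded_subsets_exp[OF fT _ assms(4,5)])
      have "card (?T A) \<le> card A * card U" using A by (intro card_touching assms(1)) auto
      also have "\<dots> \<le> a0 * card U" using A by (intro mult_le_mono1) auto
      finally show "real (card (?T A)) \<le> L" using assms(3) by linarith
    qed
    have hP: "real (card (?P A)) \<le> real (card U + 1) ^ card U / fact \<kappa>"
    proof -
      have cU: "card (U - A) \<le> card U" "card (insert r (U - A)) \<le> card U + 1"
        using assms(1,2) card_mono[of U "U - A"] by (auto simp: card_insert_if)
      have "card (?P A) * fact \<kappa> \<le> card (insert r (U - A)) ^ card (U - A)"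
        using assms(1) by (intro card_many_preimages) (auto intro: card_mono)
      also have "\<dots> \<le> (card U + 1) ^ card (U - A)" using cU by (intro power_mono) auto
      also have "\<dots> \<le> (card U + 1) ^ card U" using cU by (intro power_increasing) auto
      finally have "real (card (?P A) * fact \<kappa>) \<le> real ((card U + 1) ^ card U)" by (rule of_nat_mono)
      then show ?thesis by (simp only: of_nat_mult of_nat_power of_nat_fact pos_le_divide_eq fact_gt_zero)
    qed
    show ?thesis by (rule order_trans[OF h0 mult_mono[OF hP hX]]) auto
  qed
  have ff: "finite (?f A)" for A using fP fX by (intro finite_imageI finite_cartesian_product)
  have "many_comps U a0 C \<kappa> \<subseteq> (\<Union>A\<in>?AA. ?f A)"
  proof
    fix E assume "E \<in> many_comps U a0 C \<kappa>"
    then obtain A where E: "E \<subseteq> pairs U" "A \<subseteq> U" "card A \<le> a0" "coreless E (U - A)"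
      "card (U - A) - ec E (U - A) = \<kappa>" "ec E U \<le> ec E (U - A) + C * \<kappa>"
      unfolding many_comps_def by blast
    have g: "graph2 E" using E(1) by (rule graph2_pairs)
    obtain p where p: "parent_fun E r (U - A) p" "pedges r (U - A) p = {e \<in> E. e \<subseteq> U - A}"
       "card {x \<in> U - A. p x = r} = \<kappa>"
      using forest_parent_fun[OF g _ _ E(4), of r] assms(1,2) E(5) by auto
    let ?p = "restrict p (U - A)"
    have "{x \<in> U - A. ?p x = r} = {x \<in> U - A. p x = r}" by auto
    then have P: "?p \<in> ?P A" using p by (auto simp: parent_fun_def)
    have eU: "{e \<in> E. e \<subseteq> U} = E" using E(1) by (auto simp: pairs_def)
    have "E \<inter> ?T A = E - {e \<in> E. e \<subseteq> U - A}" using E(1) by (auto simp: pairs_def)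
    then have "card (E \<inter> ?T A) = ec E U - ec E (U - A)"
      using assms(1) by (simp add: ec_def eU card_Diff_subset)
    then have X: "E \<inter> ?T A \<in> ?X A" using E(6) by auto
    have "E = pedges r (U - A) ?p \<union> (E \<inter> ?T A)"
      using E(1) unfolding pedges_restrict p(2) by (auto simp: pairs_def)
    then have "E \<in> ?f A" using P X by (intro image_eqI[of _ _ "(?p, E \<inter> ?T A)"]) auto
    then show "E \<in> (\<Union>A\<in>?AA. ?f A)" using E(2,3) by blast
  qed
  then have "card (many_comps U a0 C \<kappa>) \<le> card (\<Union>A\<in>?AA. ?f A)" using fAA ff by (intro card_mono) auto
  also have "\<dots> \<le> (\<Sum>A\<in>?AA. card (?f A))" by (rule card_UN_le[OF fAA])
  finally have "real (card (many_comps U a0 C \<kappa>)) \<le> real (\<Sum>A\<in>?AA. card (?f A))" by (rule of_nat_mono)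
  also have "\<dots> = (\<Sum>A\<in>?AA. real (card (?f A)))" by (rule of_nat_sum)
  also have "\<dots> \<le> real (card ?AA) * ?b" by (rule sum_bounded_above[OF cf])
  also have "\<dots> \<le> real (card U + 1) ^ a0 * ?b"
  proof (rule mult_right_mono)
    show "real (card ?AA) \<le> real (card U + 1) ^ a0"
      using of_nat_mono[OF cAA, where 'a = real] by (simp only: of_nat_power)
    have "L \<ge> 0" using assms(3) by (meson of_nat_0_le_iff order_trans)
    then show "0 \<le> ?b" by simp
  qed
  also have "\<dots> = (real (card U + 1) ^ a0 * (real (card U + 1) ^ card U *
      (exp 1 * L / real (C * \<kappa>)) ^ (C * \<kappa>))) / fact \<kappa>"
    by (simp only: times_divide_eq_left times_divide_eq_right)
  finally show ?thesis by (simp only: pos_le_divide_eq fact_gt_zero)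
qed

section \<open>Random neighbourhoods\<close>

definition matching :: "'a set set \<Rightarrow> bool" where
  "matching M \<longleftrightarrow> finite M \<and> (\<forall>e\<in>M. \<forall>f\<in>M. e \<noteq> f \<longrightarrow> e \<inter> f = {})"

lemma filter_insert:
  "{x \<in> insert a A. P x} = (if P a then insert a {x \<in> A. P x} else {x \<in> A. P x})"
  by auto

text \<open>Divided by \<open>2 ^ card V\<close> this is the expectation of 2^(-m), where m is the
  number of matching edges inside a uniformly random \<open>B\<close>. Disjoint edges behave
  independently, and each contributes 3/4 + 1/4 * 1/2 = 7/8.\<close>

lemma sum_Pow_matching:
  assumes "finite M" "finite V" "M \<subseteq> pairs V" "\<forall>e\<in>M. \<forall>f\<in>M. e \<noteq> f \<longrightarrow> e \<inter> f = {}"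
  shows "(\<Sum>B\<in>Pow V. (1 / 2 :: real) ^ card {e \<in> M. e \<subseteq> B}) = 2 ^ card V * (7 / 8) ^ card M"
  using assms
proof (induction M arbitrary: V)
  case empty
  then show ?case by (simp add: card_Pow)
next
  case (insert e M)
  obtain a b where ab: "e = {a, b}" "a \<noteq> b" using insert.prems by (auto simp: pairs_def card_2_iff)
  define V' where "V' = V - {a, b}"
  have V: "V = insert a (insert b V')" "a \<notin> insert b V'" "b \<notin> V'" "finite V'"
  proof -
    have "{a, b} \<subseteq> V" using ab(1) insert.prems(2) by (simp add: pairs_def)
    then show "V = insert a (insert b V')" by (auto simp: V'_def)
    show "a \<notin> insert b V'" "b \<notin> V'" using ab(2) by (simp_all add: V'_def)
    show "finite V'" using insert.prems(1) by (simp add: V'_def)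
  qed
  have MV': "M \<subseteq> pairs V'"
  proof
    fix f assume f: "f \<in> M"
    then have "e \<noteq> f" using insert.hyps(2) by auto
    then have "e \<inter> f = {}" using bspec[OF bspec[OF insert.prems(3), of e], of f] f by simp
    then show "f \<in> pairs V'" using f insert.prems(2) ab by (auto simp: pairs_def V'_def)
  qed
  let ?h = "\<lambda>B. (1 / 2 :: real) ^ card {f \<in> insert e M. f \<subseteq> B}"
  let ?g = "\<lambda>B. (1 / 2 :: real) ^ card {f \<in> M. f \<subseteq> B}"
  have sub: "f \<subseteq> V'" if "f \<in> M" for f using MV' that by (auto simp: pairs_def)
  have h: "?h B + ?h (insert b B) + (?h (insert a B) + ?h (insert a (insert b B))) = 7 / 2 * ?g B" if B: "B \<in> Pow V'" for B
  proof -
    have *: "{f \<in> insert e M. f \<subseteq> B} = {f \<in> M. f \<subseteq> B}" "{f \<in> insert e M. f \<subseteq> insert b B} = {f \<in> M. f \<subseteq> B}"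
      "{f \<in> insert e M. f \<subseteq> insert a B} = {f \<in> M. f \<subseteq> B}"
      "{f \<in> insert e M. f \<subseteq> insert a (insert b B)} = insert e {f \<in> M. f \<subseteq> B}"
    proof -
      have ne: "\<not> e \<subseteq> B" "\<not> e \<subseteq> insert b B" "\<not> e \<subseteq> insert a B" "e \<subseteq> insert a (insert b B)"
        using B V(2,3) ab by auto
      have f: "f \<subseteq> insert b B \<longleftrightarrow> f \<subseteq> B" "f \<subseteq> insert a B \<longleftrightarrow> f \<subseteq> B"
        "f \<subseteq> insert a (insert b B) \<longleftrightarrow> f \<subseteq> B" if "f \<in> M" for f
        using sub[OF that] V(2,3) by auto
      show "{f \<in> insert e M. f \<subseteq> B} = {f \<in> M. f \<subseteq> B}"
        "{f \<in> insert e M. f \<subseteq> insert b B} = {f \<in> M. f \<subseteq> B}"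
        "{f \<in> insert e M. f \<subseteq> insert a B} = {f \<in> M. f \<subseteq> B}"
        "{f \<in> insert e M. f \<subseteq> insert a (insert b B)} = insert e {f \<in> M. f \<subseteq> B}"
        unfolding filter_insert using ne f by (simp_all cong: conj_cong)
    qed
    have "card (insert e {f \<in> M. f \<subseteq> B}) = Suc (card {f \<in> M. f \<subseteq> B})"
      using insert.hyps by simp
    then show ?thesis unfolding * by simp
  qed
  have "(\<Sum>B\<in>Pow V. ?h B) = (\<Sum>B\<in>Pow (insert b V'). ?h B + ?h (insert a B))"
    unfolding V(1) using V by (intro sum_Pow_insert) auto
  also have "\<dots> = (\<Sum>B\<in>Pow V'. (?h B + ?h (insert a B)) + (?h (insert b B) + ?h (insert a (insert b B))))"
    using V by (intro sum_Pow_insert) auto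
  also have "\<dots> = (\<Sum>B\<in>Pow V'. 7 / 2 * ?g B)"
    using h by (intro sum.cong) (auto simp: algebra_simps)
  also have "\<dots> = 7 / 2 * (2 ^ card V' * (7 / 8) ^ card M)"
    unfolding sum_distrib_left[symmetric] using insert.IH[OF V(4) MV'] insert.prems(3) by simp
  also have "\<dots> = 2 ^ card V * (7 / 8) ^ card (insert e M)"
    using V insert.hyps by simp
  finally show ?case .
qed

lemma card_few_matching_edges:
  assumes "matching M" "finite V" "M \<subseteq> pairs V"
  shows "real (card {B. B \<subseteq> V \<and> card {e \<in> M. e \<subseteq> B} < t}) \<le> 2 ^ card V * (7 / 8) ^ card M * 2 ^ t"
proof -
  let ?S = "{B. B \<subseteq> V \<and> card {e \<in> M. e \<subseteq> B} < t}"
  have "real (card ?S) * (1 / 2) ^ t = (\<Sum>B\<in>?S. (1 / 2) ^ t)" by simp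
  also have "\<dots> \<le> (\<Sum>B\<in>?S. (1 / 2) ^ card {e \<in> M. e \<subseteq> B})"
    by (intro sum_mono power_decreasing) auto
  also have "\<dots> \<le> (\<Sum>B\<in>Pow V. (1 / 2) ^ card {e \<in> M. e \<subseteq> B})"
    using assms(2) by (intro sum_mono2) auto
  also have "\<dots> = 2 ^ card V * (7 / 8) ^ card M"
    using assms by (intro sum_Pow_matching) (auto simp: matching_def)
  finally show ?thesis by (simp add: power_one_over field_simps)
qed

lemma card_large_subsets:
  fixes y T :: real
  assumes "finite V" "1 \<le> y"
  shows "real (card {B. B \<subseteq> V \<and> T \<le> real (card B)}) * y powr T \<le> (1 + y) ^ card V"
proof -
  let ?S = "{B. B \<subseteq> V \<and> T \<le> real (card B)}"
  have "real (card ?S) * y powr T = (\<Sum>B\<in>?S. y powr T)" by simp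
  also have "\<dots> \<le> (\<Sum>B\<in>?S. y powr real (card B))"
    using assms(2) by (intro sum_mono powr_mono) auto
  also have "\<dots> = (\<Sum>B\<in>?S. y ^ card B)"
    using assms(2) by (intro sum.cong) (auto simp: powr_realpow)
  also have "\<dots> \<le> (\<Sum>B\<in>Pow V. y ^ card B)"
    using assms by (intro sum_mono2) auto
  also have "\<dots> = (1 + y) ^ card V" by (rule sum_Pow_power[OF assms(1)])
  finally show ?thesis .
qed

lemma card_small_subsets:
  fixes y T :: real
  assumes "finite V" "1 \<le> y"
  shows "real (card {B. B \<subseteq> V \<and> real (card B) \<le> real (card V) - T}) * y powr T \<le> (1 + y) ^ card V"
proof -
  have "card {B. B \<subseteq> V \<and> real (card B) \<le> real (card V) - T} \<le> card {B. B \<subseteq> V \<and> T \<le> real (card B)}"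
  proof (rule card_inj_on_le)
    show "inj_on (\<lambda>B. V - B) {B. B \<subseteq> V \<and> real (card B) \<le> real (card V) - T}"
      by (auto simp: inj_on_def)
    show "(\<lambda>B. V - B) ` {B. B \<subseteq> V \<and> real (card B) \<le> real (card V) - T} \<subseteq> {B. B \<subseteq> V \<and> T \<le> real (card B)}"
    proof clarify
      fix B assume B: "B \<subseteq> V" "real (card B) \<le> real (card V) - T"
      have "card (V - B) = card V - card B" "card B \<le> card V"
        using B(1) assms(1) finite_subset by (auto intro: card_Diff_subset card_mono)
      then show "V - B \<subseteq> V \<and> T \<le> real (card (V - B))" using B(2) by (auto simp: of_nat_diff)
    qed
  qed (use assms in auto)
  then have "real (card {B. B \<subseteq> V \<and> real (card B) \<le> real (card V) - T}) * y powr T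
     \<le> real (card {B. B \<subseteq> V \<and> T \<le> real (card B)}) * y powr T"
    by (intro mult_right_mono) auto
  also have "\<dots> \<le> (1 + y) ^ card V" by (rule card_large_subsets[OF assms])
  finally show ?thesis .
qed

text \<open>For y = exp u the logarithm of the expression is ln ((1 + exp u) / 2) - u (1/2 +
  \<eta>). It vanishes at u = 0 and has derivative - \<eta> there, so a small positive u
  works.\<close>

lemma chernoff_rate:
  fixes \<eta> :: real
  assumes "0 < \<eta>"
  shows "\<exists>y>1. (1 + y) / 2 * y powr - (1 / 2 + \<eta>) < 1"
proof -
  define f where "f u = ln ((1 + exp u) / 2) - u * (1 / 2 + \<eta>)" for u :: real
  have "(f has_real_derivative (exp 0 / 2 / ((1 + exp 0) / 2) - (1 / 2 + \<eta>))) (at 0)"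
    unfolding f_def by (auto intro!: derivative_eq_intros)
  then have "(f has_real_derivative (- \<eta>)) (at 0)" by simp
  then obtain d where d: "0 < d" "\<And>h. 0 < h \<Longrightarrow> h < d \<Longrightarrow> f (0 + h) < f 0"
    using DERIV_neg_dec_right[of f "-\<eta>" 0] assms by auto
  define u where "u = d / 2"
  have u: "0 < u" "f u < 0" using d(1) d(2)[of u] by (auto simp: u_def f_def)
  have pos: "0 < (1 + exp u) / 2" by (simp add: add_pos_pos)
  have "f u = ln ((1 + exp u) / 2) + - (1 / 2 + \<eta>) * u" by (simp add: f_def algebra_simps)
  then have "exp (f u) = exp (ln ((1 + exp u) / 2)) * exp (- (1 / 2 + \<eta>) * u)" by (simp only: exp_add)
  also have "exp (ln ((1 + exp u) / 2)) = (1 + exp u) / 2" using pos by (rule exp_ln)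
  also have "exp (- (1 / 2 + \<eta>) * u) = (exp u) powr - (1 / 2 + \<eta>)" by (simp add: powr_def)
  finally have "exp (f u) = (1 + exp u) / 2 * (exp u) powr - (1 / 2 + \<eta>)" .
  moreover have "exp (f u) < 1" using u by simp
  ultimately have "(1 + exp u) / 2 * (exp u) powr - (1 / 2 + \<eta>) < 1" by (simp only:)
  moreover have "1 < exp u" using u by simp
  ultimately show ?thesis by blast
qed

section \<open>Matchings and the triangles they form with the vertices of \<open>S\<close>\<close>

lemma matching_or_cover:
  assumes "graph2 E" "finite U"
  shows "(\<exists>M. matching M \<and> M \<subseteq> edges_in E U \<and> card M = \<mu>) \<or>
    (\<exists>W\<subseteq>U. card W \<le> 2 * \<mu> \<and> (\<forall>e\<in>edges_in E U. e \<inter> W \<noteq> {}))"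
proof (induction \<mu>)
  case 0
  show ?case by (intro disjI1 exI[of _ "{}"]) (auto simp: matching_def)
next
  case (Suc \<mu>)
  then show ?case
  proof
    assume "\<exists>M. matching M \<and> M \<subseteq> edges_in E U \<and> card M = \<mu>"
    then obtain M where M: "matching M" "M \<subseteq> edges_in E U" "card M = \<mu>" by blast
    have finM: "finite M" using M by (simp add: matching_def)
    show ?thesis
    proof (cases "\<exists>e\<in>edges_in E U. e \<inter> \<Union>M = {}")
      case True
      then obtain e where e: "e \<in> edges_in E U" "e \<inter> \<Union>M = {}" by blast
      have "card e = 2" using e(1) assms(1) by (auto simp: edges_in_def graph2_def)
      then have "e \<noteq> {}" by auto
      then have "e \<notin> M" using e(2) by blast
      then have "card (insert e M) = Suc \<mu>" using M finM by simp
      moreover have "matching (insert e M)" using M e by (auto simp: matching_def)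
      ultimately show ?thesis using M e by (intro disjI1 exI[of _ "insert e M"]) auto
    next
      case False
      have "card (\<Union>M) \<le> (\<Sum>e\<in>M. card e)" by (rule card_Union_le_sum_card)
      also have "\<dots> = 2 * \<mu>" using M assms(1) by (subst sum.cong[OF refl, of M card "\<lambda>_. 2"]) (auto simp: edges_in_def graph2_def)
      finally show ?thesis using False M(2) by (intro disjI2 exI[of _ "\<Union>M"]) (auto simp: edges_in_def)
    qed
  next
    assume "\<exists>W\<subseteq>U. card W \<le> 2 * \<mu> \<and> (\<forall>e\<in>edges_in E U. e \<inter> W \<noteq> {})"
    then obtain W where "W \<subseteq> U" "card W \<le> 2 * \<mu>" "\<forall>e\<in>edges_in E U. e \<inter> W \<noteq> {}" by blast
    then show ?thesis by (intro disjI2 exI[of _ W]) auto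
  qed
qed

lemma greedy_representatives:
  assumes "finite S" "\<And>s. s \<in> S \<Longrightarrow> finite (f s) \<and> card S \<le> card (f s)"
  shows "\<exists>h. inj_on h S \<and> (\<forall>s\<in>S. h s \<in> f s)"
  using assms
proof (induction S)
  case (insert s S)
  then have "\<exists>h. inj_on h S \<and> (\<forall>s\<in>S. h s \<in> f s)" by fastforce
  then obtain h where h: "inj_on h S" "\<forall>s\<in>S. h s \<in> f s" by blast
  have "card (h ` S) \<le> card S" using insert.hyps by (intro card_image_le)
  also have "\<dots> < card (f s)" using insert by fastforce
  finally have "\<not> f s \<subseteq> h ` S" using insert.hyps by (meson card_mono finite_imageI not_le)
  then obtain e where e: "e \<in> f s" "e \<notin> h ` S" by blast
  have "inj_on (h(s := e)) (insert s S)"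
  proof (rule inj_onI)
    fix a b assume ab: "a \<in> insert s S" "b \<in> insert s S" "(h(s := e)) a = (h(s := e)) b"
    have "h b \<noteq> e" if "b \<in> S" for b using e(2) that by blast
    then show "a = b" using ab h(1) by (cases "a = s"; cases "b = s") (auto dest: inj_onD)
  qed
  moreover have "\<forall>a\<in>insert s S. (h(s := e)) a \<in> f a" using h(2) e(1) by simp
  ultimately show ?case by blast
qed simp

lemma disj_cores_family:
  assumes "finite I" "\<And>i. i \<in> I \<Longrightarrow> core E (W i) \<and> W i \<subseteq> U"
    "\<And>i j. i \<in> I \<Longrightarrow> j \<in> I \<Longrightarrow> i \<noteq> j \<Longrightarrow> W i \<inter> W j = {}"
  shows "disj_cores E U (card I)"
proof -
  obtain h where h: "bij_betw h {0..<card I} I" using ex_bij_betw_nat_finite[OF assms(1)] by blast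
  have hI: "h i \<in> I" if "i < card I" for i using h that by (auto simp: bij_betw_def)
  have inj: "h i \<noteq> h j" if "i < card I" "j < card I" "i \<noteq> j" for i j
    using h that by (auto simp: bij_betw_def inj_on_def)
  show ?thesis
    by (rule disj_coresI[of _ _ "W \<circ> h"]) (use hI inj assms(2,3) in auto)
qed

lemma nb_edge_core:
  assumes "graph2 E" "e \<in> E" "e \<subseteq> nb E U s"
  shows "core E (insert s e)"
proof -
  obtain a b where ab: "e = {a, b}" using assms by (auto simp: graph2_def card_2_iff)
  then show ?thesis using assms by (auto simp: nb_def intro!: core_triangle)
qed

lemma card_le_card_hitting:
  assumes "finite B" "\<And>e. e \<in> A \<Longrightarrow> e \<inter> B \<noteq> {}" "\<And>e f. e \<in> A \<Longrightarrow> f \<in> A \<Longrightarrow> e \<noteq> f \<Longrightarrow> e \<inter> f = {}"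
  shows "card A \<le> card B"
proof -
  have "\<forall>e\<in>A. \<exists>x. x \<in> e \<inter> B" using assms(2) by auto
  then have "\<exists>q. \<forall>e\<in>A. q e \<in> e \<inter> B" by (rule bchoice)
  then obtain q where q: "\<forall>e\<in>A. q e \<in> e \<inter> B" ..
  show ?thesis
  proof (rule card_inj_on_le)
    show "inj_on q A"
    proof (rule inj_onI, rule ccontr)
      fix e f assume ef: "e \<in> A" "f \<in> A" "q e = q f" "e \<noteq> f"
      then have "q e \<in> e \<inter> f" using q by auto
      then show False using assms(3)[OF ef(1,2,4)] by auto
    qed
    show "q ` A \<subseteq> B" using q by auto
  qed (rule assms(1))
qed

text \<open>A core avoided by many matching edges below each vertex of \<open>S\<close> could be completed to
  \<open>card S + 1\<close> disjoint cores by one triangle at each vertex of \<open>S\<close>.\<close>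

lemma coreless_of_good:
  assumes "graph2 E" "finite V" "S \<subseteq> V" "\<not> disj_cores E V (Suc (card S))"
    and M: "matching M" "M \<subseteq> edges_in E (V - S)"
    and many: "\<And>s. s \<in> S \<Longrightarrow> t \<le> card {e \<in> M. e \<subseteq> nb E (V - S) s}"
    and small: "\<not> coreless E (V - S) \<Longrightarrow> \<exists>C\<subseteq>V - S. core E C \<and> card C + card S \<le> t"
  shows "coreless E (V - S)"
proof (rule ccontr)
  assume "\<not> coreless E (V - S)"
  then obtain C where C: "C \<subseteq> V - S" "core E C" "card C + card S \<le> t" using small by blast
  have fS: "finite S" using assms(2,3) by (rule finite_subset[rotated])
  have fM: "finite M" and dM: "\<And>e f. e \<in> M \<Longrightarrow> f \<in> M \<Longrightarrow> e \<noteq> f \<Longrightarrow> e \<inter> f = {}"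
    using M(1) by (auto simp: matching_def)
  have fC: "finite C" using C(2) by (simp add: core_def)
  define A where "A s = {e \<in> M. e \<subseteq> nb E (V - S) s \<and> e \<inter> C = {}}" for s
  have hit: "card {e \<in> M. e \<inter> C \<noteq> {}} \<le> card C"
    using dM by (intro card_le_card_hitting fC) auto
  have "finite (A s) \<and> card S \<le> card (A s)" if s: "s \<in> S" for s
  proof -
    have "{e \<in> M. e \<subseteq> nb E (V - S) s} \<subseteq> A s \<union> {e \<in> M. e \<inter> C \<noteq> {}}" by (auto simp: A_def)
    then have "card {e \<in> M. e \<subseteq> nb E (V - S) s} \<le> card (A s \<union> {e \<in> M. e \<inter> C \<noteq> {}})"
      using fM by (intro card_mono) (auto simp: A_def)
    also have "\<dots> \<le> card (A s) + card {e \<in> M. e \<inter> C \<noteq> {}}" by (rule card_Un_le)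
    finally show ?thesis using many[OF s] hit C(3) fM by (simp add: A_def)
  qed
  then obtain h where h: "inj_on h S" "\<forall>s\<in>S. h s \<in> A s"
    using greedy_representatives[OF fS, of A] by blast
  have hM: "h s \<in> M" "h s \<subseteq> V - S" "h s \<inter> C = {}" "h s \<subseteq> nb E (V - S) s" if "s \<in> S" for s
    using h(2) that nb_subset[of E "V - S" s] by (auto simp: A_def)
  have "disj_cores E (V - C) (card S)"
  proof (rule disj_cores_family[OF fS, of _ "\<lambda>s. insert s (h s)"])
    fix s assume s: "s \<in> S"
    have "h s \<in> E" using hM(1)[OF s] M(2) by (auto simp: edges_in_def)
    then have "core E (insert s (h s))" using nb_edge_core[OF assms(1)] hM(4)[OF s] by blast
    then show "core E (insert s (h s)) \<and> insert s (h s) \<subseteq> V - C"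
      using hM[OF s] s assms(3) C(1) by auto
  next
    fix s s' assume ss: "s \<in> S" "s' \<in> S" "s \<noteq> s'"
    then have "h s \<noteq> h s'" using h(1) by (auto simp: inj_on_def)
    then have "h s \<inter> h s' = {}" using dM hM(1) ss by blast
    then show "insert s (h s) \<inter> insert s' (h s') = {}" using ss hM(2) by blast
  qed
  then have "disj_cores E V (Suc (card S))"
    by (rule disj_cores_Suc[of _ _ _ _ C]) (use C in auto)
  then show False using assms(4) by simp
qed

text \<open>Every matching edge inside the neighbourhood of \<open>s\<close> forms a triangle with
  \<open>s\<close>. A blocker avoiding \<open>s\<close> must meet each of these edges, and they are
  disjoint.\<close>

lemma blocker_card_ge:
  assumes "graph2 E" "finite B" "s \<in> V" "s \<notin> B" "coreless E (V - B)"
    and M: "matching M" "M \<subseteq> edges_in E (V - S)"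
    and many: "t \<le> card {e \<in> M. e \<subseteq> nb E (V - S) s}"
  shows "t \<le> card B"
proof -
  let ?A = "{e \<in> M. e \<subseteq> nb E (V - S) s}"
  have dM: "\<And>e f. e \<in> M \<Longrightarrow> f \<in> M \<Longrightarrow> e \<noteq> f \<Longrightarrow> e \<inter> f = {}"
    using M(1) by (auto simp: matching_def)
  have "e \<inter> B \<noteq> {}" if e: "e \<in> ?A" for e
  proof -
    have "e \<in> E" using e M(2) by (auto simp: edges_in_def)
    then have "core E (insert s e)" using nb_edge_core[OF assms(1)] e by blast
    then have "\<not> insert s e \<subseteq> V - B" using assms(5) unfolding coreless_def by blast
    moreover have "e \<subseteq> V" using e M(2) by (auto simp: edges_in_def)
    ultimately show "e \<inter> B \<noteq> {}" using assms(3,4) by blast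
  qed
  then have "card ?A \<le> card B" using dM by (intro card_le_card_hitting assms(2)) auto
  then show ?thesis using many by simp
qed

lemma vdegree_nb:
  assumes "edges G \<subseteq> pairs (verts G)" "finite (verts G)"
  shows "vdegree G v = card (nb (edges G) (verts G) v)"
proof -
  have "{e \<in> edges G. v \<in> e} = (\<lambda>y. {v, y}) ` nb (edges G) (verts G) v"
  proof (intro set_eqI iffI)
    fix e assume e: "e \<in> {e \<in> edges G. v \<in> e}"
    then obtain a b where ab: "e = {a, b}" "a \<in> verts G" "b \<in> verts G" using assms(1) by (auto simp: pairs_def card_2_iff)
    define y where "y = (if v = a then b else a)"
    have "e = {v, y}" "y \<in> verts G" using ab e by (auto simp: y_def)
    then show "e \<in> (\<lambda>y. {v, y}) ` nb (edges G) (verts G) v" using e by (auto simp: nb_def)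
  qed (auto simp: nb_def)
  moreover have "inj_on (\<lambda>y. {v, y}) (nb (edges G) (verts G) v)"
    by (auto simp: inj_on_def doubleton_eq_iff)
  ultimately show ?thesis by (simp add: vdegree_def card_image)
qed

lemma card_nb_split:
  assumes "finite V" "S \<subseteq> V"
  shows "card (nb E (V - S) v) \<le> card (nb E V v)" "card (nb E V v) \<le> card (nb E (V - S) v) + card S"
proof -
  show "card (nb E (V - S) v) \<le> card (nb E V v)"
    using assms by (intro card_mono finite_nb nb_mono) auto
  have "nb E V v \<subseteq> nb E (V - S) v \<union> S" by (auto simp: nb_def)
  then have "card (nb E V v) \<le> card (nb E (V - S) v \<union> S)"
    using assms by (intro card_mono) (auto intro: finite_subset)
  also have "\<dots> \<le> card (nb E (V - S) v) + card S" by (rule card_Un_le)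
  finally show "card (nb E V v) \<le> card (nb E (V - S) v) + card S" .
qed

text \<open>The neighbours of \<open>v\<close> are its children, its parent (the \<open>1\<close>),
  and the other ends of edges in \<open>X\<close>.\<close>

lemma degree_preimages:
  assumes "edges_in E U = pedges r U p \<union> X" "finite U" "X \<subseteq> pairs U" "v \<in> U"
  shows "card (nb E U v) \<le> card {x \<in> U. p x = v} + 1 + card X"
proof -
  let ?Y = "{y \<in> U. {v, y} \<in> X}"
  have fX: "finite X" using assms(2,3) by (auto intro: finite_subset)
  have "nb E U v \<subseteq> {x \<in> U. p x = v} \<union> {p v} \<union> ?Y"
  proof
    fix y assume y: "y \<in> nb E U v"
    then have "{v, y} \<in> edges_in E U" using assms(4) by (auto simp: nb_def edges_in_def)
    then have "{v, y} \<in> pedges r U p \<or> {v, y} \<in> X" using assms(1) by auto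
    then show "y \<in> {x \<in> U. p x = v} \<union> {p v} \<union> ?Y"
      using y by (auto simp: pedges_def nb_def doubleton_eq_iff)
  qed
  then have "card (nb E U v) \<le> card ({x \<in> U. p x = v} \<union> {p v} \<union> ?Y)"
    using assms(2) by (intro card_mono) auto
  also have "\<dots> \<le> card {x \<in> U. p x = v} + card {p v} + card ?Y"
    by (meson add_le_mono card_Un_le le_refl le_trans)
  also have "card ?Y \<le> card X"
    by (rule card_inj_on_le[of "\<lambda>y. {v, y}"]) (use fX in \<open>auto simp: inj_on_def doubleton_eq_iff\<close>)
  finally show ?thesis by simp
qed

lemma ex_long_path:
  assumes "graph2 E" "finite U" "\<not> coreless E U" "\<And>C. C \<subseteq> U \<Longrightarrow> core E C \<Longrightarrow> g \<le> card C"
  shows "\<exists>c. distinct c \<and> set c \<subseteq> U \<and> length c = g \<and> (\<forall>i. Suc i < g \<longrightarrow> {c ! i, c ! Suc i} \<in> E)"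
proof -
  obtain W where W: "W \<subseteq> U" "core E W" using assms(3) by (auto simp: coreless_def)
  let ?G = "\<lparr>verts = U, edges = E\<rparr>"
  obtain c where c: "is_cycle ?G c" "set c \<subseteq> W" using core_cycle[of ?G W] assms(1) W by auto
  then have d: "distinct c" "\<And>i. i < length c \<Longrightarrow> {c ! i, c ! (Suc i mod length c)} \<in> E"
    by (auto simp: is_cycle_def)
  have "core E (set c)" using cycle_core[OF c(1)] by simp
  then have "g \<le> card (set c)" using c W by (intro assms(4)) auto
  then have len: "g \<le> length c" using d(1) by (simp add: distinct_card)
  have "{take g c ! i, take g c ! Suc i} \<in> E" if "Suc i < g" for i
    using d(2)[of i] that len by simp
  moreover have "set (take g c) \<subseteq> U" using c W set_take_subset[of g c] by blast
  ultimately show ?thesis using d(1) len by (intro exI[of _ "take g c"]) auto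
qed

section \<open>The exceptional classes of graphs\<close>

definition Ex_edges :: "nat \<Rightarrow> 'a set \<Rightarrow> 'a set set set" where
  "Ex_edges k V = {E. E \<subseteq> pairs V \<and> \<not> disj_cores E V (Suc k)}"

definition deg_funs :: "'a \<Rightarrow> 'a set \<Rightarrow> nat \<Rightarrow> ('a \<Rightarrow> 'a) set" where
  "deg_funs r U d = {p \<in> U \<rightarrow>\<^sub>E insert r U. \<exists>v\<in>U. d \<le> card {x \<in> U. p x = v}}"

text \<open>These are the parent functions of graphs with a small vertex cover, that is, of those
  without a large matching.\<close>

definition cover_funs :: "'a \<Rightarrow> 'a set \<Rightarrow> nat \<Rightarrow> ('a \<Rightarrow> 'a) set" where
  "cover_funs r U w = {p \<in> U \<rightarrow>\<^sub>E insert r U. \<exists>W\<subseteq>U. card W \<le> w \<and> (\<forall>x\<in>U - W. p x \<in> insert r W)}"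

definition path_funs :: "'a \<Rightarrow> 'a set \<Rightarrow> nat \<Rightarrow> ('a \<Rightarrow> 'a) set" where
  "path_funs r U g = {p \<in> U \<rightarrow>\<^sub>E insert r U. \<exists>c. distinct c \<and> set c \<subseteq> U \<and> length c = g \<and>
      (\<forall>i. Suc i < g \<longrightarrow> p (c ! i) = c ! Suc i)}"

definition has_matching :: "nat \<Rightarrow> 'a set set \<Rightarrow> bool" where
  "has_matching \<mu> H \<longleftrightarrow> (\<exists>M. matching M \<and> M \<subseteq> H \<and> card M = \<mu>)"

text \<open>A matching chosen as a function of the graph \<open>H\<close> alone, so that the bad
  neighbourhoods form a family fixed before the neighbourhood is chosen, as
  \<open>lift_count_nb\<close> demands.\<close>

definition the_matching :: "nat \<Rightarrow> 'a set set \<Rightarrow> 'a set set" where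
  "the_matching \<mu> H = (SOME M. matching M \<and> M \<subseteq> H \<and> card M = \<mu>)"

text \<open>The same \<open>T\<close> serves both tails, because complementation exchanges
  them.\<close>

definition bad_nbhds :: "'a set \<Rightarrow> nat \<Rightarrow> nat \<Rightarrow> real \<Rightarrow> 'a set set \<Rightarrow> 'a set set" where
  "bad_nbhds U \<mu> t T H = {B. B \<subseteq> U \<and> (card {e \<in> the_matching \<mu> H. e \<subseteq> B} < t \<or>
     T \<le> real (card B) \<or> real (card B) \<le> real (card U) - T)}"

text \<open>Degrees of vertices in \<open>S\<close> are counted towards \<open>V - S\<close>, where
  the neighbourhoods are free; passing to full degrees later costs at most \<open>k\<close>.\<close>

definition good :: "nat \<Rightarrow> 'a set \<Rightarrow> nat \<Rightarrow> nat \<Rightarrow> real \<Rightarrow> 'a set set \<Rightarrow> bool" where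
  "good k V D t T E \<longleftrightarrow> (\<exists>S\<subseteq>V. card S = k \<and> coreless E (V - S) \<and>
     (\<forall>v\<in>V - S. card (nb E V v) \<le> D) \<and>
     (\<forall>s\<in>S. real (card (nb E (V - S) s)) < T \<and> real (card V - k) - T < real (card (nb E (V - S) s))) \<and>
     (\<forall>B\<subseteq>V. coreless E (V - B) \<and> \<not> S \<subseteq> B \<longrightarrow> t \<le> card B))"

lemma the_matching:
  assumes "has_matching \<mu> H"
  shows "matching (the_matching \<mu> H)" "the_matching \<mu> H \<subseteq> H" "card (the_matching \<mu> H) = \<mu>"
  using someI_ex[OF assms[unfolded has_matching_def]] by (simp_all add: the_matching_def)

lemma core_edges_in: "W \<subseteq> U \<Longrightarrow> core (edges_in E U) W \<longleftrightarrow> core E W"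
  unfolding core_def by (metis nb_edges_in subsetD)

lemma coreless_edges_in: "W \<subseteq> U \<Longrightarrow> coreless (edges_in E U) W \<longleftrightarrow> coreless E W"
  unfolding coreless_def by (meson core_edges_in order_trans)

lemma ec_edges_in: "W \<subseteq> U \<Longrightarrow> ec (edges_in E U) W = ec E W"
proof -
  assume "W \<subseteq> U"
  then have "{e \<in> edges_in E U. e \<subseteq> W} = {e \<in> E. e \<subseteq> W}" by (auto simp: edges_in_def)
  then show ?thesis by (simp add: ec_def)
qed

lemma edges_in_pairs: "E \<subseteq> pairs V \<Longrightarrow> edges_in E U \<subseteq> pairs U"
  by (auto simp: edges_in_def pairs_def)

lemma cover_of_edges:
  assumes "edges_in E U = pedges r U p \<union> X" "p \<in> U \<rightarrow>\<^sub>E insert r U" "\<forall>e\<in>edges_in E U. e \<inter> W \<noteq> {}" "x \<in> U - W"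
  shows "p x \<in> insert r W"
proof (cases "p x = r")
  case False
  then have "{x, p x} \<in> edges_in E U" using assms(1,4) by (simp add: pedges_def)
  then have "{x, p x} \<inter> W \<noteq> {}" using assms(3) by (rule bspec[rotated])
  then show ?thesis using assms(4) by simp
qed simp

lemma encI: "p \<in> P \<Longrightarrow> X \<subseteq> pairs U \<Longrightarrow> card X \<le> M \<Longrightarrow> H = pedges r U p \<union> X \<Longrightarrow> H \<in> encoded r U P M"
  unfolding encoded_def by (intro CollectI exI[of _ p] exI[of _ X] conjI)

text \<open>\<open>S\<close> and the near-forest come from the structure theorem. The first four
  disjuncts list what may then go wrong: too many trees, \<open>S\<close> too small, an atypical
  parent function, an atypical neighbourhood of a vertex in \<open>S\<close>. If none does,
  \<open>coreless_of_good\<close> and \<open>blocker_card_ge\<close> give the fifth.\<close>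

lemma class_cases:
  assumes E: "E \<in> Ex_edges k V" and V: "finite V" "r \<notin> V" "card V < 2 ^ h"
    and K: "k * (2 * h + 3) \<le> K" and M: "(5 * k + 1) * (2 * K) \<le> M" and g: "g + k \<le> t + 1"
  shows "(\<exists>S\<subseteq>V. card S \<le> k \<and> edges_in E (V - S) \<in> (\<Union>\<kappa>\<in>{K..card V}. many_comps (V - S) (k * (2 * h + 3)) (2 * (5 * k + 1)) \<kappa>))
    \<or> (\<exists>S\<subseteq>V. card S \<le> k - 1 \<and> edges_in E (V - S) \<in> encoded r (V - S) ((V - S) \<rightarrow>\<^sub>E insert r (V - S)) M)
    \<or> (\<exists>S\<subseteq>V. card S \<le> k \<and> k \<le> card S \<and> edges_in E (V - S) \<in> encoded r (V - S) (deg_funs r (V - S) d \<union> cover_funs r (V - S) (2 * \<mu>) \<union> path_funs r (V - S) g) M)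
    \<or> (\<exists>S\<subseteq>V. card S = k \<and> edges_in E (V - S) \<in> {H \<in> encoded r (V - S) ((V - S) \<rightarrow>\<^sub>E insert r (V - S)) M. H \<subseteq> pairs (V - S) \<and> has_matching \<mu> H} \<and>
        (\<exists>s\<in>S. nb E (V - S) s \<in> bad_nbhds (V - S) \<mu> t T (edges_in E (V - S))))
    \<or> good k V (d + M + k) t T E" (is "?A \<or> ?B0 \<or> ?B1 \<or> ?B2 \<or> ?G")
proof -
  let ?a0 = "k * (2 * h + 3)" and ?C = "5 * k + 1"
  have EV: "E \<subseteq> pairs V" "\<not> disj_cores E V (Suc k)" using E by (auto simp: Ex_edges_def)
  have gr: "graph2 E" using EV(1) by (rule graph2_pairs)
  obtain S A where SA: "S \<subseteq> V" "A \<subseteq> V - S" "card S \<le> k" "card A \<le> ?a0" "coreless E (V - S - A)"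
    "ec E (V - S) \<le> ec E (V - S - A) + ?C * (card A + (card (V - S - A) - ec E (V - S - A)))"
    by (rule few_disjoint_cores_structure[OF gr V(1,3) EV(2)])
  define U where "U = V - S"
  define \<kappa> where "\<kappa> = card (U - A) - ec E (U - A)"
  have fU: "finite U" "r \<notin> U" "U \<subseteq> V" using V by (auto simp: U_def)
  have ecU: "ec E U \<le> ec E (U - A) + ?C * (card A + \<kappa>)" using SA(6) by (simp add: U_def \<kappa>_def)
  show ?thesis
  proof (cases "K \<le> \<kappa>")
    case True
    have "card (U - A) \<le> card V" using fU V(1) by (intro card_mono) auto
    then have \<kappa>V: "\<kappa> \<le> card V" by (simp add: \<kappa>_def)
    \<comment> \<open>\<open>card A \<le> ?a0 \<le> K \<le> \<kappa>\<close>: the blocker part is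
      absorbed, at the price of the factor 2 in \<open>2 * ?C\<close>.\<close>
    have "card A + \<kappa> \<le> 2 * \<kappa>" using SA(4) K True by simp
    then have "?C * (card A + \<kappa>) \<le> ?C * (2 * \<kappa>)" by (rule mult_le_mono2)
    then have "ec E U \<le> ec E (U - A) + 2 * ?C * \<kappa>" using ecU by simp
    then have "edges_in E U \<in> many_comps U ?a0 (2 * ?C) \<kappa>"
      unfolding many_comps_def using edges_in_pairs[OF EV(1)] SA(2,4,5)
      by (auto simp: ec_edges_in coreless_edges_in U_def[symmetric] \<kappa>_def intro!: exI[of _ A])
    then have ?A using SA(1,3) True \<kappa>V unfolding U_def by (intro exI[of _ S]) auto
    then show ?thesis by blast
  next
    case False
    have "card A + \<kappa> \<le> 2 * K" using SA(4) K False by simp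
    then have "?C * (card A + \<kappa>) \<le> ?C * (2 * K)" by (rule mult_le_mono2)
    then have ecM: "ec E U \<le> ec E (U - A) + M" using ecU M by simp
    have cl: "coreless E (U - A)" using SA(5) by (simp add: U_def)
    obtain p X where pX: "p \<in> U \<rightarrow>\<^sub>E insert r U" "X \<subseteq> pairs U" "card X \<le> M" "edges_in E U = pedges r U p \<union> X"
      using encoded_mem[OF EV(1) fU(1,2) _ cl ecM, of "[]"] by auto
    have all: "edges_in E U \<in> encoded r U (U \<rightarrow>\<^sub>E insert r U) M" by (rule encI[OF pX])
    show ?thesis
    proof (cases "card S \<le> k - 1")
      case True
      then have ?B0 using all SA(1) unfolding U_def by (intro exI[of _ S] conjI)
      then show ?thesis by blast
    next
      case False
      then have Sk: "card S = k" using SA(3) by simp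
      have toB1: ?B1 if "q \<in> deg_funs r U d \<union> cover_funs r U (2 * \<mu>) \<union> path_funs r U g"
        "Y \<subseteq> pairs U" "card Y \<le> M" "edges_in E U = pedges r U q \<union> Y" for q Y
        using encI[OF that] SA(1,3) Sk unfolding U_def by (intro exI[of _ S] conjI) simp_all
      consider (deg) "\<exists>v\<in>U. d \<le> card {x \<in> U. p x = v}" | (cov) "\<not> has_matching \<mu> (edges_in E U)"
        | (path) "\<not> coreless E U" "\<And>C. C \<subseteq> U \<Longrightarrow> core E C \<Longrightarrow> g \<le> card C"
        | (bip) "has_matching \<mu> (edges_in E U)" "\<exists>s\<in>S. nb E U s \<in> bad_nbhds U \<mu> t T (edges_in E U)"
        | (fine) "\<forall>v\<in>U. card {x \<in> U. p x = v} < d" "has_matching \<mu> (edges_in E U)"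
          "\<not> coreless E U \<Longrightarrow> \<exists>C\<subseteq>U. core E C \<and> card C < g"
          "\<forall>s\<in>S. nb E U s \<notin> bad_nbhds U \<mu> t T (edges_in E U)"
        by (metis not_le)
      then show ?thesis
      proof cases
        case deg
        then have "p \<in> deg_funs r U d" using pX(1) by (simp add: deg_funs_def)
        then have ?B1 using pX by (intro toB1[of p X]) auto
        then show ?thesis by blast
      next
        case cov
        then obtain W where W: "W \<subseteq> U" "card W \<le> 2 * \<mu>" "\<forall>e\<in>edges_in E U. e \<inter> W \<noteq> {}"
          using matching_or_cover[OF gr fU(1), of \<mu>] unfolding has_matching_def by blast
        then have "p \<in> cover_funs r U (2 * \<mu>)"
          using pX(1) cover_of_edges[OF pX(4,1) W(3)] unfolding cover_funs_def
          by (intro CollectI conjI exI[of _ W]) simp_all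
        then have ?B1 using pX by (intro toB1[of p X]) auto
        then show ?thesis by blast
      next
        case path
        obtain c where c: "distinct c" "set c \<subseteq> U" "length c = g" "\<forall>i. Suc i < g \<longrightarrow> {c ! i, c ! Suc i} \<in> E"
          using ex_long_path[OF gr fU(1) path] by blast
        have c': "\<And>i. Suc i < length c \<Longrightarrow> {c ! i, c ! Suc i} \<in> E" using c(3,4) by simp
        \<comment> \<open>The function \<open>p\<close> need not follow the path, so the graph is
          encoded afresh by a \<open>q\<close> that does.\<close>
        obtain q Y where qY: "q \<in> U \<rightarrow>\<^sub>E insert r U" "Y \<subseteq> pairs U" "card Y \<le> M" "edges_in E U = pedges r U q \<union> Y"
            "\<forall>i. Suc i < length c \<longrightarrow> q (c ! i) = c ! Suc i"
          using encoded_mem[OF EV(1) fU(1,2) _ cl ecM c(1,2) c'] by auto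
        have "q \<in> path_funs r U g" using qY(1,5) c unfolding path_funs_def
          by (intro CollectI conjI exI[of _ c]) simp_all
        then have ?B1 using qY by (intro toB1[of q Y]) auto
        then show ?thesis by blast
      next
        case bip
        then have ?B2 using all SA(1) Sk edges_in_pairs[OF EV(1), of U] unfolding U_def by (intro exI[of _ S] conjI CollectI)
        then show ?thesis by blast
      next
        case fine
        let ?M = "the_matching \<mu> (edges_in E U)"
        note mt = the_matching[OF fine(2)]
        have nbU: "nb E U s \<subseteq> U" for s by (rule nb_subset)
        have nbs: "t \<le> card {e \<in> ?M. e \<subseteq> nb E U s}" "real (card (nb E U s)) < T"
          "real (card V - k) - T < real (card (nb E U s))" if s: "s \<in> S" for s
        proof -
          have "card U = card V - k" using Sk SA(1) V(1) unfolding U_def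
            by (subst card_Diff_subset) (auto intro: finite_subset)
          moreover have "nb E U s \<notin> bad_nbhds U \<mu> t T (edges_in E U)" using fine(4) s by blast
          ultimately show "t \<le> card {e \<in> ?M. e \<subseteq> nb E U s}" "real (card (nb E U s)) < T"
            "real (card V - k) - T < real (card (nb E U s))"
            using nbU[of s] by (auto simp: bad_nbhds_def not_less not_le)
        qed
        have "coreless E U" unfolding U_def
        proof (rule coreless_of_good[OF gr V(1) SA(1), where M = ?M and t = t])
          show "\<not> disj_cores E V (Suc (card S))" using EV(2) Sk by simp
          show "matching ?M" by (rule mt(1))
          show "?M \<subseteq> edges_in E (V - S)" using mt(2) by (simp add: U_def)
          show "t \<le> card {e \<in> ?M. e \<subseteq> nb E (V - S) s}" if "s \<in> S" for s
            using nbs(1)[OF that] by (simp add: U_def)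
          assume "\<not> coreless E (V - S)"
          then obtain C where "C \<subseteq> U" "core E C" "card C < g" using fine(3) unfolding U_def by blast
          \<comment> \<open>\<open>card C < g\<close> is strict, which is why
            \<open>g + k \<le> t + 1\<close> is enough.\<close>
          then show "\<exists>C\<subseteq>V - S. core E C \<and> card C + card S \<le> t"
            using g Sk unfolding U_def by (intro exI[of _ C]) auto
        qed
        moreover have "card (nb E V v) \<le> d + M + k" if v: "v \<in> V - S" for v
        proof -
          have "card (nb E U v) \<le> card {x \<in> U. p x = v} + 1 + card X"
            using pX v fU(1) by (intro degree_preimages) (auto simp: U_def)
          moreover have "card {x \<in> U. p x = v} < d" using fine(1) v by (auto simp: U_def)
          moreover have "card (nb E V v) \<le> card (nb E U v) + card S"
            using card_nb_split(2)[OF V(1) SA(1), of E v] by (simp add: U_def)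
          ultimately show ?thesis using pX(3) Sk by linarith
        qed
        moreover have "t \<le> card B" if B: "B \<subseteq> V" "coreless E (V - B)" "\<not> S \<subseteq> B" for B
        proof -
          obtain s where s: "s \<in> S" "s \<notin> B" using B(3) by blast
          show ?thesis
          proof (rule blocker_card_ge[OF gr _ _ s(2) B(2) mt(1)])
            show "finite B" using B(1) V(1) by (rule finite_subset)
            show "s \<in> V" using s SA(1) by auto
            show "?M \<subseteq> edges_in E (V - S)" using mt(2) by (simp add: U_def)
            show "t \<le> card {e \<in> ?M. e \<subseteq> nb E (V - S) s}" using nbs(1)[OF s(1)] by (simp add: U_def)
          qed
        qed
        ultimately have ?G
          unfolding good_def using SA(1) Sk nbs(2,3) by (intro exI[of _ S]) (auto simp: U_def)
        then show ?thesis by blast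
      qed
    qed
  qed
qed

section \<open>Cardinalities of the exceptional families\<close>

lemma lift_count_real:
  assumes "finite V" "0 \<le> Q"
    and "\<And>E. E \<in> \<E> \<Longrightarrow> E \<subseteq> pairs V \<and> (\<exists>S\<subseteq>V. card S \<le> s \<and> edges_in E (V - S) \<in> \<Q> S)"
    and "\<And>S. S \<subseteq> V \<Longrightarrow> card S \<le> s \<Longrightarrow> finite (\<Q> S) \<and> real (card (\<Q> S)) \<le> Q"
  shows "real (card \<E>) \<le> real (card V + 1) ^ s * (Q * 2 ^ (s * card V))"
proof -
  have "card \<E> \<le> (card V + 1) ^ s * (nat \<lfloor>Q\<rfloor> * 2 ^ (s * card V))"
  proof (rule lift_count[OF assms(1,3)])
    fix S assume "S \<subseteq> V" "card S \<le> s"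
    from assms(4)[OF this] show "finite (\<Q> S) \<and> card (\<Q> S) \<le> nat \<lfloor>Q\<rfloor>" by (simp add: le_nat_floor)
  qed auto
  then have "real (card \<E>) \<le> real ((card V + 1) ^ s * (nat \<lfloor>Q\<rfloor> * 2 ^ (s * card V)))" by (rule of_nat_mono)
  also have "\<dots> = real (card V + 1) ^ s * (real (nat \<lfloor>Q\<rfloor>) * 2 ^ (s * card V))"
    by (simp only: of_nat_mult of_nat_power of_nat_numeral)
  also have "\<dots> \<le> real (card V + 1) ^ s * (Q * 2 ^ (s * card V))"
    using assms(2) by (intro mult_left_mono mult_right_mono) auto
  finally show ?thesis .
qed

lemma lift_count_nb_real:
  assumes "finite V" "0 < k" "0 \<le> Q" "0 \<le> b"
    and "\<And>E. E \<in> \<E> \<Longrightarrow> E \<subseteq> pairs V \<and> (\<exists>S\<subseteq>V. card S = k \<and> edges_in E (V - S) \<in> \<Q> S \<and>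
      (\<exists>s\<in>S. nb E (V - S) s \<in> \<B> S (edges_in E (V - S))))"
    and "\<And>S. S \<subseteq> V \<Longrightarrow> card S = k \<Longrightarrow> finite (\<Q> S) \<and> real (card (\<Q> S)) \<le> Q"
    and "\<And>S H. S \<subseteq> V \<Longrightarrow> card S = k \<Longrightarrow> H \<in> \<Q> S \<Longrightarrow> finite (\<B> S H) \<and> real (card (\<B> S H)) \<le> b"
  shows "real (card \<E>) \<le> real (card V + 1) ^ k * (real k * (Q * (b * 2 ^ ((k - 1) * card V))))"
proof -
  have "card \<E> \<le> (card V + 1) ^ k * (k * (nat \<lfloor>Q\<rfloor> * (nat \<lfloor>b\<rfloor> * 2 ^ ((k - 1) * card V))))"
  proof (rule lift_count_nb[OF assms(1,2,5)])
    fix S assume S: "S \<subseteq> V" "card S = k"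
    from assms(6)[OF this] show "finite (\<Q> S) \<and> card (\<Q> S) \<le> nat \<lfloor>Q\<rfloor>" by (simp add: le_nat_floor)
    fix H assume "H \<in> \<Q> S"
    from assms(7)[OF S this] show "finite (\<B> S H) \<and> card (\<B> S H) \<le> nat \<lfloor>b\<rfloor>" by (simp add: le_nat_floor)
  qed auto
  then have "real (card \<E>) \<le> real ((card V + 1) ^ k * (k * (nat \<lfloor>Q\<rfloor> * (nat \<lfloor>b\<rfloor> * 2 ^ ((k - 1) * card V)))))"
    by (rule of_nat_mono)
  also have "\<dots> = real (card V + 1) ^ k * (real k * (real (nat \<lfloor>Q\<rfloor>) * (real (nat \<lfloor>b\<rfloor>) * 2 ^ ((k - 1) * card V))))"
    by (simp only: of_nat_mult of_nat_power of_nat_numeral)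
  also have "\<dots> \<le> real (card V + 1) ^ k * (real k * (Q * (b * 2 ^ ((k - 1) * card V))))"
    using assms(3,4) by (intro mult_left_mono mult_mono) auto
  finally show ?thesis .
qed

lemma card_deg_funs:
  assumes "finite U" "r \<notin> U"
  shows "real (card (deg_funs r U d)) \<le> real (card U) * (real (card U + 1) ^ card U / fact d)"
proof -
  let ?P = "\<lambda>v. {p \<in> U \<rightarrow>\<^sub>E insert r U. d \<le> card {x \<in> U. p x = v}}"
  have fP: "finite (?P v)" for v
  proof -
    have "finite (U \<rightarrow>\<^sub>E insert r U)" using assms by (intro finite_PiE) auto
    then show ?thesis by simp
  qed
  have b: "real (card (?P v)) \<le> real (card U + 1) ^ card U / fact d" for v
  proof -
    have "card (?P v) * fact d \<le> card (insert r U) ^ card U"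
      using assms by (intro card_many_preimages) auto
    then have "real (card (?P v) * fact d) \<le> real ((card U + 1) ^ card U)"
      using assms by (intro of_nat_mono) simp
    then show ?thesis by (simp only: of_nat_mult of_nat_power of_nat_fact pos_le_divide_eq fact_gt_zero)
  qed
  have "deg_funs r U d = (\<Union>v\<in>U. ?P v)" by (auto simp: deg_funs_def)
  then have "card (deg_funs r U d) \<le> (\<Sum>v\<in>U. card (?P v))" using card_UN_le[OF assms(1), of ?P] by simp
  then have "real (card (deg_funs r U d)) \<le> (\<Sum>v\<in>U. real (card (?P v)))"
    by (simp only: of_nat_sum[symmetric] of_nat_le_iff)
  also have "\<dots> \<le> real (card U) * (real (card U + 1) ^ card U / fact d)"
    by (rule sum_bounded_above[OF b])
  finally show ?thesis .
qed

text \<open>As \<open>w + 1\<close> is at most a sixteenth of \<open>n + 1\<close>, every vertex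
  outside the cover saves a factor 16, far more than the \<open>2 ^ n\<close> paid for choosing the
  cover.\<close>

lemma card_cover_funs:
  assumes "finite U" "r \<notin> U" "n - k \<le> card U" "card U \<le> n" "w + k \<le> n" "16 * (w + 1) \<le> n + 1"
  shows "real (card (cover_funs r U w)) \<le> 2 ^ n * (real (n + 1) ^ n / 16 ^ (n - k - w))"
proof -
  let ?u = "card U" and ?N = "real (n + 1)"
  have "card (cover_funs r U w) \<le> 2 ^ ?u * ((w + 1) ^ (?u - w) * (?u + 1) ^ w)"
    unfolding cover_funs_def using assms by (intro card_small_image) auto
  then have "real (card (cover_funs r U w)) \<le> real (2 ^ ?u * ((w + 1) ^ (?u - w) * (?u + 1) ^ w))"
    by (rule of_nat_mono)
  also have "\<dots> = 2 ^ ?u * (real (w + 1) ^ (?u - w) * real (?u + 1) ^ w)"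
    by (simp only: of_nat_mult of_nat_power of_nat_numeral)
  also have "\<dots> \<le> 2 ^ n * ((?N / 16) ^ (?u - w) * ?N ^ w)"
    using assms by (intro mult_mono power_mono power_increasing) auto
  also have "(?N / 16) ^ (?u - w) * ?N ^ w = ?N ^ ?u / 16 ^ (?u - w)"
    using assms by (simp add: power_divide power_add[symmetric])
  also have "2 ^ n * (?N ^ ?u / 16 ^ (?u - w)) \<le> 2 ^ n * (?N ^ n / 16 ^ (n - k - w))"
    using assms by (intro mult_left_mono frac_le power_increasing) auto
  finally show ?thesis .
qed

lemma card_path_funs:
  assumes "finite U" "r \<notin> U" "card U \<le> n" "0 < card U" "0 < g"
  shows "real (card (path_funs r U g)) \<le> real (n + 1) ^ (n + 1) * exp (- (real g * (real g - 1) / (2 * real n)))"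
proof -
  have "real (card (path_funs r U g)) \<le> real (card U + 1) ^ (card U + 1) * exp (- (real g * (real g - 1) / (2 * real (card U))))"
    unfolding path_funs_def by (rule card_long_path[OF assms(1,2,5)])
  also have "\<dots> \<le> real (n + 1) ^ (n + 1) * exp (- (real g * (real g - 1) / (2 * real n)))"
  proof (rule mult_mono)
    have "real (card U + 1) ^ (card U + 1) \<le> real (n + 1) ^ (card U + 1)"
      using assms(3) by (intro power_mono) auto
    also have "\<dots> \<le> real (n + 1) ^ (n + 1)" using assms(3) by (intro power_increasing) auto
    finally show "real (card U + 1) ^ (card U + 1) \<le> real (n + 1) ^ (n + 1)" .
    have "real g * (real g - 1) / (2 * real n) \<le> real g * (real g - 1) / (2 * real (card U))"
      using assms(3-5) by (intro divide_left_mono mult_nonneg_nonneg mult_pos_pos) auto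
    then show "exp (- (real g * (real g - 1) / (2 * real (card U)))) \<le> exp (- (real g * (real g - 1) / (2 * real n)))"
      by simp
  qed auto
  finally show ?thesis .
qed

lemma card_all_funs:
  assumes "finite U" "r \<notin> U" "card U \<le> n"
  shows "real (card (U \<rightarrow>\<^sub>E insert r U)) \<le> real (n + 1) ^ n"
proof -
  have "card (U \<rightarrow>\<^sub>E insert r U) = (card U + 1) ^ card U" using assms by (simp add: card_PiE)
  also have "\<dots> \<le> (n + 1) ^ card U" using assms by (intro power_mono) auto
  also have "\<dots> \<le> (n + 1) ^ n" using assms by (intro power_increasing) auto
  finally have "real (card (U \<rightarrow>\<^sub>E insert r U)) \<le> real ((n + 1) ^ n)" by (rule of_nat_mono)
  then show ?thesis by (simp only: of_nat_power)
qed

lemma card_encoded_real: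
  assumes "finite U" "finite P" "real (card P) \<le> Q" "card U \<le> n"
  shows "real (card (encoded r U P M)) \<le> Q * real (n + 1) ^ (2 * M)"
proof -
  have "real (card (encoded r U P M)) \<le> real (card P * (card U + 1) ^ (2 * M))"
    by (rule of_nat_mono[OF card_encoded(2)[OF assms(1,2)]])
  also have "\<dots> = real (card P) * real (card U + 1) ^ (2 * M)" by (simp only: of_nat_mult of_nat_power)
  also have "\<dots> \<le> Q * real (n + 1) ^ (2 * M)"
    using assms(3,4) by (intro mult_mono power_mono) (auto intro: order_trans[OF _ assms(3)])
  finally show ?thesis .
qed

lemma card_bad_nbhds:
  assumes "finite U" "card U \<le> n" "has_matching \<mu> H" "H \<subseteq> pairs U" "1 \<le> y"
  shows "finite (bad_nbhds U \<mu> t T H) \<and> real (card (bad_nbhds U \<mu> t T H)) \<le>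
    2 ^ n * ((7 / 8) ^ \<mu> * 2 ^ t + 2 * (((1 + y) / 2) ^ n * y powr - T))"
proof
  let ?B1 = "{B. B \<subseteq> U \<and> card {e \<in> the_matching \<mu> H. e \<subseteq> B} < t}"
  let ?B2 = "{B. B \<subseteq> U \<and> T \<le> real (card B)}"
  let ?B3 = "{B. B \<subseteq> U \<and> real (card B) \<le> real (card U) - T}"
  have eq: "bad_nbhds U \<mu> t T H = ?B1 \<union> ?B2 \<union> ?B3" by (auto simp: bad_nbhds_def)
  show "finite (bad_nbhds U \<mu> t T H)" unfolding eq using assms(1) by simp
  have "real (card ?B1) \<le> 2 ^ card U * (7 / 8) ^ card (the_matching \<mu> H) * 2 ^ t"
    using the_matching[OF assms(3)] assms(1,4) by (intro card_few_matching_edges) auto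
  also have "\<dots> \<le> 2 ^ n * (7 / 8) ^ \<mu> * 2 ^ t"
    unfolding the_matching(3)[OF assms(3)] using assms(2) by (intro mult_right_mono power_increasing) auto
  finally have b1: "real (card ?B1) \<le> 2 ^ n * (7 / 8) ^ \<mu> * 2 ^ t" .
  have y: "(1 + y) ^ card U * y powr - T \<le> 2 ^ n * (((1 + y) / 2) ^ n * y powr - T)"
  proof -
    have "(1 + y) ^ card U \<le> (1 + y) ^ n" using assms(2,5) by (intro power_increasing) auto
    also have "\<dots> = 2 ^ n * ((1 + y) / 2) ^ n" by (simp add: power_divide)
    finally show ?thesis by (simp add: mult_right_mono mult.assoc[symmetric])
  qed
  have "x \<le> b * y powr - T" if "x * y powr T \<le> b" for x b
    using that assms(5) by (simp add: powr_minus field_simps)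
  then have b2: "real (card ?B2) \<le> (1 + y) ^ card U * y powr - T" "real (card ?B3) \<le> (1 + y) ^ card U * y powr - T"
    using card_large_subsets[OF assms(1,5)] card_small_subsets[OF assms(1,5)] by blast+
  have "card (bad_nbhds U \<mu> t T H) \<le> card ?B1 + card ?B2 + card ?B3"
    unfolding eq by (meson add_le_mono card_Un_le le_refl le_trans)
  then have "real (card (bad_nbhds U \<mu> t T H)) \<le> real (card ?B1) + real (card ?B2) + real (card ?B3)" by simp
  then show "real (card (bad_nbhds U \<mu> t T H)) \<le> 2 ^ n * ((7 / 8) ^ \<mu> * 2 ^ t + 2 * (((1 + y) / 2) ^ n * y powr - T))"
    using b1 b2 y by (simp add: algebra_simps)
qed

lemma finite_Ex_edges: "finite V \<Longrightarrow> finite (Ex_edges k V)"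
  by (rule finite_subset[of _ "Pow (pairs V)"]) (auto simp: Ex_edges_def)

text \<open>All four families are expressed as 2^(k n) N^n times a saving. The one with many trees
  carries only N^(k + a0), which is subexponential, as its extra edges are paid for inside the sum;
  the others carry N^(2 M) for up to \<open>M\<close> freely chosen edges.\<close>

lemma card_not_good:
  fixes V :: "'a set" and k n h K M d \<mu> t g :: nat and T y L :: real
  defines "N \<equiv> real (n + 1)" and "a0 \<equiv> k * (2 * h + 3)" and "C \<equiv> 2 * (5 * k + 1)"
  assumes V: "finite V" "r \<notin> V" "card V = n" and h: "n < 2 ^ h" and k: "0 < k" "k < n"
    and K: "a0 \<le> K" "0 < K" and M: "M = (5 * k + 1) * (2 * K)"
    and g: "0 < g" "g + k \<le> t + 1" and \<mu>: "2 * \<mu> + k \<le> n" "16 * (2 * \<mu> + 1) \<le> n + 1"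
    and y: "1 \<le> y" and L: "real (a0 * n) \<le> L" "real (C * n) \<le> L"
  shows "real (card {E \<in> Ex_edges k V. \<not> good k V (d + M + k) t T E}) \<le> 2 ^ (k * n) * N ^ n *
    (N ^ (k + a0) * (\<Sum>\<kappa>\<in>{K..n}. (exp 1 * L / real (C * \<kappa>)) ^ (C * \<kappa>) / fact \<kappa>) +
     N ^ (k + 2 * M) * ((1 / 2) ^ n + real n / fact d + 2 ^ n / 16 ^ (n - k - 2 * \<mu>) +
       N * exp (- (real g * (real g - 1) / (2 * real n))) +
       real k * ((7 / 8) ^ \<mu> * 2 ^ t + 2 * (((1 + y) / 2) ^ n * y powr - T))))"
proof -
  define QA where "QA S = (\<Union>\<kappa>\<in>{K..n}. many_comps (V - S) a0 C \<kappa>)" for S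
  define P0 where "P0 S = ((V - S) \<rightarrow>\<^sub>E insert r (V - S))" for S
  define P1 where "P1 S = deg_funs r (V - S) d \<union> cover_funs r (V - S) (2 * \<mu>) \<union> path_funs r (V - S) g" for S
  define Q2 where "Q2 S = {H \<in> encoded r (V - S) (P0 S) M. H \<subseteq> pairs (V - S) \<and> has_matching \<mu> H}" for S
  define B2 where "B2 S H = bad_nbhds (V - S) \<mu> t T H" for S H
  define EA where "EA = {E \<in> Ex_edges k V. \<exists>S\<subseteq>V. card S \<le> k \<and> edges_in E (V - S) \<in> QA S}"
  define E0 where "E0 = {E \<in> Ex_edges k V. \<exists>S\<subseteq>V. card S \<le> k - 1 \<and> edges_in E (V - S) \<in> encoded r (V - S) (P0 S) M}"
  define E1 where "E1 = {E \<in> Ex_edges k V. \<exists>S\<subseteq>V. card S \<le> k \<and> edges_in E (V - S) \<in> encoded r (V - S) (P1 S) M}"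
  define E2 where "E2 = {E \<in> Ex_edges k V. \<exists>S\<subseteq>V. card S = k \<and> edges_in E (V - S) \<in> Q2 S \<and> (\<exists>s\<in>S. nb E (V - S) s \<in> B2 S (edges_in E (V - S)))}"
  have N: "1 \<le> N" "N = real n + 1" by (simp_all add: N_def)
  have finU: "finite (V - S)" "r \<notin> V - S" "card (V - S) \<le> n" for S
    using V card_mono[of V "V - S"] by auto
  have cU: "n - k \<le> card (V - S)" "0 < card (V - S)" if "S \<subseteq> V" "card S \<le> k" for S
    using that V k by (auto simp: card_Diff_subset finite_subset)
  have finP0: "finite (P0 S)" for S using finU unfolding P0_def by (intro finite_PiE) auto
  have finP1: "finite (P1 S)" for S
    by (rule finite_subset[OF _ finP0[of S]]) (auto simp: P1_def P0_def deg_funs_def cover_funs_def path_funs_def)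
  have sub: "{E \<in> Ex_edges k V. \<not> good k V (d + M + k) t T E} \<subseteq> EA \<union> E0 \<union> E1 \<union> E2"
  proof
    fix E assume E: "E \<in> {E \<in> Ex_edges k V. \<not> good k V (d + M + k) t T E}"
    then have Ec: "E \<in> Ex_edges k V" and ng: "\<not> good k V (d + M + k) t T E" by auto
    have "card V < 2 ^ h" using V h by simp
    from class_cases[OF Ec V(1,2) this K(1)[unfolded a0_def] eq_imp_le[OF M[symmetric]] g(2), of d \<mu> T]
    consider (A) "\<exists>S\<subseteq>V. card S \<le> k \<and> edges_in E (V - S) \<in> QA S"
      | (B0) "\<exists>S\<subseteq>V. card S \<le> k - 1 \<and> edges_in E (V - S) \<in> encoded r (V - S) (P0 S) M"
      | (B1) "\<exists>S\<subseteq>V. card S \<le> k \<and> k \<le> card S \<and> edges_in E (V - S) \<in> encoded r (V - S) (P1 S) M"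
      | (B2) "\<exists>S\<subseteq>V. card S = k \<and> edges_in E (V - S) \<in> Q2 S \<and> (\<exists>s\<in>S. nb E (V - S) s \<in> B2 S (edges_in E (V - S)))"
      | (G) "good k V (d + M + k) t T E"
      unfolding V(3) QA_def P0_def P1_def Q2_def B2_def a0_def C_def by argo
    then show "E \<in> EA \<union> E0 \<union> E1 \<union> E2"
    proof cases
      case A
      then have "E \<in> EA" unfolding EA_def using Ec by simp
      then show ?thesis by simp
    next
      case B0
      then have "E \<in> E0" unfolding E0_def using Ec by simp
      then show ?thesis by simp
    next
      case B1
      then obtain S where "S \<subseteq> V \<and> card S \<le> k \<and> k \<le> card S \<and> edges_in E (V - S) \<in> encoded r (V - S) (P1 S) M" ..
      then have "\<exists>S\<subseteq>V. card S \<le> k \<and> edges_in E (V - S) \<in> encoded r (V - S) (P1 S) M" by (intro exI[of _ S]) simp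
      then have "E \<in> E1" unfolding E1_def using Ec by simp
      then show ?thesis by simp
    next
      case B2
      then have "E \<in> E2" unfolding E2_def using Ec by simp
      then show ?thesis by simp
    next
      case G
      then show ?thesis using ng by simp
    qed
  qed
  have clsP: "E \<subseteq> pairs V" if "E \<in> Ex_edges k V" for E using that by (simp add: Ex_edges_def)
  define SA where "SA = (\<Sum>\<kappa>\<in>{K..n}. (exp 1 * L / real (C * \<kappa>)) ^ (C * \<kappa>) / fact \<kappa>)"
  have L0: "0 \<le> L" using L(1) by (meson of_nat_0_le_iff order_trans)
  have SA0: "0 \<le> SA" unfolding SA_def using L0 by (intro sum_nonneg) auto
  have Apart: "real (card EA) \<le> N ^ k * ((N ^ a0 * (N ^ n * SA)) * 2 ^ (k * n))"
  proof -
    have cQA: "finite (QA S) \<and> real (card (QA S)) \<le> N ^ a0 * (N ^ n * SA)" for S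
    proof
      have fm: "finite (many_comps (V - S) a0 C \<kappa>)" for \<kappa>
        by (rule finite_subset[of _ "Pow (pairs (V - S))"]) (use finU in \<open>auto simp: many_comps_def\<close>)
      then show "finite (QA S)" unfolding QA_def by simp
      have cm: "real (card (many_comps (V - S) a0 C \<kappa>)) \<le> N ^ a0 * (N ^ n * ((exp 1 * L / real (C * \<kappa>)) ^ (C * \<kappa>) / fact \<kappa>))"
        if \<kappa>: "\<kappa> \<in> {K..n}" for \<kappa>
      proof -
        let ?z = "(exp 1 * L / real (C * \<kappa>)) ^ (C * \<kappa>)" and ?u = "card (V - S)"
        have z: "0 \<le> ?z" using L0 by simp
        have "real (card (many_comps (V - S) a0 C \<kappa>)) * fact \<kappa> \<le> real (?u + 1) ^ a0 * (real (?u + 1) ^ ?u * ?z)"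
        proof (rule card_many_comps[OF finU(1,2)])
          have "a0 * ?u \<le> a0 * n" using finU(3) by simp
          then show "real (a0 * ?u) \<le> L" using L(1) by linarith
          show "0 < C * \<kappa>" using \<kappa> K(2) by (simp add: C_def)
          have "C * \<kappa> \<le> C * n" using \<kappa> by simp
          then show "real (C * \<kappa>) \<le> L" using L(2) by linarith
        qed
        also have "\<dots> \<le> N ^ a0 * (N ^ n * ?z)"
        proof (intro mult_mono order.refl z)
          have u: "real (?u + 1) \<le> N" using finU(3)[of S] by (simp add: N_def)
          then show "real (?u + 1) ^ a0 \<le> N ^ a0" by (intro power_mono) auto
          have "real (?u + 1) ^ ?u \<le> N ^ ?u" using u by (intro power_mono) auto
          also have "\<dots> \<le> N ^ n" using finU(3)[of S] N by (intro power_increasing) auto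
          finally show "real (?u + 1) ^ ?u \<le> N ^ n" .
        qed (use z N in auto)
        finally have "real (card (many_comps (V - S) a0 C \<kappa>)) \<le> N ^ a0 * (N ^ n * ?z) / fact \<kappa>"
          by (simp only: pos_le_divide_eq fact_gt_zero)
        then show ?thesis by (simp only: times_divide_eq_right)
      qed
      have "card (QA S) \<le> (\<Sum>\<kappa>\<in>{K..n}. card (many_comps (V - S) a0 C \<kappa>))"
        unfolding QA_def by (rule card_UN_le) simp
      then have "real (card (QA S)) \<le> (\<Sum>\<kappa>\<in>{K..n}. real (card (many_comps (V - S) a0 C \<kappa>)))"
        by (simp only: of_nat_sum[symmetric] of_nat_le_iff)
      also have "\<dots> \<le> (\<Sum>\<kappa>\<in>{K..n}. N ^ a0 * (N ^ n * ((exp 1 * L / real (C * \<kappa>)) ^ (C * \<kappa>) / fact \<kappa>)))"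
        by (rule sum_mono[OF cm])
      also have "\<dots> = N ^ a0 * (N ^ n * SA)" by (simp only: SA_def sum_distrib_left)
      finally show "real (card (QA S)) \<le> N ^ a0 * (N ^ n * SA)" .
    qed
    have "real (card EA) \<le> real (card V + 1) ^ k * ((N ^ a0 * (N ^ n * SA)) * 2 ^ (k * card V))"
    proof (rule lift_count_real[OF V(1)])
      show "0 \<le> N ^ a0 * (N ^ n * SA)" using SA0 N by simp
      show "E \<subseteq> pairs V \<and> (\<exists>S\<subseteq>V. card S \<le> k \<and> edges_in E (V - S) \<in> QA S)" if "E \<in> EA" for E
        using that clsP by (simp add: EA_def)
    qed (rule cQA)
    then show ?thesis by (simp only: V(3) N_def)
  qed
  \<comment> \<open>One deleted vertex less leaves \<open>n\<close> fewer free pairs. This is the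
    whole saving of \<open>E0\<close>; in \<open>E2\<close> it cancels the \<open>2 ^ n\<close> from
    the bound on the restricted neighbourhood.\<close>
  have two: "(2::real) ^ ((k - 1) * n) = 2 ^ (k * n) * (1 / 2) ^ n"
  proof -
    have "(2::real) ^ (k * n) = 2 ^ ((k - 1) * n + n)" using k(1) by (cases k) auto
    then show ?thesis by (simp add: power_add power_divide)
  qed
  have c0: "real (card (encoded r (V - S) (P0 S) M)) \<le> N ^ n * N ^ (2 * M)" for S
    unfolding N_def P0_def using finU finP0[of S] by (intro card_encoded_real card_all_funs) (auto simp: P0_def)
  have fe0: "finite (encoded r (V - S) (P0 S) M)" for S by (rule card_encoded(1)[OF finU(1) finP0])
  have B0part: "real (card E0) \<le> N ^ k * ((N ^ n * N ^ (2 * M)) * (2 ^ (k * n) * (1 / 2) ^ n))"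
  proof -
    have "real (card E0) \<le> real (card V + 1) ^ (k - 1) * ((N ^ n * N ^ (2 * M)) * 2 ^ ((k - 1) * card V))"
    proof (rule lift_count_real[OF V(1)])
      show "0 \<le> N ^ n * N ^ (2 * M)" using N by simp
      show "E \<subseteq> pairs V \<and> (\<exists>S\<subseteq>V. card S \<le> k - 1 \<and> edges_in E (V - S) \<in> encoded r (V - S) (P0 S) M)" if "E \<in> E0" for E
        using that clsP by (simp add: E0_def)
    qed (use c0 fe0 in simp)
    also have "\<dots> = N ^ (k - 1) * ((N ^ n * N ^ (2 * M)) * (2 ^ (k * n) * (1 / 2) ^ n))"
      by (simp only: V(3) N_def two)
    also have "\<dots> \<le> N ^ k * ((N ^ n * N ^ (2 * M)) * (2 ^ (k * n) * (1 / 2) ^ n))"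
      using N by (intro mult_right_mono power_increasing) auto
    finally show ?thesis .
  qed
  define x1 where "x1 = real n / fact d + 2 ^ n / 16 ^ (n - k - 2 * \<mu>) + N * exp (- (real g * (real g - 1) / (2 * real n)))"
  have x1: "0 \<le> x1" unfolding x1_def using N by (intro add_nonneg_nonneg) auto
  have B1part: "real (card E1) \<le> N ^ k * ((N ^ n * x1 * N ^ (2 * M)) * 2 ^ (k * n))"
  proof -
    have cP1: "real (card (P1 S)) \<le> N ^ n * x1" if S: "S \<subseteq> V" "card S \<le> k" for S
    proof -
      let ?U = "V - S"
      have "real (card (deg_funs r ?U d)) \<le> real (card ?U) * (real (card ?U + 1) ^ card ?U / fact d)"
        by (rule card_deg_funs[OF finU(1,2)])
      also have "\<dots> \<le> real n * (N ^ n / fact d)"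
      proof (intro mult_mono divide_right_mono)
        have "real (card ?U + 1) ^ card ?U \<le> N ^ card ?U"
          using finU(3)[of S] by (intro power_mono) (auto simp: N_def)
        also have "\<dots> \<le> N ^ n" using finU(3)[of S] N by (intro power_increasing) auto
        finally show "real (card ?U + 1) ^ card ?U \<le> N ^ n" .
      qed (use finU(3)[of S] in auto)
      finally have 1: "real (card (deg_funs r ?U d)) \<le> N ^ n * (real n / fact d)" by (simp add: mult_ac)
      have "real (card (cover_funs r ?U (2 * \<mu>))) \<le> 2 ^ n * (real (n + 1) ^ n / 16 ^ (n - k - 2 * \<mu>))"
        using finU[of S] cU[OF S] \<mu> by (intro card_cover_funs) auto
      then have 2: "real (card (cover_funs r ?U (2 * \<mu>))) \<le> N ^ n * (2 ^ n / 16 ^ (n - k - 2 * \<mu>))"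
        by (simp add: N_def mult_ac)
      have "real (card (path_funs r ?U g)) \<le> real (n + 1) ^ (n + 1) * exp (- (real g * (real g - 1) / (2 * real n)))"
        using finU[of S] cU[OF S] g by (intro card_path_funs) auto
      then have 3: "real (card (path_funs r ?U g)) \<le> N ^ n * (N * exp (- (real g * (real g - 1) / (2 * real n))))"
        by (simp add: N_def mult_ac)
      have "card (P1 S) \<le> card (deg_funs r ?U d) + card (cover_funs r ?U (2 * \<mu>)) + card (path_funs r ?U g)"
        unfolding P1_def by (meson add_le_mono card_Un_le le_refl le_trans)
      then have "real (card (P1 S)) \<le> real (card (deg_funs r ?U d)) + real (card (cover_funs r ?U (2 * \<mu>))) + real (card (path_funs r ?U g))"
        by linarith
      then show ?thesis using 1 2 3 unfolding x1_def distrib_left by linarith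
    qed
    have "real (card E1) \<le> real (card V + 1) ^ k * ((N ^ n * x1 * N ^ (2 * M)) * 2 ^ (k * card V))"
    proof (rule lift_count_real[OF V(1)])
      show "0 \<le> N ^ n * x1 * N ^ (2 * M)" using N x1 by simp
      show "E \<subseteq> pairs V \<and> (\<exists>S\<subseteq>V. card S \<le> k \<and> edges_in E (V - S) \<in> encoded r (V - S) (P1 S) M)" if "E \<in> E1" for E
        using that clsP by (simp add: E1_def)
      fix S assume S: "S \<subseteq> V" "card S \<le> k"
      have "real (card (encoded r (V - S) (P1 S) M)) \<le> N ^ n * x1 * N ^ (2 * M)"
        unfolding N_def using cP1[OF S] finU finP1[of S] by (intro card_encoded_real) (auto simp: N_def)
      then show "finite (encoded r (V - S) (P1 S) M) \<and> real (card (encoded r (V - S) (P1 S) M)) \<le> N ^ n * x1 * N ^ (2 * M)"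
        using card_encoded(1)[OF finU(1) finP1] by simp
    qed
    then show ?thesis by (simp only: V(3) N_def)
  qed
  define x2 where "x2 = (7 / 8) ^ \<mu> * 2 ^ t + 2 * (((1 + y) / 2) ^ n * y powr - T)"
  have x2: "0 \<le> x2" unfolding x2_def using y by (intro add_nonneg_nonneg mult_nonneg_nonneg) auto
  have B2part: "real (card E2) \<le> N ^ k * (real k * ((N ^ n * N ^ (2 * M)) * ((2 ^ n * x2) * (2 ^ (k * n) * (1 / 2) ^ n))))"
  proof -
    have "real (card E2) \<le> real (card V + 1) ^ k * (real k * ((N ^ n * N ^ (2 * M)) * ((2 ^ n * x2) * 2 ^ ((k - 1) * card V))))"
    proof (rule lift_count_nb_real[OF V(1) k(1)])
      show "0 \<le> N ^ n * N ^ (2 * M)" using N by simp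
      show "0 \<le> 2 ^ n * x2" using x2 by simp
      show "E \<subseteq> pairs V \<and> (\<exists>S\<subseteq>V. card S = k \<and> edges_in E (V - S) \<in> Q2 S \<and> (\<exists>s\<in>S. nb E (V - S) s \<in> B2 S (edges_in E (V - S))))"
        if "E \<in> E2" for E using that clsP by (simp add: E2_def)
      fix S assume S: "S \<subseteq> V" "card S = k"
      have "card (Q2 S) \<le> card (encoded r (V - S) (P0 S) M)"
        unfolding Q2_def using fe0 by (intro card_mono) auto
      then have "real (card (Q2 S)) \<le> N ^ n * N ^ (2 * M)" using c0[of S] by linarith
      then show "finite (Q2 S) \<and> real (card (Q2 S)) \<le> N ^ n * N ^ (2 * M)" using fe0[of S] by (simp add: Q2_def)
      fix H assume H: "H \<in> Q2 S"
      then have hm: "has_matching \<mu> H" by (simp add: Q2_def)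
      have "H \<subseteq> pairs (V - S)" using H by (simp add: Q2_def)
      then show "finite (B2 S H) \<and> real (card (B2 S H)) \<le> 2 ^ n * x2"
        unfolding B2_def x2_def by (intro card_bad_nbhds finU hm y)
    qed
    then show ?thesis by (simp only: V(3) N_def two)
  qed
  have "finite (EA \<union> E0 \<union> E1 \<union> E2)"
    by (rule finite_subset[OF _ finite_Ex_edges[OF V(1), of k]]) (auto simp: EA_def E0_def E1_def E2_def)
  then have "card {E \<in> Ex_edges k V. \<not> good k V (d + M + k) t T E} \<le> card (EA \<union> E0 \<union> E1 \<union> E2)"
    using sub by (rule card_mono)
  also have "\<dots> \<le> card EA + card E0 + card E1 + card E2"
    by (meson add_le_mono card_Un_le le_refl le_trans)
  finally have "real (card {E \<in> Ex_edges k V. \<not> good k V (d + M + k) t T E}) \<le>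
      real (card EA) + real (card E0) + real (card E1) + real (card E2)" by linarith
  also have "\<dots> \<le> N ^ k * ((N ^ a0 * (N ^ n * SA)) * 2 ^ (k * n)) +
     N ^ k * ((N ^ n * N ^ (2 * M)) * (2 ^ (k * n) * (1 / 2) ^ n)) +
     N ^ k * ((N ^ n * x1 * N ^ (2 * M)) * 2 ^ (k * n)) +
     N ^ k * (real k * ((N ^ n * N ^ (2 * M)) * ((2 ^ n * x2) * (2 ^ (k * n) * (1 / 2) ^ n))))"
    by (intro add_mono Apart B0part B1part B2part)
  also have "\<dots> = 2 ^ (k * n) * N ^ n * (N ^ (k + a0) * SA + N ^ (k + 2 * M) * ((1 / 2) ^ n + x1 + real k * x2))"
  proof -
    have "(2::real) ^ n * (1 / 2) ^ n = 1" by (simp add: power_mult_distrib[symmetric])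
    then have e: "(2 ^ n * x2) * (2 ^ (k * n) * (1 / 2) ^ n) = x2 * 2 ^ (k * n)"
      by (metis (no_types, opaque_lifting) mult.assoc mult.commute mult.left_neutral)
    show ?thesis unfolding e by (simp only: power_add) (simp add: algebra_simps)
  qed
  finally show ?thesis unfolding SA_def x1_def x2_def by (simp only: add.assoc)
qed

section \<open>Exponentially small quantities\<close>

lemma at_top_ge: "filterlim f at_top F \<Longrightarrow> \<forall>\<^sub>F x in F. (c :: real) \<le> f x"
  by (simp add: filterlim_at_top)

definition exp_small :: "(nat \<Rightarrow> real) \<Rightarrow> bool" where
  "exp_small f \<longleftrightarrow> (\<exists>c>0. \<forall>\<^sub>F n in sequentially. f n \<le> exp (- c * real n))"

lemma exp_smallI: "0 < c \<Longrightarrow> (\<forall>\<^sub>F n in sequentially. f n \<le> exp (- c * real n)) \<Longrightarrow> exp_small f"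
  by (auto simp: exp_small_def)

lemma exp_small_mono:
  assumes "exp_small g" "\<forall>\<^sub>F n in sequentially. f n \<le> g n"
  shows "exp_small f"
proof -
  obtain c where c: "0 < c" "\<forall>\<^sub>F n in sequentially. g n \<le> exp (- c * real n)"
    using assms(1) unfolding exp_small_def by blast
  show ?thesis by (rule exp_smallI[OF c(1)]) (use c(2) assms(2) in eventually_elim, linarith)
qed

text \<open>This is for the freely chosen extra edges: their number of choices grows exponentially,
  at a rate that must stay below the decay rate of \<open>f\<close>.\<close>

lemma exp_small_mult_rate:
  assumes c: "\<forall>\<^sub>F n in sequentially. f n \<le> exp (- c * real n)" and "b < c"
    and h: "\<forall>\<^sub>F n in sequentially. 0 \<le> h n \<and> h n \<le> exp (b * real n)"
  shows "exp_small (\<lambda>n. h n * f n)"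
proof (rule exp_smallI)
  show "0 < c - b" using assms(2) by simp
  show "\<forall>\<^sub>F n in sequentially. h n * f n \<le> exp (- (c - b) * real n)"
    using c h
  proof eventually_elim
    case (elim n)
    have "h n * f n \<le> h n * exp (- c * real n)" using elim by (intro mult_left_mono) auto
    also have "\<dots> \<le> exp (b * real n) * exp (- c * real n)" using elim by (intro mult_right_mono) auto
    finally show ?case by (simp add: exp_add[symmetric] algebra_simps)
  qed
qed

lemma exp_small_mult:
  assumes "exp_small f"
    and h: "\<And>b. 0 < b \<Longrightarrow> \<forall>\<^sub>F n in sequentially. 0 \<le> h n \<and> h n \<le> exp (b * real n)"
  shows "exp_small (\<lambda>n. h n * f n)"
proof -
  obtain c where c: "0 < c" "\<forall>\<^sub>F n in sequentially. f n \<le> exp (- c * real n)"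
    using assms(1) unfolding exp_small_def by blast
  show ?thesis by (rule exp_small_mult_rate[OF c(2) _ h[of "c / 2"]]) (use c in auto)
qed

lemma exp_small_cmult:
  assumes "exp_small f" "0 \<le> a"
  shows "exp_small (\<lambda>n. a * f n)"
proof (rule exp_small_mult[OF assms(1)])
  fix b :: real assume b: "0 < b"
  have "filterlim (\<lambda>n::nat. exp (b * real n)) at_top sequentially" using b by real_asymp
  then have "\<forall>\<^sub>F n in sequentially. a \<le> exp (b * real n)" by (rule at_top_ge)
  then show "\<forall>\<^sub>F n in sequentially. 0 \<le> a \<and> a \<le> exp (b * real n)" using assms(2) by simp
qed

lemma exp_small_add:
  assumes "exp_small f" "exp_small g"
  shows "exp_small (\<lambda>n. f n + g n)"
proof -
  obtain c where c: "0 < c" "\<forall>\<^sub>F n in sequentially. f n \<le> exp (- c * real n)"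
    using assms(1) unfolding exp_small_def by blast
  obtain d where d: "0 < d" "\<forall>\<^sub>F n in sequentially. g n \<le> exp (- d * real n)"
    using assms(2) unfolding exp_small_def by blast
  define a where "a = min c d"
  have a: "0 < a" "a \<le> c" "a \<le> d" using c d by (auto simp: a_def)
  have "exp_small (\<lambda>n. exp (- a * real n))" by (rule exp_smallI[OF a(1)]) simp
  then have "exp_small (\<lambda>n. 2 * exp (- a * real n))" by (rule exp_small_cmult) simp
  moreover have "\<forall>\<^sub>F n in sequentially. f n + g n \<le> 2 * exp (- a * real n)"
    using c(2) d(2)
  proof eventually_elim
    case (elim n)
    have "exp (- c * real n) \<le> exp (- a * real n)" "exp (- d * real n) \<le> exp (- a * real n)"
      using a by (auto intro!: mult_right_mono)
    then show ?case using elim by linarith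
  qed
  ultimately show ?thesis by (rule exp_small_mono)
qed

lemma exp_small_power:
  fixes q :: real
  assumes "0 < q" "q < 1"
  shows "exp_small (\<lambda>n. q ^ n)"
proof (rule exp_smallI)
  show "0 < - ln q" using assms by simp
  have "q ^ n = exp (- (- ln q) * real n)" for n
  proof -
    have "exp (- (- ln q) * real n) = exp (real n * ln q)" by (simp add: mult.commute)
    also have "\<dots> = q ^ n" using assms(1) by (subst exp_of_nat_mult) simp
    finally show ?thesis by simp
  qed
  then show "\<forall>\<^sub>F n in sequentially. q ^ n \<le> exp (- (- ln q) * real n)" by simp
qed

section \<open>Decay rates of the individual terms\<close>

lemma subexp_power:
  "0 < b \<Longrightarrow> \<forall>\<^sub>F n in sequentially. 0 \<le> real (n + 1) ^ j \<and> real (n + 1) ^ j \<le> exp (b * real n)"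
proof -
  assume b: "0 < b"
  have "filterlim (\<lambda>n::nat. b * real n - real j * ln (real n + 1)) at_top sequentially"
    using b by real_asymp
  then have "\<forall>\<^sub>F n in sequentially. 0 \<le> b * real n - real j * ln (real n + 1)" by (rule at_top_ge)
  then show ?thesis
  proof eventually_elim
    case (elim n)
    have "real (n + 1) ^ j = exp (real j * ln (real n + 1))"
      by (subst exp_of_nat_mult) (simp add: add.commute)
    then show ?case using elim by simp
  qed
qed

text \<open>m^m / m! is a single term of the series for exp m.\<close>

lemma power_le_exp_fact: "real m ^ m \<le> exp (real m) * fact m"
proof -
  have "real m ^ m / fact m \<le> (\<Sum>i\<in>{m}. real m ^ i / fact i)" by simp
  also have "\<dots> \<le> (\<Sum>i. real m ^ i / fact i)"
    using summable_exp[of "real m"] by (intro sum_le_suminf) (auto simp: divide_inverse mult.commute)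
  also have "\<dots> = exp (real m)" by (simp add: exp_def divide_inverse mult.commute scaleR_conv_of_real)
  finally show ?thesis by (simp add: pos_divide_le_eq)
qed

text \<open>For d about n / (2 ln n) the quantity d ln d is about n / 2, so d! eventually exceeds
  exp (n / 4). The value of d is half of the degree threshold n / ln n; the other half leaves room
  for the extra edges. The \<open>- 1\<close> in \<open>?x\<close> absorbs the rounding.\<close>

lemma exp_small_fact: "exp_small (\<lambda>n. real n / fact (nat \<lfloor>real n / (2 * ln (real n))\<rfloor>))"
proof -
  let ?x = "\<lambda>n::nat. real n / (2 * ln (real n)) - 1"
  have "filterlim (\<lambda>n::nat. ?x n * (ln (?x n) - 1) - real n / 4) at_top sequentially" by real_asymp
  then have e1: "\<forall>\<^sub>F n in sequentially. 0 \<le> ?x n * (ln (?x n) - 1) - real n / 4" by (rule at_top_ge)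
  have "filterlim ?x at_top sequentially" by real_asymp
  then have e2: "\<forall>\<^sub>F n in sequentially. exp 1 \<le> ?x n" by (rule at_top_ge)
  have "\<forall>\<^sub>F n in sequentially. real n / fact (nat \<lfloor>real n / (2 * ln (real n))\<rfloor>) \<le> real (n + 1) ^ 1 * exp (- (1 / 4) * real n)"
    using e1 e2
  proof eventually_elim
    case (elim n)
    define d where "d = nat \<lfloor>real n / (2 * ln (real n))\<rfloor>"
    have xd: "?x n \<le> real d" unfolding d_def by linarith
    have x0: "0 < ?x n" by (rule less_le_trans[OF exp_gt_zero elim(2)])
    then have x1: "1 \<le> ln (?x n)" "0 < ?x n" using elim(2) ln_ge_iff[OF x0, of 1] by blast+
    have "real n / 4 \<le> ?x n * (ln (?x n) - 1)" using elim by simp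
    also have "\<dots> \<le> real d * (ln (real d) - 1)"
      using xd x1 by (intro mult_mono) auto
    finally have *: "real n / 4 \<le> real d * (ln (real d) - 1)" .
    have dpos: "0 < real d" using xd x1 by linarith
    have "real d ^ d = exp (real d * ln (real d))"
      by (subst exp_of_nat_mult) (use dpos in simp)
    then have "exp (real d * ln (real d)) \<le> exp (real d) * fact d" using power_le_exp_fact[of d] by simp
    then have "exp (real d * ln (real d) - real d) \<le> fact d"
      by (simp add: exp_diff pos_divide_le_eq mult.commute)
    moreover have "exp (real n / 4) \<le> exp (real d * ln (real d) - real d)" using * by (simp add: algebra_simps)
    ultimately have "exp (real n / 4) \<le> fact d" by linarith
    then have "real n / fact d \<le> real n / exp (real n / 4)" by (intro divide_left_mono) auto
    also have "\<dots> = real n * exp (- (real n / 4))" by (simp only: exp_minus divide_inverse)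
    also have "\<dots> = real n * exp (- (1 / 4) * real n)" by simp
    also have "\<dots> \<le> real (n + 1) ^ 1 * exp (- (1 / 4) * real n)" by (intro mult_right_mono) auto
    finally show ?case by (simp add: d_def)
  qed
  moreover have "exp_small (\<lambda>n. real (n + 1) ^ 1 * exp (- (1 / 4) * real n))"
    by (intro exp_small_mult subexp_power exp_smallI[of "1/4"]) auto
  ultimately show ?thesis by (rule exp_small_mono[rotated])
qed

lemma exp_small_cover: "exp_small (\<lambda>n. 2 ^ n / 16 ^ (n - k - 2 * (n div 64)))"
proof (rule exp_small_mono)
  show "exp_small (\<lambda>n. (1 / 2) ^ n)" by (rule exp_small_power) auto
  show "\<forall>\<^sub>F n in sequentially. 2 ^ n / 16 ^ (n - k - 2 * (n div 64)) \<le> (1 / 2 :: real) ^ n"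
    using eventually_ge_at_top[of "4 * k"]
  proof eventually_elim
    case (elim n)
    have "n \<le> 2 * (n - k - 2 * (n div 64))" using elim by linarith
    then have "(4::real) ^ n \<le> 4 ^ (2 * (n - k - 2 * (n div 64)))" by (rule power_increasing) simp
    also have "\<dots> = 16 ^ (n - k - 2 * (n div 64))" by (simp add: power_mult)
    finally have "2 ^ n / 16 ^ (n - k - 2 * (n div 64)) \<le> 2 ^ n / (4::real) ^ n"
      by (intro divide_left_mono) auto
    also have "\<dots> = (1 / 2) ^ n" by (simp add: power_divide[symmetric])
    finally show ?case .
  qed
qed

text \<open>For large n the path length is at least n/2048 and, diminished by one, at least n/4096;
  hence the denominator 2 * 2048 * 4096 = 16777216.\<close>

lemma exp_small_path:
  "exp_small (\<lambda>n. real (n + 1) * exp (- (real (n div 1024 + 1 - k) * (real (n div 1024 + 1 - k) - 1) / (2 * real n))))"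
proof -
  have "exp_small (\<lambda>n. real (n + 1) ^ 1 * exp (- (1 / 16777216) * real n))"
    by (intro exp_small_mult subexp_power exp_smallI[of "1/16777216"]) auto
  then show ?thesis
  proof (rule exp_small_mono)
    show "\<forall>\<^sub>F n in sequentially. real (n + 1) * exp (- (real (n div 1024 + 1 - k) * (real (n div 1024 + 1 - k) - 1) / (2 * real n)))
      \<le> real (n + 1) ^ 1 * exp (- (1 / 16777216) * real n)"
      using eventually_ge_at_top[of "2048 * k + 4096"]
    proof eventually_elim
      case (elim n)
      let ?g = "real (n div 1024 + 1 - k)"
      have "n \<le> 2048 * (n div 1024 + 1 - k)" using elim by linarith
      then have "real n \<le> real (2048 * (n div 1024 + 1 - k))" by (rule of_nat_mono)
      then have g1: "real n / 2048 \<le> ?g" by simp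
      have "n \<le> 4096 * (n div 1024 + 1 - k - 1)" using elim by linarith
      then have "real n \<le> real (4096 * (n div 1024 + 1 - k - 1))" by (rule of_nat_mono)
      then have g2: "real n / 4096 \<le> ?g - 1" using elim by (simp add: of_nat_diff)
      have "(real n / 2048) * (real n / 4096) \<le> ?g * (?g - 1)" using g1 g2 by (intro mult_mono) auto
      then have "(real n / 2048) * (real n / 4096) / (2 * real n) \<le> ?g * (?g - 1) / (2 * real n)"
        by (rule divide_right_mono) simp
      moreover have "(real n / 2048) * (real n / 4096) / (2 * real n) = (1 / 16777216) * real n" using elim by simp
      ultimately have "exp (- (?g * (?g - 1) / (2 * real n))) \<le> exp (- (1 / 16777216) * real n)" by simp
      then show ?case by (simp add: mult_left_mono)
    qed
  qed
qed

text \<open>(7/8)^(n/64) is at most exp (- n/512) and 2^(n/1024) at most exp (n/1024), leaving exp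
  (- n/1024). The factor \<open>exp (1 / 8)\<close> pays for the rounding in
  \<open>n div 64\<close>.\<close>

lemma exp_small_matching: "exp_small (\<lambda>n. (7 / 8) ^ (n div 64) * 2 ^ (n div 1024))"
proof (rule exp_small_mono)
  have "exp_small (\<lambda>n. exp (- (1 / 1024) * real n))" by (rule exp_smallI[of "1/1024"]) auto
  then show "exp_small (\<lambda>n. exp (1 / 8) * exp (- (1 / 1024) * real n))" by (rule exp_small_cmult) simp
  show "\<forall>\<^sub>F n in sequentially. (7 / 8) ^ (n div 64) * 2 ^ (n div 1024) \<le> exp (1 / 8) * exp (- (1 / 1024) * real n)"
  proof (intro always_eventually allI)
    fix n :: nat
    have "(7 / 8 :: real) \<le> exp (- (1 / 8))" using exp_ge_add_one_self[of "- (1 / 8)"] by simp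
    then have 1: "(7 / 8 :: real) ^ (n div 64) \<le> exp (- (1 / 8)) ^ (n div 64)" by (rule power_mono) simp
    have "(2 :: real) \<le> exp 1" using exp_ge_add_one_self[of 1] by simp
    then have 2: "(2 :: real) ^ (n div 1024) \<le> exp 1 ^ (n div 1024)" by (rule power_mono) simp
    have "(7 / 8 :: real) ^ (n div 64) * 2 ^ (n div 1024) \<le> exp (- (1 / 8)) ^ (n div 64) * exp 1 ^ (n div 1024)"
      using 1 2 by (intro mult_mono) auto
    also have "\<dots> = exp (- (real (n div 64) / 8) + real (n div 1024))"
      by (simp add: exp_of_nat_mult[symmetric] exp_add[symmetric])
    also have "\<dots> \<le> exp (1 / 8 + - (1 / 1024) * real n)"
    proof -
      have "n < 64 * (n div 64 + 1)" using dividend_less_times_div[of 64 n] by simp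
      moreover have "1024 * (n div 1024) \<le> n" by simp
      ultimately have "real n < real (64 * (n div 64 + 1))" "real (1024 * (n div 1024)) \<le> real n"
        by (simp_all only: of_nat_less_iff of_nat_le_iff)
      then have "real n / 64 \<le> real (n div 64) + 1" "real (n div 1024) \<le> real n / 1024" by simp_all
      then show ?thesis by simp
    qed
    finally show "(7 / 8) ^ (n div 64) * 2 ^ (n div 1024) \<le> exp (1 / 8) * exp (- (1 / 1024) * real n)"
      by (simp only: exp_add)
  qed
qed

lemma exp_small_main:
  fixes y \<eta> :: real
  assumes "1 < y" "(1 + y) / 2 * y powr - (1 / 2 + \<eta>) < 1"
  shows "exp_small (\<lambda>n. (1 / 2) ^ n + real n / fact (nat \<lfloor>real n / (2 * ln (real n))\<rfloor>) +
    2 ^ n / 16 ^ (n - k - 2 * (n div 64)) +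
    real (n + 1) * exp (- (real (n div 1024 + 1 - k) * (real (n div 1024 + 1 - k) - 1) / (2 * real n))) +
    real k * ((7 / 8) ^ (n div 64) * 2 ^ (n div 1024) + 2 * (((1 + y) / 2) ^ n * y powr - ((1 / 2 + \<eta>) * real n))))"
proof -
  define q where "q = (1 + y) / 2 * y powr - (1 / 2 + \<eta>)"
  have "((1 + y) / 2) ^ n * y powr - ((1 / 2 + \<eta>) * real n) = q ^ n" for n
  proof -
    have "y powr - ((1 / 2 + \<eta>) * real n) = (y powr - (1 / 2 + \<eta>)) powr real n"
      unfolding powr_powr by (simp add: algebra_simps)
    also have "\<dots> = (y powr - (1 / 2 + \<eta>)) ^ n" using assms(1) by (intro powr_realpow) simp
    finally show ?thesis unfolding q_def by (simp only: power_mult_distrib)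
  qed
  moreover have "0 < q" "q < 1" using assms by (auto simp: q_def)
  ultimately show ?thesis
    using exp_small_power[of q] exp_small_power[of "1/2"]
    by (intro exp_small_add exp_small_cmult exp_small_fact exp_small_cover exp_small_path exp_small_matching) auto
qed

section \<open>The main theorem\<close>

text \<open>From \<kappa> \<ge> \<beta> n / x and e \<le> \<beta> x follows e n \<le> \<kappa> x^2.
  So the base of the power is at most x^4, while \<kappa>! \<ge> (\<kappa> / e)^\<kappa> \<ge> (n /
  x^2)^\<kappa>. The quotient is at most (x^(4C+2) / n)^\<kappa> \<le> exp (- x \<kappa> / 2), and x
  \<kappa> \<ge> \<beta> n.\<close>

lemma many_comps_term:
  fixes \<beta> x :: real and C \<kappa> n :: nat
  assumes n: "0 < n" and x: "x = ln (real n)" "1 \<le> x" and \<beta>: "0 < \<beta>" and C: "0 < C"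
    and e: "exp 1 \<le> \<beta> * x" "real (4 * C + 2) * ln x \<le> x / 2" and \<kappa>: "\<beta> * real n / x \<le> real \<kappa>"
  shows "(exp 1 * (real n * x ^ 2) / real (C * \<kappa>)) ^ (C * \<kappa>) / fact \<kappa> \<le> exp (- (\<beta> / 2) * real n)"
proof -
  have x0: "0 < x" using x by linarith
  have \<kappa>0: "0 < \<beta> * real n / x" using \<beta> n x0 by simp
  then have \<kappa>1: "0 < real \<kappa>" using \<kappa> by linarith
  have key: "exp 1 * real n \<le> real \<kappa> * x ^ 2"
  proof -
    have "exp 1 * real n \<le> (\<beta> * x) * real n" using e(1) by (rule mult_right_mono) simp
    also have "\<dots> = (\<beta> * real n / x) * x ^ 2" using x0 by (simp add: power2_eq_square)
    also have "\<dots> \<le> real \<kappa> * x ^ 2" using \<kappa> by (rule mult_right_mono) simp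
    finally show ?thesis .
  qed
  have "exp 1 * (real n * x ^ 2) / real (C * \<kappa>) \<le> exp 1 * (real n * x ^ 2) / real \<kappa>"
    using C \<kappa>1 x0 by (intro divide_left_mono) auto
  also have "\<dots> \<le> x ^ 4"
  proof -
    have "exp 1 * (real n * x ^ 2) = (exp 1 * real n) * x ^ 2" by simp
    also have "\<dots> \<le> (real \<kappa> * x ^ 2) * x ^ 2" using key by (rule mult_right_mono) simp
    also have "\<dots> = x ^ 4 * real \<kappa>" by (simp add: power2_eq_square power4_eq_xxxx)
    finally show ?thesis using \<kappa>1 by (simp only: pos_divide_le_eq)
  qed
  finally have "(exp 1 * (real n * x ^ 2) / real (C * \<kappa>)) ^ (C * \<kappa>) \<le> (x ^ 4) ^ (C * \<kappa>)"
    using x0 by (intro power_mono) auto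
  also have "\<dots> = (x ^ (4 * C)) ^ \<kappa>" by (simp only: power_mult[symmetric] mult.assoc)
  finally have num: "(exp 1 * (real n * x ^ 2) / real (C * \<kappa>)) ^ (C * \<kappa>) \<le> (x ^ (4 * C)) ^ \<kappa>" .
  have "(real n / x ^ 2) ^ \<kappa> \<le> (real \<kappa> / exp 1) ^ \<kappa>"
    using key x0 by (intro power_mono) (auto simp: field_simps)
  also have "\<dots> = real \<kappa> ^ \<kappa> / exp (real \<kappa>)" by (simp add: power_divide exp_of_nat_mult[symmetric])
  also have "\<dots> \<le> fact \<kappa>" using power_le_exp_fact[of \<kappa>] by (simp add: pos_divide_le_eq mult.commute)
  finally have den: "(real n / x ^ 2) ^ \<kappa> \<le> fact \<kappa>" .
  have npos: "0 < (real n / x ^ 2) ^ \<kappa>" using n x0 by simp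
  have "(exp 1 * (real n * x ^ 2) / real (C * \<kappa>)) ^ (C * \<kappa>) / fact \<kappa> \<le> (x ^ (4 * C)) ^ \<kappa> / (real n / x ^ 2) ^ \<kappa>"
    using num den npos x0 by (intro frac_le) auto
  also have "\<dots> = (x ^ (4 * C) / (real n / x ^ 2)) ^ \<kappa>" by (simp only: power_divide)
  also have "x ^ (4 * C) / (real n / x ^ 2) = x ^ (4 * C + 2) / real n" by (simp add: power_add power2_eq_square)
  also have "(x ^ (4 * C + 2) / real n) ^ \<kappa> \<le> exp (- (x / 2)) ^ \<kappa>"
  proof (rule power_mono)
    have "x ^ (4 * C + 2) = exp (real (4 * C + 2) * ln x)" by (subst exp_of_nat_mult) (use x0 in simp)
    also have "\<dots> \<le> exp (x / 2)" using e(2) by simp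
    finally have "x ^ (4 * C + 2) / real n \<le> exp (x / 2) / exp x" using x n by (simp add: divide_right_mono)
    also have "\<dots> = exp (- (x / 2))" by (simp add: exp_diff[symmetric])
    finally show "x ^ (4 * C + 2) / real n \<le> exp (- (x / 2))" .
  qed (use x0 in simp)
  also have "\<dots> = exp (- (real \<kappa> * x / 2))" by (simp add: exp_of_nat_mult[symmetric])
  also have "\<dots> \<le> exp (- (\<beta> / 2) * real n)"
  proof -
    have "\<beta> * real n \<le> real \<kappa> * x" using \<kappa> x0 by (simp add: pos_divide_le_eq)
    then show ?thesis by simp
  qed
  finally show ?thesis .
qed

lemma exp_small_many_comps:
  fixes \<beta> :: real
  assumes "0 < \<beta>" "0 < C"
  shows "exp_small (\<lambda>n. \<Sum>\<kappa>\<in>{nat \<lceil>\<beta> * real n / ln (real n)\<rceil>..n}.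
    (exp 1 * (real n * ln (real n) ^ 2) / real (C * \<kappa>)) ^ (C * \<kappa>) / fact \<kappa>)"
proof -
  have "exp_small (\<lambda>n. real (n + 1) ^ 1 * exp (- (\<beta> / 2) * real n))"
    by (intro exp_small_mult subexp_power exp_smallI[of "\<beta> / 2"]) (use assms in auto)
  then show ?thesis
  proof (rule exp_small_mono)
    have "filterlim (\<lambda>n::nat. ln (real n)) at_top sequentially" by real_asymp
    then have 1: "\<forall>\<^sub>F n in sequentially. 1 \<le> ln (real n)" by (rule at_top_ge)
    have "filterlim (\<lambda>n::nat. \<beta> * ln (real n)) at_top sequentially" using assms(1) by real_asymp
    then have 2: "\<forall>\<^sub>F n in sequentially. exp 1 \<le> \<beta> * ln (real n)" by (rule at_top_ge)
    have "filterlim (\<lambda>n::nat. ln (real n) / 2 - real (4 * C + 2) * ln (ln (real n))) at_top sequentially" by real_asymp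
    then have 3: "\<forall>\<^sub>F n in sequentially. 0 \<le> ln (real n) / 2 - real (4 * C + 2) * ln (ln (real n))" by (rule at_top_ge)
    show "\<forall>\<^sub>F n in sequentially. (\<Sum>\<kappa>\<in>{nat \<lceil>\<beta> * real n / ln (real n)\<rceil>..n}.
      (exp 1 * (real n * ln (real n) ^ 2) / real (C * \<kappa>)) ^ (C * \<kappa>) / fact \<kappa>)
      \<le> real (n + 1) ^ 1 * exp (- (\<beta> / 2) * real n)"
      using 1 2 3 eventually_gt_at_top[of 0]
    proof eventually_elim
      case (elim n)
      let ?I = "{nat \<lceil>\<beta> * real n / ln (real n)\<rceil>..n}"
      have "(\<Sum>\<kappa>\<in>?I. (exp 1 * (real n * ln (real n) ^ 2) / real (C * \<kappa>)) ^ (C * \<kappa>) / fact \<kappa>)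
          \<le> real (card ?I) * exp (- (\<beta> / 2) * real n)"
      proof (rule sum_bounded_above)
        fix \<kappa> assume "\<kappa> \<in> ?I"
        then have "nat \<lceil>\<beta> * real n / ln (real n)\<rceil> \<le> \<kappa>" by simp
        then have "\<beta> * real n / ln (real n) \<le> real \<kappa>" by linarith
        then show "(exp 1 * (real n * ln (real n) ^ 2) / real (C * \<kappa>)) ^ (C * \<kappa>) / fact \<kappa> \<le> exp (- (\<beta> / 2) * real n)"
          using elim assms by (intro many_comps_term[OF _ refl]) auto
      qed
      also have "\<dots> \<le> real (n + 1) ^ 1 * exp (- (\<beta> / 2) * real n)" by (intro mult_right_mono) auto
      finally show ?case .
    qed
  qed
qed

text \<open>The exponent is O(k ln n), so the power is exp (O(k (ln n)^2)), which is
  subexponential.\<close>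

lemma slack_blocker:
  assumes "0 < (b :: real)"
  shows "\<forall>\<^sub>F n in sequentially. 0 \<le> real (n + 1) ^ (k + k * (2 * (nat \<lceil>2 * ln (real n)\<rceil> + 1) + 3)) \<and>
    real (n + 1) ^ (k + k * (2 * (nat \<lceil>2 * ln (real n)\<rceil> + 1) + 3)) \<le> exp (b * real n)"
proof -
  have "filterlim (\<lambda>n::nat. b * real n - real k * (4 * ln (real n) + 8) * ln (real n + 1)) at_top sequentially"
    using assms by real_asymp
  then have "\<forall>\<^sub>F n in sequentially. 0 \<le> b * real n - real k * (4 * ln (real n) + 8) * ln (real n + 1)" by (rule at_top_ge)
  then show ?thesis using eventually_gt_at_top[of 0]
  proof eventually_elim
    case (elim n)
    let ?h = "nat \<lceil>2 * ln (real n)\<rceil>" and ?j = "k + k * (2 * (nat \<lceil>2 * ln (real n)\<rceil> + 1) + 3)"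
    have "0 \<le> ln (real n)" using elim by simp
    then have h: "real ?h \<le> 2 * ln (real n) + 1" by linarith
    have "real ?j = real k * (2 * real ?h + 6)" by (simp add: algebra_simps)
    also have "\<dots> \<le> real k * (4 * ln (real n) + 8)" using h by (intro mult_left_mono) auto
    finally have "real ?j * ln (real n + 1) \<le> real k * (4 * ln (real n) + 8) * ln (real n + 1)"
      by (rule mult_right_mono) simp
    then have le: "real ?j * ln (real n + 1) \<le> b * real n" using elim(1) by linarith
    have eq: "real (n + 1) ^ ?j = exp (real ?j * ln (real n + 1))"
      by (subst exp_of_nat_mult) (simp add: add.commute)
    show ?case unfolding eq using le by (simp only: exp_ge_zero exp_le_cancel_iff simp_thms)
  qed
qed

text \<open>The exponent is k + (20 k + 4) K with K about \<beta> n / ln n. The crude bound ln (n +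
  1) \<le> 2 ln n turns 20 k + 4 into 40 k + 8; one more \<beta> n covers the summand k and the
  rounding of K.\<close>

lemma slack_extra:
  assumes "0 < (\<beta> :: real)"
  shows "\<forall>\<^sub>F n in sequentially. 0 \<le> real (n + 1) ^ (k + 2 * ((5 * k + 1) * (2 * nat \<lceil>\<beta> * real n / ln (real n)\<rceil>))) \<and>
    real (n + 1) ^ (k + 2 * ((5 * k + 1) * (2 * nat \<lceil>\<beta> * real n / ln (real n)\<rceil>))) \<le> exp (((40 * real k + 9) * \<beta>) * real n)"
proof -
  have "filterlim (\<lambda>n::nat. \<beta> * real n - (21 * real k + 4) * ln (real n + 1)) at_top sequentially"
    using assms by real_asymp
  then have 1: "\<forall>\<^sub>F n in sequentially. 0 \<le> \<beta> * real n - (21 * real k + 4) * ln (real n + 1)" by (rule at_top_ge)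
  have "filterlim (\<lambda>n::nat. 2 * ln (real n) - ln (real n + 1)) at_top sequentially" by real_asymp
  then have 2: "\<forall>\<^sub>F n in sequentially. 0 \<le> 2 * ln (real n) - ln (real n + 1)" by (rule at_top_ge)
  show ?thesis using 1 2 eventually_gt_at_top[of 1]
  proof eventually_elim
    case (elim n)
    let ?K = "nat \<lceil>\<beta> * real n / ln (real n)\<rceil>"
    let ?j = "k + 2 * ((5 * k + 1) * (2 * ?K))"
    have ln0: "0 < ln (real n)" using elim by simp
    then have q0: "0 \<le> \<beta> * real n / ln (real n)" using assms by simp
    then have K: "real ?K \<le> \<beta> * real n / ln (real n) + 1" by linarith
    have q1: "0 \<le> (20 * real k + 4) * (\<beta> * real n / ln (real n))"
      using q0 by (intro mult_nonneg_nonneg) auto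
    have "real ?j = real k + (20 * real k + 4) * real ?K" by (simp add: algebra_simps)
    also have "\<dots> \<le> real k + (20 * real k + 4) * (\<beta> * real n / ln (real n) + 1)"
      using K by (intro add_left_mono mult_left_mono) auto
    also have "\<dots> = (21 * real k + 4) + (20 * real k + 4) * (\<beta> * real n / ln (real n))" by (simp add: algebra_simps)
    finally have "real ?j * ln (real n + 1) \<le> ((21 * real k + 4) + (20 * real k + 4) * (\<beta> * real n / ln (real n))) * ln (real n + 1)"
      by (rule mult_right_mono) simp
    also have "\<dots> = (21 * real k + 4) * ln (real n + 1) + (20 * real k + 4) * (\<beta> * real n / ln (real n)) * ln (real n + 1)"
      by (rule distrib_right)
    also have "\<dots> \<le> \<beta> * real n + (20 * real k + 4) * (\<beta> * real n / ln (real n)) * (2 * ln (real n))"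
      using elim(1,2) by (intro add_mono mult_left_mono[OF _ q1]) auto
    also have "\<dots> = ((40 * real k + 9) * \<beta>) * real n" using ln0 by (simp add: field_simps)
    finally have le: "real ?j * ln (real n + 1) \<le> ((40 * real k + 9) * \<beta>) * real n" .
    have eq: "real (n + 1) ^ ?j = exp (real ?j * ln (real n + 1))"
      by (subst exp_of_nat_mult) (simp add: add.commute)
    show ?case unfolding eq using le by (simp only: exp_ge_zero exp_le_cancel_iff simp_thms)
  qed
qed

text \<open>With m = n - k the losses are: N^k from lowering the exponent n to m, exp (k + 1) from
  (N / m)^m = (1 + (k + 1) / m)^m, m^2 from the prefactor in \<open>card_Ex_cycles_lower\<close> and
  from m^m against m^(m-1), and 2^(k k) from 2^(k n) against 2^(k m).\<close>

lemma Ex_cycles_base: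
  assumes "k < n"
  shows "2 ^ (k * n) * real (n + 1) ^ n \<le>
    (2 ^ (k * k) * exp (real k + 1)) * real (n + 1) ^ (k + 2) * real (card (labelled (Ex_cycles (k + 1)) n))"
proof -
  define m where "m = n - k"
  have m: "0 < m" "n = m + k" using assms by (auto simp: m_def)
  let ?c = "real (card (labelled (Ex_cycles (k + 1)) n))" and ?N = "real (n + 1)"
  have "2 ^ (k * m) * m ^ (m - 1) \<le> m * card (labelled (Ex_cycles (k + 1)) n)"
    using card_Ex_cycles_lower[OF assms] by (simp add: m_def)
  then have "real (2 ^ (k * m) * m ^ (m - 1)) \<le> real (m * card (labelled (Ex_cycles (k + 1)) n))" by (rule of_nat_mono)
  then have low: "2 ^ (k * m) * real m ^ (m - 1) \<le> real m * ?c"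
    by (simp only: of_nat_mult of_nat_power of_nat_numeral)
  have mm: "real m ^ m = real m * real m ^ (m - 1)" using m(1) by (cases m) auto
  have "?N = real m * (1 + (real k + 1) / real m)" using m by (simp add: field_simps)
  then have "?N ^ m = real m ^ m * (1 + (real k + 1) / real m) ^ m" by (simp only: power_mult_distrib)
  also have "\<dots> \<le> real m ^ m * exp ((real k + 1) / real m) ^ m"
    by (intro mult_left_mono power_mono) auto
  also have "exp ((real k + 1) / real m) ^ m = exp (real k + 1)"
    using m(1) by (simp add: exp_of_nat_mult[symmetric])
  finally have Nm: "?N ^ m \<le> real m ^ m * exp (real k + 1)" .
  have "2 ^ (k * n) * ?N ^ n = 2 ^ (k * k) * ?N ^ k * (2 ^ (k * m) * ?N ^ m)"
    unfolding m(2) by (simp add: power_add algebra_simps)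
  also have "\<dots> \<le> 2 ^ (k * k) * ?N ^ k * (2 ^ (k * m) * (real m ^ m * exp (real k + 1)))"
    using Nm by (intro mult_left_mono) auto
  also have "\<dots> = 2 ^ (k * k) * ?N ^ k * exp (real k + 1) * (real m * (2 ^ (k * m) * real m ^ (m - 1)))"
    unfolding mm by (simp add: mult_ac)
  also have "\<dots> \<le> 2 ^ (k * k) * ?N ^ k * exp (real k + 1) * (real m * (real m * ?c))"
    using low by (intro mult_left_mono) auto
  also have "\<dots> = 2 ^ (k * k) * exp (real k + 1) * ?N ^ k * ?c * (real m * real m)" by (simp add: mult_ac)
  also have "\<dots> \<le> 2 ^ (k * k) * exp (real k + 1) * ?N ^ k * ?c * (?N * ?N)"
    using m by (intro mult_left_mono mult_mono) auto
  also have "\<dots> = (2 ^ (k * k) * exp (real k + 1)) * ?N ^ (k + 2) * ?c"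
    by (simp add: power_add power2_eq_square mult_ac)
  finally show ?thesis .
qed

text \<open>The threshold n / ln n lies between \<open>D\<close>, which bounds the degrees outside
  \<open>S\<close>, and n - k - T, below all degrees in \<open>S\<close>. So \<open>S\<close> is
  exactly the set of vertices of high degree.\<close>

lemma good_conclusion:
  fixes R :: "nat ugraph" and \<epsilon> \<delta> T :: real
  assumes R: "R \<in> labelled (Ex_cycles (k + 1)) n" and good: "good k {1..n} D t T (edges R)"
    and D: "real D \<le> real n / ln (real n)"
    and T: "T + real k \<le> (1 / 2 + \<epsilon>) * real n" "(1 / 2 - \<epsilon>) * real n \<le> real n - real k - T"
      "real n / ln (real n) \<le> real n - real k - T"
    and t: "\<delta> * real n < real t" and k: "k \<le> n"
  shows "let S = high_degree_verts R n in
    (card S = k \<and> blocker R S) \<and>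
    (\<forall>B. blocker R B \<and> \<not> S \<subseteq> B \<longrightarrow> real (card B) > \<delta> * real n) \<and>
    (\<forall>v\<in>S. (1 / 2 - \<epsilon>) * real n \<le> real (vdegree R v) \<and> real (vdegree R v) \<le> (1 / 2 + \<epsilon>) * real n)"
proof -
  let ?V = "{1..n}" and ?E = "edges R"
  have vR: "verts R = ?V" and sR: "simple_graph R" using R by (auto simp: labelled_def Ex_cycles_def)
  have EP: "?E \<subseteq> pairs (verts R)" using sR by (auto simp: simple_graph_def pairs_def)
  have deg: "vdegree R v = card (nb ?E ?V v)" for v
    using vdegree_nb[OF EP, of v] by (simp add: vR)
  obtain S where S: "S \<subseteq> ?V" "card S = k" "coreless ?E (?V - S)" "\<forall>v\<in>?V - S. card (nb ?E ?V v) \<le> D"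
    "\<forall>s\<in>S. real (card (nb ?E (?V - S) s)) < T \<and> real (card ?V - k) - T < real (card (nb ?E (?V - S) s))"
    "\<forall>B\<subseteq>?V. coreless ?E (?V - B) \<and> \<not> S \<subseteq> B \<longrightarrow> t \<le> card B"
    using good unfolding good_def by (elim exE conjE)
  have degS: "real n - real k - T < real (vdegree R s)" "real (vdegree R s) < T + real k" if s: "s \<in> S" for s
  proof -
    have "real (card ?V - k) = real n - real k" using k by (simp add: of_nat_diff)
    then have b: "real (card (nb ?E (?V - S) s)) < T" "real n - real k - T < real (card (nb ?E (?V - S) s))"
      using S(5) s by auto
    show "real n - real k - T < real (vdegree R s)"
      using b(2) card_nb_split(1)[OF _ S(1), of ?E s] unfolding deg by simp
    show "real (vdegree R s) < T + real k"
      using b(1) card_nb_split(2)[OF _ S(1), of ?E s] S(2) unfolding deg by simp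
  qed
  have high: "high_degree_verts R n = S"
  proof (intro set_eqI iffI)
    fix v assume v: "v \<in> high_degree_verts R n"
    show "v \<in> S"
    proof (rule ccontr)
      assume "v \<notin> S"
      then have "card (nb ?E ?V v) \<le> D" using S(4) v vR by (auto simp: high_degree_verts_def)
      then show False using v D by (simp add: high_degree_verts_def deg)
    qed
  next
    fix v assume v: "v \<in> S"
    then show "v \<in> high_degree_verts R n"
      using degS(1)[OF v] T(3) S(1) vR by (auto simp: high_degree_verts_def)
  qed
  have "blocker R S" using S(1,3) vR blocker_iff_coreless[OF sR, of S] by simp
  moreover have "real (card B) > \<delta> * real n" if "blocker R B" "\<not> S \<subseteq> B" for B
  proof -
    have "t \<le> card B" using that S(6) vR blocker_iff_coreless[OF sR, of B] by simp
    then show ?thesis using t by linarith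
  qed
  moreover have "(1 / 2 - \<epsilon>) * real n \<le> real (vdegree R v) \<and> real (vdegree R v) \<le> (1 / 2 + \<epsilon>) * real n" if "v \<in> S" for v
    using degS[OF that] T by linarith
  ultimately show ?thesis unfolding high Let_def using S(2) by blast
qed

lemma less_two_power_ln: "0 < n \<Longrightarrow> n < 2 ^ (nat \<lceil>2 * ln (real n)\<rceil> + 1)"
proof -
  assume n: "0 < n"
  let ?h = "nat \<lceil>2 * ln (real n)\<rceil> + 1"
  have l0: "0 \<le> ln (real n)" using n by simp
  have "1 / 2 \<le> ln (2 :: real)" using ln2_ge_two_thirds by simp
  then have "ln (real n) \<le> 2 * ln (real n) * ln 2" using mult_left_mono[of "1/2" "ln 2" "2 * ln (real n)"] l0 by simp
  also have "\<dots> < real ?h * ln 2"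
  proof (rule mult_strict_right_mono)
    show "2 * ln (real n) < real ?h" by linarith
  qed simp
  finally have "exp (ln (real n)) < exp (real ?h * ln 2)" by simp
  also have "exp (real ?h * ln 2) = 2 ^ ?h" by (subst exp_of_nat_mult) simp
  finally have "real n < real (2 ^ ?h)" using n by simp
  then show ?thesis by (simp only: of_nat_less_iff)
qed

lemma parameters:
  fixes \<beta> \<eta> :: real
  assumes "0 < k" "0 < \<beta>" "(10 * real k + 2) * \<beta> \<le> 1 / 4" "0 < \<eta>" "\<eta> \<le> 1 / 16"
  shows "\<forall>\<^sub>F n in sequentially.
    k * (2 * (nat \<lceil>2 * ln (real n)\<rceil> + 1) + 3) \<le> nat \<lceil>\<beta> * real n / ln (real n)\<rceil> \<and>
    0 < nat \<lceil>\<beta> * real n / ln (real n)\<rceil> \<and>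
    real (k * (2 * (nat \<lceil>2 * ln (real n)\<rceil> + 1) + 3) * n) \<le> real n * ln (real n) ^ 2 \<and>
    real (2 * (5 * k + 1) * n) \<le> real n * ln (real n) ^ 2 \<and>
    real (nat \<lfloor>real n / (2 * ln (real n))\<rfloor> + (5 * k + 1) * (2 * nat \<lceil>\<beta> * real n / ln (real n)\<rceil>) + k) \<le> real n / ln (real n) \<and>
    real k \<le> \<eta> * real n \<and> 4 \<le> ln (real n) \<and> 2048 * (k + 2) \<le> n"
proof -
  have "filterlim (\<lambda>n::nat. \<beta> * real n / ln (real n) - real k * (4 * ln (real n) + 7)) at_top sequentially"
    using assms(2) by real_asymp
  then have 1: "\<forall>\<^sub>F n in sequentially. 1 \<le> \<beta> * real n / ln (real n) - real k * (4 * ln (real n) + 7)" by (rule at_top_ge)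
  have "filterlim (\<lambda>n::nat. ln (real n) ^ 2 - real k * (4 * ln (real n) + 7)) at_top sequentially" by real_asymp
  then have 2: "\<forall>\<^sub>F n in sequentially. 0 \<le> ln (real n) ^ 2 - real k * (4 * ln (real n) + 7)" by (rule at_top_ge)
  have "filterlim (\<lambda>n::nat. ln (real n) ^ 2) at_top sequentially" by real_asymp
  then have 3: "\<forall>\<^sub>F n in sequentially. real (2 * (5 * k + 1)) \<le> ln (real n) ^ 2" by (rule at_top_ge)
  have "filterlim (\<lambda>n::nat. real n / ln (real n)) at_top sequentially" by real_asymp
  then have 4: "\<forall>\<^sub>F n in sequentially. 4 * (11 * real k + 2) \<le> real n / ln (real n)" by (rule at_top_ge)
  have "filterlim (\<lambda>n::nat. \<eta> * real n) at_top sequentially" using assms(4) by real_asymp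
  then have 5: "\<forall>\<^sub>F n in sequentially. real k \<le> \<eta> * real n" by (rule at_top_ge)
  have "filterlim (\<lambda>n::nat. ln (real n)) at_top sequentially" by real_asymp
  then have 6: "\<forall>\<^sub>F n in sequentially. 4 \<le> ln (real n)" by (rule at_top_ge)
  show ?thesis using 1 2 3 4 5 6 eventually_ge_at_top[of "2048 * (k + 2)"]
  proof eventually_elim
    case (elim n)
    let ?x = "ln (real n)"
    let ?h = "nat \<lceil>2 * ?x\<rceil>" and ?K = "nat \<lceil>\<beta> * real n / ?x\<rceil>" and ?d = "nat \<lfloor>real n / (2 * ?x)\<rfloor>"
    let ?q = "real n / ?x"
    have x: "0 < ?x" using elim(6) by linarith
    have h: "real ?h \<le> 2 * ?x + 1" using x by linarith
    have "real (k * (2 * (?h + 1) + 3)) = real k * (2 * real ?h + 5)" by (simp add: algebra_simps)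
    also have "\<dots> \<le> real k * (4 * ?x + 7)" using h by (intro mult_left_mono) auto
    finally have a0: "real (k * (2 * (?h + 1) + 3)) \<le> real k * (4 * ?x + 7)" .
    have a0': "0 \<le> real k * (4 * ?x + 7)" using x by simp
    have K: "\<beta> * real n / ?x \<le> real ?K" by linarith
    have "0 \<le> \<beta> * real n / ?x" using assms(2) x by simp
    then have K': "real ?K \<le> \<beta> * ?q + 1" by simp
    have "real (k * (2 * (?h + 1) + 3)) \<le> real ?K" "0 < real ?K" using a0 a0' K elim(1) by linarith+
    then have c1: "k * (2 * (?h + 1) + 3) \<le> ?K" "0 < ?K" by (simp_all only: of_nat_le_iff of_nat_0_less_iff)
    have "real (k * (2 * (?h + 1) + 3) * n) = real n * real (k * (2 * (?h + 1) + 3))"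
      by (simp only: of_nat_mult mult.commute)
    also have "\<dots> \<le> real n * ?x ^ 2" using a0 elim(2) by (intro mult_left_mono) auto
    finally have c2: "real (k * (2 * (?h + 1) + 3) * n) \<le> real n * ?x ^ 2" .
    have "real (2 * (5 * k + 1) * n) = real n * real (2 * (5 * k + 1))" by (simp only: of_nat_mult mult.commute)
    also have "\<dots> \<le> real n * ?x ^ 2" using elim(3) by (intro mult_left_mono) auto
    finally have c3: "real (2 * (5 * k + 1) * n) \<le> real n * ?x ^ 2" .
    have "0 \<le> real n / (2 * ?x)" using x by simp
    then have "real ?d \<le> real n / (2 * ?x)" by linarith
    then have d: "real ?d \<le> ?q / 2" by (simp add: mult.commute)
    have "real (?d + (5 * k + 1) * (2 * ?K) + k) = real ?d + (10 * real k + 2) * real ?K + real k" by (simp add: algebra_simps)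
    also have "\<dots> \<le> ?q / 2 + (10 * real k + 2) * (\<beta> * ?q + 1) + real k"
      using d K' by (intro add_mono mult_left_mono) auto
    also have "\<dots> = ?q / 2 + ((10 * real k + 2) * \<beta>) * ?q + (11 * real k + 2)" by (simp add: algebra_simps)
    \<comment> \<open>The share of each summand: half of the threshold for \<open>?d\<close>, a
      quarter for the extra edges by the bound on \<beta>, a quarter for the constants.\<close>
    also have "\<dots> \<le> ?q / 2 + 1 / 4 * ?q + ?q / 4"
      using assms(3) elim(4) x by (intro add_mono mult_right_mono) auto
    also have "\<dots> = ?q" by simp
    finally have c4: "real (?d + (5 * k + 1) * (2 * ?K) + k) \<le> ?q" .
    show ?case using c1 c2 c3 c4 elim(5,6,7) by blast
  qed
qed

lemma prob_not_good_le:
  fixes X :: "nat ugraph set"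
  assumes "k < n" and X: "\<And>R. R \<in> labelled (Ex_cycles (k + 1)) n \<Longrightarrow> R \<in> X \<Longrightarrow> \<not> good k {1..n} D t T (edges R)"
    and b: "real (card {E \<in> Ex_edges k {1..n}. \<not> good k {1..n} D t T E}) \<le> 2 ^ (k * n) * real (n + 1) ^ n * b" "0 \<le> b"
  shows "measure_pmf.prob (pmf_of_set (labelled (Ex_cycles (k + 1)) n)) X \<le>
    (2 ^ (k * k) * exp (real k + 1)) * (real (n + 1) ^ (k + 2) * b)"
proof -
  let ?A = "labelled (Ex_cycles (k + 1)) n"
  have fin: "finite ?A" "?A \<noteq> {}" by (rule finite_labelled_Ex_cycles, rule labelled_Ex_cycles_nonempty) simp
  have pos: "0 < real (card ?A)" using fin by (simp add: card_gt_0_iff)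
  have "card (?A \<inter> X) \<le> card {E \<in> Ex_edges k {1..n}. \<not> good k {1..n} D t T E}"
  proof (rule card_inj_on_le)
    show "inj_on edges (?A \<inter> X)" by (auto simp: inj_on_def labelled_def)
    show "edges ` (?A \<inter> X) \<subseteq> {E \<in> Ex_edges k {1..n}. \<not> good k {1..n} D t T E}"
    proof clarify
      fix R assume R: "R \<in> ?A" "R \<in> X"
      then have "edges R \<in> Ex_edges k {1..n}" unfolding Ex_cycles_edges by (auto simp: Ex_edges_def)
      then show "edges R \<in> Ex_edges k {1..n} \<and> \<not> good k {1..n} D t T (edges R)" using X[OF R] by simp
    qed
    show "finite {E \<in> Ex_edges k {1..n}. \<not> good k {1..n} D t T E}" using finite_Ex_edges[of "{1..n}" k] by simp
  qed
  then have "real (card (?A \<inter> X)) \<le> 2 ^ (k * n) * real (n + 1) ^ n * b" using b(1) by linarith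
  also have "\<dots> \<le> ((2 ^ (k * k) * exp (real k + 1)) * real (n + 1) ^ (k + 2) * real (card ?A)) * b"
    using Ex_cycles_base[OF assms(1)] b(2) by (rule mult_right_mono)
  finally have "real (card (?A \<inter> X)) \<le> (2 ^ (k * k) * exp (real k + 1)) * (real (n + 1) ^ (k + 2) * b) * real (card ?A)"
    by (simp only: mult_ac)
  then show ?thesis unfolding measure_pmf_of_set[OF fin(2,1)] by (simp only: pos_divide_le_eq[OF pos])
qed

theorem theorem1p4:
  shows "\<exists>\<delta>::real. \<delta> > 0 \<and>
    (\<forall>k::nat. k \<ge> 1 \<longrightarrow> (\<forall>\<epsilon>::real. \<epsilon> > 0 \<longrightarrow>
      (\<exists>c::real. c > 0 \<and>
        (\<forall>\<^sub>F n in sequentially.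
          measure_pmf.prob (pmf_of_set (labelled (Ex_cycles (k + 1)) n))
            {R. \<not> (let S = high_degree_verts R n in
              (card S = k \<and> blocker R S) \<and>
              (\<forall>B. blocker R B \<and> \<not> S \<subseteq> B \<longrightarrow> real (card B) > \<delta> * real n) \<and>
              (\<forall>v\<in>S. (1/2 - \<epsilon>) * real n \<le> real (vdegree R v) \<and>
                      real (vdegree R v) \<le> (1/2 + \<epsilon>) * real n))}
          \<le> exp (- c * real n)))))"
proof (rule exI[of _ "1 / 2048 :: real"], intro conjI allI impI)
  \<comment> \<open>Blockers missing a vertex of \<open>S\<close> will have at least
    \<open>n div 1024\<close> vertices; 1/2048 leaves room for the rounding and makes the inequality
    strict.\<close>
  show "(0 :: real) < 1 / 2048" by simp
  fix k :: nat and \<epsilon> :: real assume k: "1 \<le> k" and \<epsilon>: "0 < \<epsilon>"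
  have k0: "0 < k" using k by simp
  \<comment> \<open>Half of \<epsilon> is kept for the at most \<open>k \<le> \<eta> * n\<close>
    edges inside \<open>S\<close>. The cap \<eta> \<le> 1/16 keeps the degrees in \<open>S\<close>
    above 3n/8, hence above n / ln n once ln n \<ge> 4.\<close>
  define \<eta> where "\<eta> = min \<epsilon> (1 / 8) / 2"
  have \<eta>: "0 < \<eta>" "\<eta> \<le> 1 / 16" "2 * \<eta> \<le> \<epsilon>" using \<epsilon> by (auto simp: \<eta>_def)
  obtain y where y: "1 < y" "(1 + y) / 2 * y powr - (1 / 2 + \<eta>) < 1" using chernoff_rate[OF \<eta>(1)] by blast
  define main where "main n = (1 / 2) ^ n + real n / fact (nat \<lfloor>real n / (2 * ln (real n))\<rfloor>) +
    2 ^ n / 16 ^ (n - k - 2 * (n div 64)) +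
    real (n + 1) * exp (- (real (n div 1024 + 1 - k) * (real (n div 1024 + 1 - k) - 1) / (2 * real n))) +
    real k * ((7 / 8) ^ (n div 64) * 2 ^ (n div 1024) + 2 * (((1 + y) / 2) ^ n * y powr - ((1 / 2 + \<eta>) * real n)))" for n
  have "exp_small main" unfolding main_def by (rule exp_small_main[OF y])
  then obtain c1 where c1: "0 < c1" "\<forall>\<^sub>F n in sequentially. main n \<le> exp (- c1 * real n)"
    unfolding exp_small_def by blast
  \<comment> \<open>The first bound keeps the degrees outside \<open>S\<close> below n / ln n; the
    second lets the cost exp ((40 k + 9) \<beta> n) of the extra edges use up at most half of the
    rate \<open>c1\<close>, which was fixed without reference to \<beta>.\<close>
  define \<beta> where "\<beta> = min (1 / (4 * (10 * real k + 2))) (c1 / (2 * (40 * real k + 9)))"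
  have \<beta>0: "0 < \<beta>" using c1 by (auto simp: \<beta>_def)
  have "\<beta> \<le> 1 / (4 * (10 * real k + 2))" by (simp add: \<beta>_def)
  then have \<beta>1: "(10 * real k + 2) * \<beta> \<le> 1 / 4" by (simp add: field_simps)
  have "\<beta> \<le> c1 / (2 * (40 * real k + 9))" by (simp add: \<beta>_def)
  then have "(40 * real k + 9) * \<beta> \<le> c1 / 2" by (simp add: field_simps)
  then have \<beta>2: "(40 * real k + 9) * \<beta> < c1" using c1(1) by linarith
  define h where "h n = nat \<lceil>2 * ln (real n)\<rceil> + 1" for n :: nat
  define K where "K n = nat \<lceil>\<beta> * real n / ln (real n)\<rceil>" for n :: nat
  define M where "M n = (5 * k + 1) * (2 * K n)" for n
  define C where "C = 2 * (5 * k + 1)"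
  define comps where "comps n = (\<Sum>\<kappa>\<in>{K n..n}. (exp 1 * (real n * ln (real n) ^ 2) / real (C * \<kappa>)) ^ (C * \<kappa>) / fact \<kappa>)" for n
  define b where "b n = real (n + 1) ^ (k + k * (2 * h n + 3)) * comps n + real (n + 1) ^ (k + 2 * M n) * main n" for n
  have "exp_small comps" unfolding comps_def K_def by (rule exp_small_many_comps[OF \<beta>0]) (simp add: C_def)
  then have "exp_small (\<lambda>n. real (n + 1) ^ (k + k * (2 * h n + 3)) * comps n)"
    unfolding h_def by (rule exp_small_mult) (rule slack_blocker)
  moreover have "exp_small (\<lambda>n. real (n + 1) ^ (k + 2 * M n) * main n)"
    unfolding M_def K_def by (rule exp_small_mult_rate[OF c1(2) \<beta>2 slack_extra[OF \<beta>0]])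
  ultimately have "exp_small b" unfolding b_def by (rule exp_small_add)
  then have "exp_small (\<lambda>n. real (n + 1) ^ (k + 2) * b n)" by (rule exp_small_mult) (rule subexp_power)
  then have es: "exp_small (\<lambda>n. (2 ^ (k * k) * exp (real k + 1)) * (real (n + 1) ^ (k + 2) * b n))"
    by (rule exp_small_cmult) simp
  let ?X = "\<lambda>n. {R. \<not> (let S = high_degree_verts R n in
              (card S = k \<and> blocker R S) \<and>
              (\<forall>B. blocker R B \<and> \<not> S \<subseteq> B \<longrightarrow> real (card B) > 1 / 2048 * real n) \<and>
              (\<forall>v\<in>S. (1/2 - \<epsilon>) * real n \<le> real (vdegree R v) \<and>
                      real (vdegree R v) \<le> (1/2 + \<epsilon>) * real n))}"
  have "\<forall>\<^sub>F n in sequentially. measure_pmf.prob (pmf_of_set (labelled (Ex_cycles (k + 1)) n)) (?X n)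
      \<le> (2 ^ (k * k) * exp (real k + 1)) * (real (n + 1) ^ (k + 2) * b n)"
    using parameters[OF k0 \<beta>0 \<beta>1 \<eta>(1,2)]
  proof eventually_elim
    case (elim n)
    define d where "d = nat \<lfloor>real n / (2 * ln (real n))\<rfloor>"
    let ?T = "(1 / 2 + \<eta>) * real n"
    have p: "k * (2 * h n + 3) \<le> K n" "0 < K n"
      "real (k * (2 * h n + 3) * n) \<le> real n * ln (real n) ^ 2" "real (C * n) \<le> real n * ln (real n) ^ 2"
      "real (d + M n + k) \<le> real n / ln (real n)" "real k \<le> \<eta> * real n" "4 \<le> ln (real n)" "2048 * (k + 2) \<le> n"
      using elim unfolding h_def K_def M_def C_def d_def by blast+
    have kn: "k < n" "0 < n" using p(8) by auto
    have n_ge: "2048 * k + 4096 \<le> n" using p(8) by simp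
    have aux: "2 * q + k \<le> n" "16 * (2 * q + 1) \<le> n + 1" if "64 * q \<le> n" for q
      using that n_ge by simp_all
    have dv: "64 * (n div 64) \<le> n" "n < 1024 + 1024 * (n div 1024)" "2 * (k + 2) \<le> n div 1024"
      using p(8) dividend_less_times_div[of 1024 n] by (simp_all add: less_eq_div_iff_mult_less_eq)
    have bad: "real (card {E \<in> Ex_edges k {1..n}. \<not> good k {1..n} (d + M n + k) (n div 1024) ?T E})
        \<le> 2 ^ (k * n) * real (n + 1) ^ n * b n"
      unfolding b_def comps_def main_def C_def d_def[symmetric]
    proof (rule card_not_good[where r = 0])
      show "n < 2 ^ h n" unfolding h_def by (rule less_two_power_ln[OF kn(2)])
      \<comment> \<open>The path length is the largest \<open>g\<close> with
        \<open>g + k \<le> t + 1\<close> for \<open>t = n div 1024\<close>.\<close>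
      show "0 < n div 1024 + 1 - k" "n div 1024 + 1 - k + k \<le> n div 1024 + 1" using dv(3) by simp_all
      show "2 * (n div 64) + k \<le> n" by (rule aux(1)[OF dv(1)])
      show "16 * (2 * (n div 64) + 1) \<le> n + 1" by (rule aux(2)[OF dv(1)])
      show "real (2 * (5 * k + 1) * n) \<le> real n * ln (real n) ^ 2" using p(4) by (simp only: C_def)
      show "1 \<le> y" using y(1) by simp
    qed (use p kn k0 in \<open>simp_all add: M_def\<close>)
    have "0 \<le> comps n" unfolding comps_def by (intro sum_nonneg) auto
    moreover have "0 \<le> main n" unfolding main_def using y(1) by (intro add_nonneg_nonneg mult_nonneg_nonneg) auto
    ultimately have b0: "0 \<le> b n" unfolding b_def by simp
    have not_good: "\<not> good k {1..n} (d + M n + k) (n div 1024) ?T (edges R)"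
      if R: "R \<in> labelled (Ex_cycles (k + 1)) n" "R \<in> ?X n" for R
    proof
      assume good: "good k {1..n} (d + M n + k) (n div 1024) ?T (edges R)"
      have e: "\<eta> * real n + \<eta> * real n \<le> \<epsilon> * real n"
        using mult_right_mono[OF \<eta>(3), of "real n"] by simp
      have "real n / ln (real n) \<le> real n / 4" using p(7) by (intro divide_left_mono) auto
      moreover have "\<eta> * real n \<le> 1 / 16 * real n" using \<eta>(2) by (rule mult_right_mono) simp
      ultimately have T3: "real n / ln (real n) \<le> real n - real k - ?T"
        using p(6) unfolding distrib_right by linarith
      have "n < 2048 * (n div 1024)" using dv(2,3) by simp
      then have "real n < real (2048 * (n div 1024))" by (simp only: of_nat_less_iff)
      then have t: "1 / 2048 * real n < real (n div 1024)" by simp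
      have "?T + real k \<le> (1 / 2 + \<epsilon>) * real n" "(1 / 2 - \<epsilon>) * real n \<le> real n - real k - ?T"
        using e p(6) unfolding distrib_right left_diff_distrib by linarith+
      from good_conclusion[OF R(1) good p(5) this T3 t less_imp_le[OF kn(1)]] show False
        using R(2) by blast
    qed
    show ?case by (rule prob_not_good_le[OF kn(1) not_good bad b0])
  qed
  then have "exp_small (\<lambda>n. measure_pmf.prob (pmf_of_set (labelled (Ex_cycles (k + 1)) n)) (?X n))"
    by (rule exp_small_mono[OF es])
  then show "\<exists>c>0. \<forall>\<^sub>F n in sequentially.
      measure_pmf.prob (pmf_of_set (labelled (Ex_cycles (k + 1)) n)) (?X n) \<le> exp (- c * real n)"
    by (simp only: exp_small_def)
qed

end
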